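(* Let $n\geq 5$ be such that $n \not\equiv 0 \pmod{4}$, and let $L$ be a $\mathbb{Z}$-form of the Specht $\mathbb{Q}\mathfrak{S}_n$-module $S^{(n-2,1^2)}_{\mathbb{Q}}$. Let $\{p_1,\ldots,p_g\}$ be the set of prime divisors of $n!=|\mathfrak{S}_n|$. Then for each $j\in\{1,\ldots,g\}$ there exists a unique $N_{p_j} \in X_{p_j}$ such that $$L\cong \bigcap_{j=1}^g N_{p_j}$$ as $\mathbb{Z}\mathfrak{S}_n$-lattices (that is, there is a unique family $(N_{p_1},\ldots,N_{p_g})\in X_{p_1}\times\cdots\times X_{p_g}$ with this property), where the sets $X_p$ of $\mathbb{Z}\mathfrak{S}_n$-sublattices of $S^{(n-2,1^2)}_{\mathbb{Z}}$ are those defined in the context.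
   Context: $\mathfrak{S}_n$ is the symmetric group of degree $n$. A $\mathbb{Z}\mathfrak{S}_n$-lattice is a left $\mathbb{Z}\mathfrak{S}_n$-module that is finitely generated and free over $\mathbb{Z}$; a $\mathbb{Z}$-form of a $\mathbb{Q}\mathfrak{S}_n$-module $V$ is a $\mathbb{Z}\mathfrak{S}_n$-lattice $M$ with $\mathbb{Q}\otimes_{\mathbb{Z}}M\cong V$. $\nu_p$ is the $p$-adic valuation. Let $\mathfrak{S}_n$ permute the standard basis $\mathbf{1},\ldots,\mathbf{n}$ of the natural permutation lattice $M^{(n-1,1)}_{\mathbb{Z}}=\mathbb{Z}^n$. The natural Specht lattice is $M:=S^{(n-1,1)}_{\mathbb{Z}}=\{\sum_i a_i\mathbf{i}:\sum_i a_i=0\}$, with $\mathbb{Z}$-basis $b(i):=\mathbf{i}-\mathbf{1}$, $2\le i\le n$. The Specht lattice labelled by $(n-2,1^2)$ is identified with $S:=S^{(n-2,1^2)}_{\mathbb{Z}}=\bigwedge^2(M)$ (diagonal $\mathfrak{S}_n$-action), with $\mathbb{Z}$-basis $b(i_1,i_2):=(\mathbf{i_1}-\mathbf{1})\wedge(\mathbf{i_2}-\mathbf{1})$, $2\le i_1<i_2\le n$; and $S^{(n-2,1^2)}_{\mathbb{Q}}=\mathbb{Q}\otimes_{\mathbb{Z}}S$. For every divisor $d\in\mathbb{N}$ of $n$, set $M_d:=\mathbb{Z}\sum_{i=2}^n b(i)+dM\subseteq M$, which is a $\mathbb{Z}\mathfrak{S}_n$-sublattice of $M$; $\bigwedge^2(M_d)$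 is regarded as a sublattice of $\bigwedge^2(M)=S$. For every prime number $p\geq 3$ set $X_p:=\{\bigwedge^2(M_{p^i}):0\le i\le\nu_p(n)\}$. If $n$ is odd, set $X_2:=\{S,\hat S_1,\hat S_2\}$, where $\hat S_1:=\{\sum_{2\le i_1<i_2\le n}\alpha(i_1,i_2)b(i_1,i_2):\alpha(i_1,i_2)\in\mathbb{Z},\ \sum\alpha(i_1,i_2)\equiv 0 \pmod 2\}$ and $\hat S_2:=\{\sum_{2\le i_1<i_2\le n}\alpha(i_1,i_2)b(i_1,i_2):\alpha(i_1,i_2)\in\mathbb{Z},\ \alpha(i_1,i_2)\equiv\alpha(n-1,n)\pmod 2 \text{ for all } i_1,i_2\}$. If $n\equiv 2\pmod 4$, set $X_2:=\{S,\hat T_1,\hat T_2,\hat T_3\}$, where $2S\subset\hat T_3\subset\hat T_2\subset\hat T_1\subset S$ is the unique chain of $\mathbb{Z}\mathfrak{S}_n$-sublattices in which each term is a maximal proper $\mathbb{Z}\mathfrak{S}_n$-sublattice of the next (it is unique because the $\mathbb{F}_2\mathfrak{S}_n$-module $S/2S$ is uniserial of composition length $4$). *)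

theory Defs
  imports
    "HOL-Algebra.IntRing"
    "HOL-Algebra.Module"
    "HOL-Algebra.Sym_Groups"
    "HOL-Algebra.Free_Abelian_Groups"
    "HOL-Number_Theory.Cong"
begin

section \<open>Modules over group rings of symmetric groups\<close>

abbreviation rat_ring :: "rat ring"
  where "rat_ring \<equiv> \<lparr>carrier = UNIV, monoid.mult = (*), one = 1, ring.zero = 0, add = (+)\<rparr>"

text \<open>
  A left module over the group ring of the symmetric group of degree \<open>n\<close> with coefficients in
  \<open>R\<close> is an \<open>R\<close>-module with an \<open>R\<close>-linear left action of the group. As for the library record
  for modules, the fields \<open>mult\<close> and \<open>one\<close> inherited from rings carry no meaning.
\<close>

record ('r, 'v) sn_module = "('r, 'v) module" +
  act :: "(nat \<Rightarrow> nat) \<Rightarrow> 'v \<Rightarrow> 'v"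

locale sn_module = module R V
  for n :: nat and R (structure) and V :: "('r, 'v, 'm) sn_module_scheme" (structure) +
  assumes act_closed:
      "\<lbrakk>\<sigma> \<in> carrier (sym_group n); x \<in> carrier V\<rbrakk> \<Longrightarrow> act V \<sigma> x \<in> carrier V"
    and act_add:
      "\<lbrakk>\<sigma> \<in> carrier (sym_group n); x \<in> carrier V; y \<in> carrier V\<rbrakk>
        \<Longrightarrow> act V \<sigma> (x \<oplus>\<^bsub>V\<^esub> y) = act V \<sigma> x \<oplus>\<^bsub>V\<^esub> act V \<sigma> y"
    and act_smult:
      "\<lbrakk>\<sigma> \<in> carrier (sym_group n); r \<in> carrier R; x \<in> carrier V\<rbrakk>
        \<Longrightarrow> act V \<sigma> (r \<odot>\<^bsub>V\<^esub> x) = r \<odot>\<^bsub>V\<^esub> act V \<sigma> x"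
    and act_one:
      "x \<in> carrier V \<Longrightarrow> act V \<one>\<^bsub>sym_group n\<^esub> x = x"
    and act_mult:
      "\<lbrakk>\<sigma> \<in> carrier (sym_group n); \<tau> \<in> carrier (sym_group n); x \<in> carrier V\<rbrakk>
        \<Longrightarrow> act V (\<sigma> \<otimes>\<^bsub>sym_group n\<^esub> \<tau>) x = act V \<sigma> (act V \<tau> x)"

definition sn_iso ::
  "nat \<Rightarrow> ('r, 'k) ring_scheme \<Rightarrow> ('r, 'v) sn_module \<Rightarrow> ('r, 'w) sn_module \<Rightarrow> bool"
  where "sn_iso n R V W \<longleftrightarrow>
    (\<exists>f. bij_betw f (carrier V) (carrier W) \<and>
      (\<forall>x\<in>carrier V. \<forall>y\<in>carrier V. f (x \<oplus>\<^bsub>V\<^esub> y) = f x \<oplus>\<^bsub>W\<^esub> f y) \<and>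
      (\<forall>r\<in>carrier R. \<forall>x\<in>carrier V. f (r \<odot>\<^bsub>V\<^esub> x) = r \<odot>\<^bsub>W\<^esub> f x) \<and>
      (\<forall>\<sigma>\<in>carrier (sym_group n). \<forall>x\<in>carrier V. f (act V \<sigma> x) = act W \<sigma> (f x)))"

definition sn_lattice :: "nat \<Rightarrow> (int, 'v) sn_module \<Rightarrow> bool"
  where "sn_lattice n L \<longleftrightarrow> sn_module n \<Z> L \<and>
    (\<exists>B. finite B \<and> B \<subseteq> carrier L \<and>
      (\<forall>x\<in>carrier L. \<exists>!c. c \<in> B \<rightarrow>\<^sub>E UNIV \<and> x = (\<Oplus>\<^bsub>L\<^esub>b\<in>B. c b \<odot>\<^bsub>L\<^esub> b)))"

definition sn_sublattice :: "nat \<Rightarrow> (int, 'v) sn_module \<Rightarrow> 'v set \<Rightarrow> bool"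
  where "sn_sublattice n L U \<longleftrightarrow>
    submodule U \<Z> L \<and> (\<forall>\<sigma>\<in>carrier (sym_group n). \<forall>x\<in>U. act L \<sigma> x \<in> U)"

definition maximal_sn_sublattice ::
  "nat \<Rightarrow> (int, 'v) sn_module \<Rightarrow> 'v set \<Rightarrow> 'v set \<Rightarrow> bool"
  where "maximal_sn_sublattice n L U W \<longleftrightarrow>
    sn_sublattice n L U \<and> sn_sublattice n L W \<and> U \<subset> W \<and>
    (\<forall>Y. sn_sublattice n L Y \<and> U \<subseteq> Y \<and> Y \<subseteq> W \<longrightarrow> Y = U \<or> Y = W)"


section \<open>Extension of scalars from the integers to the rationals\<close>

text \<open>
  The tensor product of \<open>\<rat>\<close> and \<open>L\<close> over \<open>\<int>\<close> is the free abelian group on the pairs \<open>(q, x)\<close>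
  modulo the usual relations; \<open>(q, x)\<close> stands for the pure tensor of \<open>q\<close> and \<open>x\<close>.
\<close>

definition tensor_gens :: "(int, 'v) sn_module \<Rightarrow> (rat \<times> 'v \<Rightarrow>\<^sub>0 int) monoid"
  where "tensor_gens L = free_Abelian_group (UNIV \<times> carrier L)"

definition tensor_rels :: "(int, 'v) sn_module \<Rightarrow> (rat \<times> 'v \<Rightarrow>\<^sub>0 int) set"
  where "tensor_rels L =
    {frag_of (q + r, x) - frag_of (q, x) - frag_of (r, x) | q r x. x \<in> carrier L} \<union>
    {frag_of (q, x \<oplus>\<^bsub>L\<^esub> y) - frag_of (q, x) - frag_of (q, y) | q x y.
       x \<in> carrier L \<and> y \<in> carrier L} \<union>
    {frag_of (q * of_int k, x) - frag_of (q, k \<odot>\<^bsub>L\<^esub> x) | q k x. x \<in> carrier L}"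

definition tensor_kernel :: "(int, 'v) sn_module \<Rightarrow> (rat \<times> 'v \<Rightarrow>\<^sub>0 int) set"
  where "tensor_kernel L = generate (tensor_gens L) (tensor_rels L)"

text \<open>
  Endomorphisms of the free group that preserve the relations act on cosets: the image of
  a coset lies in a single coset, which is recovered by adding the kernel.
\<close>

definition rat_tensor :: "(int, 'v) sn_module \<Rightarrow> (rat, (rat \<times> 'v \<Rightarrow>\<^sub>0 int) set) sn_module"
  where "rat_tensor L =
    (let F = tensor_gens L; K = tensor_kernel L in
     \<lparr>carrier = carrier (F Mod K),
      monoid.mult = undefined,
      one = undefined,
      ring.zero = \<one>\<^bsub>F Mod K\<^esub>,
      add = (\<otimes>\<^bsub>F Mod K\<^esub>),
      smult = (\<lambda>q T. K <#>\<^bsub>F\<^esub> frag_extend (\<lambda>(r, x). frag_of (q * r, x)) ` T),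
      act = (\<lambda>\<sigma> T. K <#>\<^bsub>F\<^esub> frag_extend (\<lambda>(r, x). frag_of (r, act L \<sigma> x)) ` T)\<rparr>)"

lemma cring_rat_ring: "cring rat_ring"
proof (rule cringI)
  show "abelian_group rat_ring"
  proof (rule abelian_groupI)
    fix x assume "x \<in> carrier rat_ring"
    show "\<exists>y\<in>carrier rat_ring. y \<oplus>\<^bsub>rat_ring\<^esub> x = \<zero>\<^bsub>rat_ring\<^esub>"
      by (rule bexI[of _ "- x"]) simp_all
  qed simp_all
  show "comm_monoid rat_ring"
    by (rule comm_monoidI) simp_all
qed (simp add: distrib_right)

lemma tensor_gens_simps:
  "c \<in> carrier (tensor_gens L) \<longleftrightarrow> Poly_Mapping.keys c \<subseteq> UNIV \<times> carrier L"
  "c \<otimes>\<^bsub>tensor_gens L\<^esub> d = c + d"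
  "\<one>\<^bsub>tensor_gens L\<^esub> = 0"
  "c \<in> carrier (tensor_gens L) \<Longrightarrow> inv\<^bsub>tensor_gens L\<^esub> c = - c"
  by (simp_all add: tensor_gens_def)

lemma tensor_rels_closed:
  assumes "module \<Z> L"
  shows "tensor_rels L \<subseteq> carrier (tensor_gens L)"
proof -
  interpret L: module \<Z> L by fact
  have of: "frag_of (q, x) \<in> carrier (tensor_gens L)" if "x \<in> carrier L" for q x
    using that by (simp add: tensor_gens_simps)
  have diff: "c - d \<in> carrier (tensor_gens L)"
    if "c \<in> carrier (tensor_gens L)" "d \<in> carrier (tensor_gens L)" for c d
    using that keys_diff[of c d] unfolding tensor_gens_simps by blast
  show ?thesis
    by (auto simp: tensor_rels_def intro!: diff of)
qed

lemma tensor_kernel_normal: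
  assumes "module \<Z> L"
  shows "tensor_kernel L \<lhd> tensor_gens L"
proof -
  have comm: "comm_group (tensor_gens L)"
    by (simp add: tensor_gens_def abelian_free_Abelian_group)
  have "subgroup (tensor_kernel L) (tensor_gens L)"
    unfolding tensor_kernel_def
    by (rule group.generate_is_subgroup[OF comm_group.axioms(2)[OF comm]])
       (rule tensor_rels_closed[OF assms])
  with comm show ?thesis
    by (simp add: comm_group.normal_iff_subgroup)
qed

lemma tensor_kernel_closed:
  assumes "module \<Z> L"
  shows "0 \<in> tensor_kernel L"
    and "c \<in> tensor_kernel L \<Longrightarrow> d \<in> tensor_kernel L \<Longrightarrow> c + d \<in> tensor_kernel L"
    and "c \<in> tensor_kernel L \<Longrightarrow> - c \<in> tensor_kernel L"
proof -
  have sub: "subgroup (tensor_kernel L) (tensor_gens L)"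
    using tensor_kernel_normal[OF assms] by (simp add: normal_def)
  show "0 \<in> tensor_kernel L"
    using subgroup.one_closed[OF sub] by (simp add: tensor_gens_simps)
  show "c \<in> tensor_kernel L \<Longrightarrow> d \<in> tensor_kernel L \<Longrightarrow> c + d \<in> tensor_kernel L"
    using subgroup.m_closed[OF sub, of c d] by (simp add: tensor_gens_simps(2))
  show "c \<in> tensor_kernel L \<Longrightarrow> - c \<in> tensor_kernel L"
    using subgroup.m_inv_closed[OF sub, of c] subgroup.mem_carrier[OF sub, of c]
    by (simp add: tensor_gens_simps(4))
qed

lemma tensor_coset_map:
  assumes L: "module \<Z> L"
    and rels: "\<And>c. c \<in> tensor_rels L \<Longrightarrow> frag_extend g c \<in> tensor_kernel L"
  shows "tensor_kernel L <#>\<^bsub>tensor_gens L\<^esub>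
      frag_extend g ` (tensor_kernel L #>\<^bsub>tensor_gens L\<^esub> a) =
    tensor_kernel L #>\<^bsub>tensor_gens L\<^esub> frag_extend g a"
proof -
  let ?K = "tensor_kernel L" and ?F = "tensor_gens L"
  note closed = tensor_kernel_closed[OF L]
  have "frag_extend g k \<in> ?K" if "k \<in> generate ?F (tensor_rels L)" for k
    using that
  proof (induction rule: generate.induct)
    case one
    show ?case using closed(1) by (simp add: tensor_gens_simps)
  next
    case (incl h)
    then show ?case by (rule rels)
  next
    case (inv h)
    then have "h \<in> carrier ?F" using tensor_rels_closed[OF L] by auto
    then show ?case
      using closed(3)[OF rels[OF inv]] by (simp add: tensor_gens_simps(4) frag_extend_minus)
  next
    case (eng h1 h2)
    then show ?case using closed(2) by (simp add: tensor_gens_simps(2) frag_extend_add)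
  qed
  then have map: "frag_extend g k \<in> ?K" if "k \<in> ?K" for k
    using that by (simp add: tensor_kernel_def)
  show ?thesis
    unfolding set_mult_def r_coset_def tensor_gens_simps(2)
  proof (intro equalityI subsetI; clarsimp)
    fix k k' assume "k \<in> ?K" "k' \<in> ?K"
    then show "\<exists>h\<in>?K. k + frag_extend g (k' + a) = h + frag_extend g a"
      by (intro bexI[of _ "k + frag_extend g k'"] closed(2) map) (simp_all add: frag_extend_add)
  next
    fix k assume "k \<in> ?K"
    with closed(1) show "\<exists>h\<in>?K. \<exists>m\<in>?K. k + frag_extend g a = h + frag_extend g (m + a)"
      by (metis add_0)
  qed
qed

lemma sn_module_rat_tensor:
  fixes L :: "(int, 'v) sn_module"
  assumes "sn_module n \<Z> L"
  shows "sn_module n rat_ring (rat_tensor L)"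
proof -
  interpret L: sn_module n \<Z> L by fact
  let ?K = "tensor_kernel L" and ?F = "tensor_gens L" and ?V = "rat_tensor L"
  let ?s = "\<lambda>q::rat. \<lambda>(r, x::'v). frag_of (q * r, x)"
  let ?a = "\<lambda>\<sigma>. \<lambda>(r::rat, x). frag_of (r, act L \<sigma> x)"
  have L: "module \<Z> L" by unfold_locales
  note closed = tensor_kernel_closed[OF L]
  have comm: "comm_group ?F"
    by (simp add: tensor_gens_def abelian_free_Abelian_group)
  have normal: "?K \<lhd> ?F" by (rule tensor_kernel_normal[OF L])
  have relK: "c \<in> ?K" if "c \<in> tensor_rels L" for c
    using that unfolding tensor_kernel_def by (rule generate.incl)
  have rel1: "frag_of (q + r, x) - frag_of (q, x) - frag_of (r, x) \<in> ?K"
    if "x \<in> carrier L" for q r x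
    using that by (intro relK) (unfold tensor_rels_def, blast)
  have rel2: "frag_of (q, x \<oplus>\<^bsub>L\<^esub> y) - frag_of (q, x) - frag_of (q, y) \<in> ?K"
    if "x \<in> carrier L" "y \<in> carrier L" for q x y
    using that by (intro relK) (unfold tensor_rels_def, blast)
  have rel3: "frag_of (q * of_int k, x) - frag_of (q, k \<odot>\<^bsub>L\<^esub> x) \<in> ?K"
    if "x \<in> carrier L" for q k x
    using that by (intro relK) (unfold tensor_rels_def, blast)
  have s: "smult ?V q (?K #>\<^bsub>?F\<^esub> c) = ?K #>\<^bsub>?F\<^esub> frag_extend (?s q) c" for q c
  proof -
    have "frag_extend (?s q) d \<in> ?K" if "d \<in> tensor_rels L" for d
      using that unfolding tensor_rels_def
      by (auto simp: frag_extend_diff distrib_left mult.assoc[symmetric] intro: rel1 rel2 rel3)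
    from tensor_coset_map[OF L this] show ?thesis
      by (simp add: rat_tensor_def Let_def)
  qed
  have a: "act ?V \<sigma> (?K #>\<^bsub>?F\<^esub> c) = ?K #>\<^bsub>?F\<^esub> frag_extend (?a \<sigma>) c"
    if \<sigma>: "\<sigma> \<in> carrier (sym_group n)" for \<sigma> c
  proof -
    have "frag_extend (?a \<sigma>) d \<in> ?K" if "d \<in> tensor_rels L" for d
      using that unfolding tensor_rels_def
    proof (elim UnE CollectE exE conjE)
      fix q r x assume "x \<in> carrier L" "d = frag_of (q + r, x) - frag_of (q, x) - frag_of (r, x)"
      then show ?thesis
        using rel1[OF L.act_closed[OF \<sigma>], of x q r] by (simp add: frag_extend_diff)
    next
      fix q x y assume "x \<in> carrier L" "y \<in> carrier L"
        "d = frag_of (q, x \<oplus>\<^bsub>L\<^esub> y) - frag_of (q, x) - frag_of (q, y)"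
      then show ?thesis
        using rel2[OF L.act_closed[OF \<sigma>] L.act_closed[OF \<sigma>], of x y q]
        by (simp add: frag_extend_diff L.act_add[OF \<sigma>])
    next
      fix q k x assume "x \<in> carrier L" "d = frag_of (q * of_int k, x) - frag_of (q, k \<odot>\<^bsub>L\<^esub> x)"
      then show ?thesis
        using rel3[OF L.act_closed[OF \<sigma>], of x q k]
        by (simp add: frag_extend_diff L.act_smult[OF \<sigma>])
    qed
    from tensor_coset_map[OF L this] show ?thesis
      by (simp add: rat_tensor_def Let_def)
  qed
  have V: "carrier ?V = (\<lambda>c. ?K #>\<^bsub>?F\<^esub> c) ` carrier ?F"
    by (simp add: rat_tensor_def Let_def carrier_FactGroup)
  have p: "(?K #>\<^bsub>?F\<^esub> c) \<oplus>\<^bsub>?V\<^esub> (?K #>\<^bsub>?F\<^esub> d) = ?K #>\<^bsub>?F\<^esub> (c + d)"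
    if "c \<in> carrier ?F" "d \<in> carrier ?F" for c d
    using normal.rcos_sum[OF normal that] by (simp add: rat_tensor_def Let_def tensor_gens_simps(2))
  have sF: "frag_extend (?s q) c \<in> carrier ?F" if "c \<in> carrier ?F" for q c
  proof -
    have "Poly_Mapping.keys (?s q p) \<subseteq> UNIV \<times> carrier L" if "p \<in> Poly_Mapping.keys c" for p
      using that \<open>c \<in> carrier ?F\<close> unfolding tensor_gens_simps by (cases p) auto
    then show ?thesis
      using keys_frag_extend[of "?s q" c] unfolding tensor_gens_simps by blast
  qed
  have aF: "frag_extend (?a \<sigma>) c \<in> carrier ?F"
    if \<sigma>: "\<sigma> \<in> carrier (sym_group n)" and "c \<in> carrier ?F" for \<sigma> c
  proof -
    have "Poly_Mapping.keys (?a \<sigma> p) \<subseteq> UNIV \<times> carrier L" if "p \<in> Poly_Mapping.keys c" for p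
      using that \<open>c \<in> carrier ?F\<close> L.act_closed[OF \<sigma>] unfolding tensor_gens_simps
      by (cases p) auto
    then show ?thesis
      using keys_frag_extend[of "?a \<sigma>" c] unfolding tensor_gens_simps by blast
  qed
  have addF: "c + d \<in> carrier ?F" if "c \<in> carrier ?F" "d \<in> carrier ?F" for c d
    using that keys_add[of c d] unfolding tensor_gens_simps by blast
  have cosetI: "?K #>\<^bsub>?F\<^esub> c = ?K #>\<^bsub>?F\<^esub> d" if "c - d \<in> ?K" for c d
  proof -
    have "\<exists>k'\<in>?K. k + c = k' + d" if "k \<in> ?K" for k
      using closed(2)[OF that \<open>c - d \<in> ?K\<close>] by (rule rev_bexI) simp
    moreover have "\<exists>k'\<in>?K. k + d = k' + c" if "k \<in> ?K" for k
      using closed(2)[OF that closed(3)[OF \<open>c - d \<in> ?K\<close>]] by (rule rev_bexI) simp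
    ultimately show ?thesis
      unfolding r_coset_def tensor_gens_simps(2) set_eq_iff UN_iff singleton_iff by metis
  qed
  have s_add: "frag_extend (?s (q + r)) c - (frag_extend (?s q) c + frag_extend (?s r) c) \<in> ?K"
    if "c \<in> carrier ?F" for q r c
    using that unfolding tensor_gens_simps(1)
  proof (induction c rule: frag_induction)
    case zero
    then show ?case using closed(1) by simp
  next
    case (one p)
    obtain r0 x where "p = (r0, x)" by force
    with one rel1[of x "q * r0" "r * r0"] show ?case by (simp add: distrib_right diff_diff_eq)
  next
    case (diff c d)
    have eq: "frag_extend (?s (q + r)) (c - d) -
        (frag_extend (?s q) (c - d) + frag_extend (?s r) (c - d)) =
      (frag_extend (?s (q + r)) c - (frag_extend (?s q) c + frag_extend (?s r) c))
        + - (frag_extend (?s (q + r)) d - (frag_extend (?s q) d + frag_extend (?s r) d))"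
      unfolding frag_extend_diff by simp
    show ?case
      unfolding eq by (rule closed(2)[OF diff(1) closed(3)[OF diff(2)]])
  qed
  have ext_comp: "frag_extend g (frag_extend h c) = frag_extend k c"
    if "Poly_Mapping.keys c \<subseteq> S" "\<And>p. p \<in> S \<Longrightarrow> frag_extend g (h p) = k p"
    for g h k S and c :: "rat \<times> 'v \<Rightarrow>\<^sub>0 int"
    using that(1) by (induction c rule: frag_induction) (simp_all add: that(2) frag_extend_diff)
  have "module rat_ring ?V"
  proof (rule moduleI)
    show "cring rat_ring" by (rule cring_rat_ring)
    interpret Q: comm_group "?F Mod ?K"
      using comm_group.abelian_FactGroup[OF comm] normal by (simp add: normal_def)
    have Q: "carrier ?V = carrier (?F Mod ?K)" "\<zero>\<^bsub>?V\<^esub> = \<one>\<^bsub>?F Mod ?K\<^esub>"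
      "x \<oplus>\<^bsub>?V\<^esub> y = x \<otimes>\<^bsub>?F Mod ?K\<^esub> y" for x y
      by (simp_all add: rat_tensor_def Let_def)
    show "abelian_group ?V"
    proof (rule abelian_groupI, unfold Q)
      show "\<exists>y\<in>carrier (?F Mod ?K). y \<otimes>\<^bsub>?F Mod ?K\<^esub> x = \<one>\<^bsub>?F Mod ?K\<^esub>"
        if "x \<in> carrier (?F Mod ?K)" for x
        using Q.l_inv[OF that] Q.inv_closed[OF that] by (rule bexI)
    qed (fact Q.m_closed Q.one_closed Q.m_assoc Q.m_comm Q.l_one)+
  next
    fix q x assume "x \<in> carrier ?V"
    then show "q \<odot>\<^bsub>?V\<^esub> x \<in> carrier ?V" unfolding V using sF by (auto simp: s)
  next
    fix q r x assume "x \<in> carrier ?V"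
    then obtain c where c: "c \<in> carrier ?F" "x = ?K #>\<^bsub>?F\<^esub> c" unfolding V by blast
    show "(q \<oplus>\<^bsub>rat_ring\<^esub> r) \<odot>\<^bsub>?V\<^esub> x = q \<odot>\<^bsub>?V\<^esub> x \<oplus>\<^bsub>?V\<^esub> r \<odot>\<^bsub>?V\<^esub> x"
      unfolding c(2) s p[OF sF[OF c(1)] sF[OF c(1)]] using cosetI[OF s_add[OF c(1)]] by simp
    show "(q \<otimes>\<^bsub>rat_ring\<^esub> r) \<odot>\<^bsub>?V\<^esub> x = q \<odot>\<^bsub>?V\<^esub> (r \<odot>\<^bsub>?V\<^esub> x)"
      unfolding c(2) s by (subst ext_comp[of c UNIV _ _ "?s (q * r)"]) (auto simp: mult.assoc)
  next
    fix q x y assume "x \<in> carrier ?V" "y \<in> carrier ?V"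
    then obtain c d where c: "c \<in> carrier ?F" "x = ?K #>\<^bsub>?F\<^esub> c"
      and d: "d \<in> carrier ?F" "y = ?K #>\<^bsub>?F\<^esub> d" unfolding V by blast
    show "q \<odot>\<^bsub>?V\<^esub> (x \<oplus>\<^bsub>?V\<^esub> y) = q \<odot>\<^bsub>?V\<^esub> x \<oplus>\<^bsub>?V\<^esub> q \<odot>\<^bsub>?V\<^esub> y"
      unfolding c(2) d(2) p[OF c(1) d(1)] s p[OF sF[OF c(1)] sF[OF d(1)]] by (simp add: frag_extend_add)
  next
    fix x assume "x \<in> carrier ?V"
    then obtain c where c: "c \<in> carrier ?F" "x = ?K #>\<^bsub>?F\<^esub> c" unfolding V by blast
    have "frag_extend (?s 1) c = c"
      by (subst (2) frag_expansion) (auto intro: frag_extend_eq)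
    then show "\<one>\<^bsub>rat_ring\<^esub> \<odot>\<^bsub>?V\<^esub> x = x" unfolding c(2) s by simp
  qed
  moreover have "sn_module_axioms n rat_ring ?V"
  proof
    fix \<sigma> x assume \<sigma>: "\<sigma> \<in> carrier (sym_group n)" and "x \<in> carrier ?V"
    then obtain c where c: "c \<in> carrier ?F" "x = ?K #>\<^bsub>?F\<^esub> c" unfolding V by blast
    show "act ?V \<sigma> x \<in> carrier ?V" unfolding c(2) a[OF \<sigma>] V using aF[OF \<sigma> c(1)] by blast
    fix q
    have "frag_extend (?a \<sigma>) (frag_extend (?s q) c) = frag_extend (?s q) (frag_extend (?a \<sigma>) c)"
      using ext_comp[of c UNIV "?a \<sigma>" "?s q" "\<lambda>(r, x). frag_of (q * r, act L \<sigma> x)"]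
        ext_comp[of c UNIV "?s q" "?a \<sigma>" "\<lambda>(r, x). frag_of (q * r, act L \<sigma> x)"] by auto
    then show "act ?V \<sigma> (q \<odot>\<^bsub>?V\<^esub> x) = q \<odot>\<^bsub>?V\<^esub> act ?V \<sigma> x"
      unfolding c(2) s a[OF \<sigma>] by simp
    fix \<tau> assume \<tau>: "\<tau> \<in> carrier (sym_group n)"
    have \<sigma>\<tau>: "\<sigma> \<otimes>\<^bsub>sym_group n\<^esub> \<tau> \<in> carrier (sym_group n)"
      using \<sigma> \<tau> by (simp add: group.is_monoid monoid.m_closed sym_group_is_group)
    have "frag_extend (?a (\<sigma> \<otimes>\<^bsub>sym_group n\<^esub> \<tau>)) c = frag_extend (?a \<sigma>) (frag_extend (?a \<tau>) c)"
      using c(1) unfolding tensor_gens_simps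
      by (intro ext_comp[symmetric]) (auto simp: L.act_mult[OF \<sigma> \<tau>])
    then show "act ?V (\<sigma> \<otimes>\<^bsub>sym_group n\<^esub> \<tau>) x = act ?V \<sigma> (act ?V \<tau> x)"
      unfolding c(2) a[OF \<sigma>] a[OF \<tau>] a[OF \<sigma>\<tau>] by simp
  next
    fix \<sigma> x y assume \<sigma>: "\<sigma> \<in> carrier (sym_group n)" and "x \<in> carrier ?V" "y \<in> carrier ?V"
    then obtain c d where c: "c \<in> carrier ?F" "x = ?K #>\<^bsub>?F\<^esub> c"
      and d: "d \<in> carrier ?F" "y = ?K #>\<^bsub>?F\<^esub> d" unfolding V by blast
    show "act ?V \<sigma> (x \<oplus>\<^bsub>?V\<^esub> y) = act ?V \<sigma> x \<oplus>\<^bsub>?V\<^esub> act ?V \<sigma> y"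
      unfolding c(2) d(2) p[OF c(1) d(1)] a[OF \<sigma>] p[OF aF[OF \<sigma> c(1)] aF[OF \<sigma> d(1)]]
      by (simp add: frag_extend_add)
  next
    fix x assume "x \<in> carrier ?V"
    then obtain c where c: "c \<in> carrier ?F" "x = ?K #>\<^bsub>?F\<^esub> c" unfolding V by blast
    have one: "\<one>\<^bsub>sym_group n\<^esub> \<in> carrier (sym_group n)"
      by (simp add: group.is_monoid monoid.one_closed sym_group_is_group)
    have "frag_extend (?a \<one>\<^bsub>sym_group n\<^esub>) c = frag_extend frag_of c"
      using c(1) unfolding tensor_gens_simps by (intro frag_extend_eq) (auto simp: L.act_one)
    then show "act ?V \<one>\<^bsub>sym_group n\<^esub> x = x"
      unfolding c(2) a[OF one] by (simp flip: frag_expansion)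
  qed
  ultimately show ?thesis by (rule sn_module.intro)
qed

definition Z_form :: "nat \<Rightarrow> (rat, 'w) sn_module \<Rightarrow> (int, 'v) sn_module \<Rightarrow> bool"
  where "Z_form n V L \<longleftrightarrow> sn_lattice n L \<and> sn_iso n rat_ring (rat_tensor L) V"


section \<open>The Specht lattices\<close>

text \<open>
  Elements of \<open>\<int>\<^sup>n\<close> are functions supported on \<open>{1..n}\<close>, and \<open>basis_diff i\<close> is the difference
  of the \<open>i\<close>-th and the first standard basis vector.
\<close>

definition perm_lattice :: "nat \<Rightarrow> (int, nat \<Rightarrow> int) sn_module"
  where "perm_lattice n =
    \<lparr>carrier = {a. \<forall>i. i \<notin> {1..n} \<longrightarrow> a i = 0},
     monoid.mult = undefined,
     one = undefined,
     ring.zero = (\<lambda>i. 0),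
     add = (\<lambda>a b i. a i + b i),
     smult = (\<lambda>k a i. k * a i),
     act = (\<lambda>\<sigma> a i. a (inv' \<sigma> i))\<rparr>"

definition natural_specht :: "nat \<Rightarrow> (nat \<Rightarrow> int) set"
  where "natural_specht n = {a \<in> carrier (perm_lattice n). (\<Sum>i=1..n. a i) = 0}"

definition basis_diff :: "nat \<Rightarrow> nat \<Rightarrow> int"
  where "basis_diff i = (\<lambda>j. of_bool (j = i) - of_bool (j = 1))"

definition M_sub :: "nat \<Rightarrow> nat \<Rightarrow> (nat \<Rightarrow> int) set"
  where "M_sub n d =
    {\<lambda>j. k * (\<Sum>i=2..n. basis_diff i j) + int d * m j | k m. m \<in> natural_specht n}"

text \<open>
  The exterior square of \<open>\<int>\<^sup>n\<close> is realised by alternating integer matrices, with \<open>x \<and> y\<close>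
  the matrix \<open>x y\<^sup>T - y x\<^sup>T\<close>. The exterior square of a sublattice embeds into it as the subgroup
  generated by the products \<open>x \<and> y\<close> of its elements.
\<close>

definition wedge :: "(nat \<Rightarrow> int) \<Rightarrow> (nat \<Rightarrow> int) \<Rightarrow> nat \<Rightarrow> nat \<Rightarrow> int"
  where "wedge x y = (\<lambda>i j. x i * y j - y i * x j)"

definition ext_square_perm :: "nat \<Rightarrow> (int, nat \<Rightarrow> nat \<Rightarrow> int) sn_module"
  where "ext_square_perm n =
    \<lparr>carrier = {\<omega>. (\<forall>i. \<omega> i i = 0) \<and> (\<forall>i j. \<omega> i j = - \<omega> j i) \<and>
                   (\<forall>i j. \<omega> i j \<noteq> 0 \<longrightarrow> i \<in> {1..n} \<and> j \<in> {1..n})},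
     monoid.mult = undefined,
     one = undefined,
     ring.zero = (\<lambda>i j. 0),
     add = (\<lambda>\<omega> \<eta> i j. \<omega> i j + \<eta> i j),
     smult = (\<lambda>k \<omega> i j. k * \<omega> i j),
     act = (\<lambda>\<sigma> \<omega> i j. \<omega> (inv' \<sigma> i) (inv' \<sigma> j))\<rparr>"

definition ext_square :: "nat \<Rightarrow> (nat \<Rightarrow> int) set \<Rightarrow> (nat \<Rightarrow> nat \<Rightarrow> int) set"
  where "ext_square n N =
    generate (add_monoid (ext_square_perm n)) {wedge x y | x y. x \<in> N \<and> y \<in> N}"

definition specht_lattice :: "nat \<Rightarrow> (int, nat \<Rightarrow> nat \<Rightarrow> int) sn_module"
  where "specht_lattice n =
    (ext_square_perm n)\<lparr>carrier := ext_square n (natural_specht n)\<rparr>"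

definition wedge_pairs :: "nat \<Rightarrow> (nat \<times> nat) set"
  where "wedge_pairs n = {(i, j). 2 \<le> i \<and> i < j \<and> j \<le> n}"

definition wedge_comb :: "nat \<Rightarrow> (nat \<Rightarrow> nat \<Rightarrow> int) \<Rightarrow> nat \<Rightarrow> nat \<Rightarrow> int"
  where "wedge_comb n \<alpha> =
    (\<lambda>k l. \<Sum>(i, j)\<in>wedge_pairs n. \<alpha> i j * wedge (basis_diff i) (basis_diff j) k l)"


lemma ext_square_perm_carrier_iff:
  "\<omega> \<in> carrier (ext_square_perm n) \<longleftrightarrow> (\<forall>i. \<omega> i i = 0) \<and> (\<forall>i j. \<omega> i j + \<omega> j i = 0) \<and>
    (\<forall>i j. i \<notin> {1..n} \<or> j \<notin> {1..n} \<longrightarrow> \<omega> i j = 0)"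
  unfolding ext_square_perm_def partial_object.simps mem_Collect_eq eq_neg_iff_add_eq_0 by blast

lemma ext_square_perm_simps:
  "\<zero>\<^bsub>ext_square_perm n\<^esub> = (\<lambda>i j. 0)"
  "\<omega> \<oplus>\<^bsub>ext_square_perm n\<^esub> \<eta> = (\<lambda>i j. \<omega> i j + \<eta> i j)"
  "k \<odot>\<^bsub>ext_square_perm n\<^esub> \<omega> = (\<lambda>i j. k * \<omega> i j)"
  "act (ext_square_perm n) \<sigma> \<omega> = (\<lambda>i j. \<omega> (inv' \<sigma> i) (inv' \<sigma> j))"
  by (simp_all add: ext_square_perm_def)

lemma sn_module_ext_square_perm: "sn_module n \<Z> (ext_square_perm n)"
proof -
  have "module \<Z> (ext_square_perm n)"
  proof (rule moduleI)
    show "cring \<Z>" by (rule int_is_cring)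
    show "abelian_group (ext_square_perm n)"
    proof (rule abelian_groupI)
      fix x y assume x: "x \<in> carrier (ext_square_perm n)" and y: "y \<in> carrier (ext_square_perm n)"
      have "x i j + y i j + (x j i + y j i) = (x i j + x j i) + (y i j + y j i)" for i j
        by simp
      with x y show "x \<oplus>\<^bsub>ext_square_perm n\<^esub> y \<in> carrier (ext_square_perm n)"
        unfolding ext_square_perm_carrier_iff ext_square_perm_simps by (metis add_0)
    next
      fix x assume x: "x \<in> carrier (ext_square_perm n)"
      have "- x i j + - x j i = - (x i j + x j i)" for i j
        by simp
      with x have "(\<lambda>i j. - x i j) \<in> carrier (ext_square_perm n)"
        unfolding ext_square_perm_carrier_iff by (metis minus_zero)
      then show "\<exists>y\<in>carrier (ext_square_perm n).
          y \<oplus>\<^bsub>ext_square_perm n\<^esub> x = \<zero>\<^bsub>ext_square_perm n\<^esub>"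
        by (rule rev_bexI) (simp add: ext_square_perm_simps)
    qed (simp_all add: ext_square_perm_carrier_iff ext_square_perm_simps ac_simps)
  next
    fix k x assume x: "x \<in> carrier (ext_square_perm n)"
    have "k * x i j + k * x j i = k * (x i j + x j i)" for i j
      by (simp add: distrib_left)
    with x show "k \<odot>\<^bsub>ext_square_perm n\<^esub> x \<in> carrier (ext_square_perm n)"
      unfolding ext_square_perm_carrier_iff ext_square_perm_simps by (metis mult_zero_right)
  qed (simp_all add: ext_square_perm_simps algebra_simps)
  moreover have "sn_module_axioms n \<Z> (ext_square_perm n)"
  proof
    fix \<sigma> x assume \<sigma>: "\<sigma> \<in> carrier (sym_group n)" and x: "x \<in> carrier (ext_square_perm n)"
    have "inv' \<sigma> i \<in> {1..n} \<longleftrightarrow> i \<in> {1..n}" for i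
      using \<sigma> by (meson permutes_in_image permutes_inv sym_group_carrier)
    with x show "act (ext_square_perm n) \<sigma> x \<in> carrier (ext_square_perm n)"
      unfolding ext_square_perm_carrier_iff ext_square_perm_simps by blast
  next
    fix \<sigma> \<tau> x assume "\<sigma> \<in> carrier (sym_group n)" "\<tau> \<in> carrier (sym_group n)"
    then have "inv' (\<sigma> \<circ> \<tau>) = inv' \<tau> \<circ> inv' \<sigma>"
      by (intro o_inv_distrib) (auto simp: sym_group_carrier permutes_bij)
    then show "act (ext_square_perm n) (\<sigma> \<otimes>\<^bsub>sym_group n\<^esub> \<tau>) x =
        act (ext_square_perm n) \<sigma> (act (ext_square_perm n) \<tau> x)"
      by (simp add: ext_square_perm_simps sym_group_mult)
  qed (simp_all add: ext_square_perm_simps sym_group_one)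
  ultimately show ?thesis by (rule sn_module.intro)
qed

lemma act_wedge:
  "act (ext_square_perm n) \<sigma> (wedge x y) =
    wedge (act (perm_lattice n) \<sigma> x) (act (perm_lattice n) \<sigma> y)"
  by (simp add: ext_square_perm_def perm_lattice_def wedge_def)

lemma finite_wedge_pairs: "finite (wedge_pairs n)"
  by (rule finite_subset[of _ "{0..n} \<times> {0..n}"]) (auto simp: wedge_pairs_def)

lemma wedge_comb_coeff:
  assumes "(k, l) \<in> wedge_pairs n"
  shows "wedge_comb n \<alpha> k l = \<alpha> k l"
proof -
  have "wedge_comb n \<alpha> k l = (\<Sum>q\<in>wedge_pairs n. if q = (k, l) then \<alpha> k l else 0)"
    unfolding wedge_comb_def
    by (rule sum.cong)
       (use assms in \<open>auto simp: wedge_pairs_def wedge_def basis_diff_def split: if_splits\<close>)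
  with assms show ?thesis
    by (simp add: finite_wedge_pairs)
qed

text \<open>
  The products \<open>wedge (basis_diff i) (basis_diff j)\<close> with \<open>2 \<le> i < j \<le> n\<close> form a \<open>\<int>\<close>-basis:
  they generate by the next lemma, and coefficients are unique by the previous one.
\<close>

lemma carrier_specht_lattice: "carrier (specht_lattice n) = range (wedge_comb n)"
proof -
  let ?E = "ext_square_perm n"
  interpret E: sn_module n \<Z> ?E by (rule sn_module_ext_square_perm)
  define P where "P = {\<omega> \<in> carrier ?E. \<forall>k. (\<Sum>l=1..n. \<omega> k l) = 0}"
  have addP: "(\<lambda>k l. \<omega> k l + \<eta> k l) \<in> P" if "\<omega> \<in> P" "\<eta> \<in> P" for \<omega> \<eta>
    using that E.M.add.m_closed[of \<omega> \<eta>]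
    by (auto simp: P_def ext_square_perm_simps sum.distrib)
  have wedgeP: "wedge x y \<in> P" if "x \<in> natural_specht n" "y \<in> natural_specht n" for x y
    using that unfolding P_def ext_square_perm_carrier_iff wedge_def natural_specht_def perm_lattice_def
    by (auto simp: sum_subtractf simp flip: sum_distrib_left)
  have scaleP: "(\<lambda>k l. c * \<omega> k l) \<in> P" if "\<omega> \<in> P" for c \<omega>
    using that E.smult_closed[of c \<omega>]
    by (auto simp: P_def ext_square_perm_simps simp flip: sum_distrib_left)
  have zeroP: "(\<lambda>k l. 0) \<in> P"
    by (simp add: P_def ext_square_perm_carrier_iff)
  have P_eqI: "\<omega> = \<eta>" if P: "\<omega> \<in> P" "\<eta> \<in> P" and eq: "\<forall>(k, l)\<in>wedge_pairs n. \<omega> k l = \<eta> k l"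
    for \<omega> \<eta>
  proof -
    define \<delta> where "\<delta> = (\<lambda>k l. \<omega> k l + (-1) * \<eta> k l)"
    have \<delta>P: "\<delta> \<in> P" unfolding \<delta>_def using P by (intro addP scaleP)
    have E: "\<delta> \<in> carrier ?E" using \<delta>P by (simp add: P_def)
    have anti: "\<delta> k l = - \<delta> l k" for k l
      using E unfolding ext_square_perm_carrier_iff by (metis add_eq_0_iff)
    have *: "\<delta> k l = 0" if "k \<noteq> 1" "l \<noteq> 1" for k l
    proof -
      consider "(k, l) \<in> wedge_pairs n" | "(l, k) \<in> wedge_pairs n" | "k = l"
        | "k \<notin> {1..n} \<or> l \<notin> {1..n}"
        using \<open>k \<noteq> 1\<close> \<open>l \<noteq> 1\<close> unfolding wedge_pairs_def by fastforce
      then show ?thesis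
      proof cases
        case 1 then show ?thesis using eq by (auto simp: \<delta>_def)
      next
        case 2 then have "\<delta> l k = 0" using eq by (auto simp: \<delta>_def)
        then show ?thesis using anti[of k l] by simp
      next
        case 3 then show ?thesis using E by (simp add: ext_square_perm_carrier_iff)
      next
        case 4 then show ?thesis using E by (auto simp: ext_square_perm_carrier_iff)
      qed
    qed
    have col: "\<delta> k 1 = 0" for k
    proof (cases "k = 1 \<or> n = 0")
      case True
      then show ?thesis using E by (auto simp: ext_square_perm_carrier_iff)
    next
      case False
      have "0 = (\<Sum>l=1..n. \<delta> k l)" using \<delta>P by (simp add: P_def)
      also have "\<dots> = \<delta> k 1 + (\<Sum>l\<in>{1..n}-{1}. \<delta> k l)"
        using False by (intro sum.remove) auto
      also have "(\<Sum>l\<in>{1..n}-{1}. \<delta> k l) = 0"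
        using False * by (intro sum.neutral) auto
      finally show ?thesis by simp
    qed
    have "\<delta> k l = 0" for k l
      using *[of k l] col[of k] col[of l] anti[of k l] by (cases "k = 1"; cases "l = 1") auto
    then show ?thesis by (auto simp: \<delta>_def fun_eq_iff)
  qed
  have basis: "basis_diff i \<in> natural_specht n" if "2 \<le> i" "i \<le> n" for i
    using that by (auto simp: natural_specht_def perm_lattice_def basis_diff_def sum_subtractf of_bool_def)
  have combP: "wedge_comb n \<alpha> \<in> P" for \<alpha>
  proof -
    have "A \<subseteq> wedge_pairs n \<Longrightarrow>
        (\<lambda>k l. \<Sum>(i, j)\<in>A. \<alpha> i j * wedge (basis_diff i) (basis_diff j) k l) \<in> P" if "finite A" for A
      using that
    proof induction
      case empty then show ?case by (simp add: zeroP)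
    next
      case (insert q A)
      obtain i j where q: "q = (i, j)" by force
      have "(\<lambda>k l. \<alpha> i j * wedge (basis_diff i) (basis_diff j) k l) \<in> P"
        using insert.prems q by (intro scaleP wedgeP basis) (auto simp: wedge_pairs_def)
      from addP[OF this insert.IH] insert.prems insert.hyps show ?case by (simp add: q)
    qed
    from this[OF finite_wedge_pairs] show ?thesis by (simp add: wedge_comb_def)
  qed
  have neg: "\<ominus>\<^bsub>?E\<^esub> \<omega> = (\<lambda>k l. (-1) * \<omega> k l)" if "\<omega> \<in> carrier ?E" for \<omega>
    using E.smult_l_minus[of 1 \<omega>] that E.smult_one[of \<omega>] by (simp add: ext_square_perm_simps)
  have "\<omega> \<in> P" if "\<omega> \<in> ext_square n (natural_specht n)" for \<omega>
    using that unfolding ext_square_def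
  proof (induction rule: generate.induct)
    case one
    then show ?case by (simp add: zeroP ext_square_perm_simps)
  next
    case (incl h)
    then show ?case using wedgeP by auto
  next
    case (inv h)
    then have "h \<in> P" using wedgeP by auto
    then show ?case using neg[of h] scaleP[of h "-1"] by (simp add: P_def a_inv_def)
  next
    case (eng g h)
    then show ?case using addP by (simp add: ext_square_perm_simps)
  qed
  then have "\<omega> = wedge_comb n \<omega>" if "\<omega> \<in> ext_square n (natural_specht n)" for \<omega>
    using that combP by (intro P_eqI) (auto simp: wedge_comb_coeff)
  moreover have "wedge_comb n \<alpha> \<in> ext_square n (natural_specht n)" for \<alpha>
  proof -
    have "A \<subseteq> wedge_pairs n \<Longrightarrow>
        (\<lambda>k l. \<Sum>(i, j)\<in>A. \<alpha> i j * wedge (basis_diff i) (basis_diff j) k l)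
          \<in> ext_square n (natural_specht n)" if "finite A" for A
      using that
    proof induction
      case empty
      then show ?case
        using generate.one[of "add_monoid ?E"] by (simp add: ext_square_def ext_square_perm_simps)
    next
      case (insert q A)
      obtain i j where q: "q = (i, j)" by force
      let ?x = "\<lambda>k. \<alpha> i j * basis_diff i k"
      have "?x \<in> natural_specht n" "basis_diff j \<in> natural_specht n"
        using insert.prems q basis[of i] basis[of j]
        by (auto simp: wedge_pairs_def natural_specht_def perm_lattice_def simp flip: sum_distrib_left)
      then have "wedge ?x (basis_diff j) \<in> ext_square n (natural_specht n)"
        unfolding ext_square_def by (intro generate.incl) auto
      moreover have "wedge ?x (basis_diff j) = (\<lambda>k l. \<alpha> i j * wedge (basis_diff i) (basis_diff j) k l)"
        by (simp add: wedge_def fun_eq_iff algebra_simps)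
      ultimately show ?case
        using generate.eng[of _ "add_monoid ?E" "{wedge x y |x y. x \<in> natural_specht n \<and> y \<in> natural_specht n}",
            folded ext_square_def] insert
        by (simp add: q ext_square_perm_simps)
    qed
    from this[OF finite_wedge_pairs] show ?thesis by (simp add: wedge_comb_def)
  qed
  ultimately show ?thesis by (auto simp: specht_lattice_def)
qed


section \<open>The sets of representatives\<close>

definition S_hat1 :: "nat \<Rightarrow> (nat \<Rightarrow> nat \<Rightarrow> int) set"
  where "S_hat1 n = {wedge_comb n \<alpha> | \<alpha>. [(\<Sum>(i, j)\<in>wedge_pairs n. \<alpha> i j) = 0] (mod 2)}"

definition S_hat2 :: "nat \<Rightarrow> (nat \<Rightarrow> nat \<Rightarrow> int) set"
  where "S_hat2 n =
    {wedge_comb n \<alpha> | \<alpha>. \<forall>(i, j)\<in>wedge_pairs n. [\<alpha> i j = \<alpha> (n - 1) n] (mod 2)}"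

definition T_chain ::
  "nat \<Rightarrow> (nat \<Rightarrow> nat \<Rightarrow> int) set \<Rightarrow> (nat \<Rightarrow> nat \<Rightarrow> int) set \<Rightarrow> (nat \<Rightarrow> nat \<Rightarrow> int) set \<Rightarrow> bool"
  where "T_chain n T1 T2 T3 \<longleftrightarrow>
    (let S = specht_lattice n; twoS = (\<lambda>\<omega>. 2 \<odot>\<^bsub>S\<^esub> \<omega>) ` carrier S in
     maximal_sn_sublattice n S twoS T3 \<and> maximal_sn_sublattice n S T3 T2 \<and>
     maximal_sn_sublattice n S T2 T1 \<and> maximal_sn_sublattice n S T1 (carrier S))"

text \<open>
  The value of \<open>X_set n 2\<close> is meaningful only if 4 does not divide \<open>n\<close>: the last case is meant
  for \<open>n\<close> congruent to 2 modulo 4, where the chain exists and is unique.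
\<close>

definition X_set :: "nat \<Rightarrow> nat \<Rightarrow> (nat \<Rightarrow> nat \<Rightarrow> int) set set"
  where "X_set n p =
    (if p \<noteq> 2 then {ext_square n (M_sub n (p ^ i)) | i. i \<le> multiplicity p n}
     else if odd n then {carrier (specht_lattice n), S_hat1 n, S_hat2 n}
     else (case (THE (T1, T2, T3). T_chain n T1 T2 T3) of (T1, T2, T3) \<Rightarrow>
       {carrier (specht_lattice n), T1, T2, T3}))"

end

theory Submission
  imports Defs "HOL-Library.Function_Algebras"
begin

text \<open>
  The Specht lattice is the cycle space of the complete graph: alternating integer matrices with
  vanishing row sums. For distinct \<open>i, j, k, l\<close> the operator \<open>(1 - (i j)) (1 - (k l))\<close> sends a cycle
  \<open>x\<close> to \<open>csq i j k l x\<close> times the square \<open>sq i j k l = (i - j) \<and> (k - l)\<close>. If \<open>d\<close> generates the ideal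
  of all values \<open>csq i j k l x\<close> with \<open>x\<close> in an invariant lattice \<open>U\<close>, then \<open>U\<close> therefore contains
  \<open>d Q\<close> and lies in \<open>d Q\<^sup>#\<close>, where \<open>Q\<close> is the span of the squares, a sublattice of index 2, and
  \<open>Q\<^sup>#\<close> is its dual. As \<open>Q\<^sup>#/Q\<close> is small, the lattices of \<open>p\<close>-power index are found by hand: up to
  powers of \<open>p\<close> these are the lattices \<open>tri_lat n (p ^ i)\<close> of cycles whose values on triangles vanish
  modulo \<open>p ^ i\<close> and, if \<open>p = 2\<close>, also \<open>Q\<close> and the lattice of cycles whose values on triangles all
  have the same parity. An isomorphism between two invariant lattices commutes with these operators
  and so is a scalar; hence a \<open>\<int>\<close>-form is determined by its localizations up to powers of \<open>p\<close>.
\<close>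

subsection \<open>Cycles of the complete graph\<close>

text \<open>Square values do not see a single edge. Row sums express \<open>n * x i j\<close>
  through triangle values, and squares control the triangle values only up to a common value
  \<open>e\<close> with \<open>2 * e\<close> divisible by the content. So beyond the content only
  the prime 2 and the primes dividing \<open>n\<close> leave any freedom:
  \<open>multiplicity p n\<close> bounds it for odd \<open>p\<close>, and at 2 the assumption that 4
  does not divide \<open>n\<close> keeps the loss down to one factor 2. All arguments stay inside
  the integral cycles. Two lattices are proportional if their images under \<open>smul a\<close> and
  \<open>smul b\<close> agree for some nonzero integers, and localizing at \<open>p\<close> means
  allowing multipliers prime to \<open>p\<close>. A \<int>-form is given only through its scalar
  extension, a quotient of a free abelian group. It is first embedded into the cycles: a finite
  basis has a common denominator, and integral linear forms detect when two pure tensors agree.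
  After rescaling, the embedded lattice contains \<open>smul (4 * int n)\<close> of every cycle, so
  only primes up to \<open>n\<close> occur.\<close>

type_synonym mat = "nat \<Rightarrow> nat \<Rightarrow> int"

definition smul :: "int \<Rightarrow> mat \<Rightarrow> mat"
  where "smul c x = (\<lambda>i j. c * x i j)"

text \<open>Composition with \<open>\<sigma>\<close> is the action of the inverse permutation. For
  lattices stable under all permutations the direction does not matter; it is restored when
  \<open>act\<close> is compared with \<open>relabel\<close>.\<close>

definition relabel :: "(nat \<Rightarrow> nat) \<Rightarrow> mat \<Rightarrow> mat"
  where "relabel \<sigma> x = (\<lambda>i j. x (\<sigma> i) (\<sigma> j))"

text \<open>
  Alternating matrices with vanishing row sums are the integral cycles of the complete graph on
  \<open>{1..n}\<close>.
\<close>

definition cycles :: "nat \<Rightarrow> mat set"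
  where "cycles n = {x. (\<forall>i j. x i j + x j i = 0) \<and>
    (\<forall>i j. x i j \<noteq> 0 \<longrightarrow> i \<in> {1..n} \<and> j \<in> {1..n}) \<and> (\<forall>i. (\<Sum>j=1..n. x i j) = 0)}"

lemma smul_apply [simp]: "smul c x i j = c * x i j"
  by (simp add: smul_def)

lemma relabel_apply [simp]: "relabel \<sigma> x i j = x (\<sigma> i) (\<sigma> j)"
  by (simp add: relabel_def)

lemma sum_fun_apply: "(\<Sum>a\<in>A. f a) x = (\<Sum>a\<in>A. f a x)"
  by (induction A rule: infinite_finite_induct) simp_all

lemma smul_smul: "smul a (smul b x) = smul (a * b) x"
  by (simp add: smul_def mult.assoc)

lemma smul_1 [simp]: "smul 1 x = x"
  by (simp add: smul_def)

lemma smul_0_left [simp]: "smul 0 x = 0"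
  by (simp add: smul_def fun_eq_iff)

lemma smul_0_right [simp]: "smul c 0 = 0"
  by (simp add: smul_def fun_eq_iff)

lemma smul_add: "smul c (x + y) = smul c x + smul c y"
  by (simp add: smul_def fun_eq_iff distrib_left)

lemma smul_diff: "smul c (x - y) = smul c x - smul c y"
  by (simp add: smul_def fun_eq_iff right_diff_distrib)

lemma smul_add_left: "smul (a + b) x = smul a x + smul b x"
  by (simp add: smul_def fun_eq_iff distrib_right)

lemma smul_diff_left: "smul (a - b) x = smul a x - smul b x"
  by (simp add: smul_def fun_eq_iff left_diff_distrib)

lemma smul_minus_left: "smul (- a) x = - smul a x"
  by (simp add: smul_def fun_eq_iff)

lemma smul_sum: "smul c (\<Sum>a\<in>A. f a) = (\<Sum>a\<in>A. smul c (f a))"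
  by (simp add: fun_eq_iff sum_fun_apply sum_distrib_left)

lemma smul_cancel: "c \<noteq> 0 \<Longrightarrow> smul c x = smul c y \<longleftrightarrow> x = y"
  by (simp add: smul_def fun_eq_iff)

lemma relabel_add: "relabel \<sigma> (x + y) = relabel \<sigma> x + relabel \<sigma> y"
  by (simp add: relabel_def fun_eq_iff)

lemma relabel_smul: "relabel \<sigma> (smul c x) = smul c (relabel \<sigma> x)"
  by (simp add: relabel_def fun_eq_iff)

lemma cyclesD:
  assumes "x \<in> cycles n"
  shows cycles_anti: "x j i = - x i j"
    and cycles_diag: "x i i = 0"
    and cycles_outside: "i \<notin> {1..n} \<or> j \<notin> {1..n} \<Longrightarrow> x i j = 0"
    and cycles_row: "(\<Sum>j=1..n. x i j) = 0"
proof -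
  have anti: "x i j + x j i = 0" for i j using assms unfolding cycles_def by blast
  show "x j i = - x i j" using anti[of i j] by simp
  show "x i i = 0" using anti[of i i] by simp
qed (use assms in \<open>auto simp: cycles_def\<close>)

lemma cyclesI:
  assumes "\<And>i j. x i j = - x j i" "\<And>i j. i \<notin> {1..n} \<or> j \<notin> {1..n} \<Longrightarrow> x i j = 0"
    "\<And>i. i \<in> {1..n} \<Longrightarrow> (\<Sum>j=1..n. x i j) = 0"
  shows "x \<in> cycles n"
proof -
  have "(\<Sum>j=1..n. x i j) = 0" for i
    using assms(2,3)[of i] by (cases "i \<in> {1..n}") (auto intro!: sum.neutral)
  moreover have "x i j + x j i = 0" for i j using assms(1)[of i j] by simp
  ultimately show ?thesis using assms(2) unfolding cycles_def by blast
qed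

lemma sum_permutes:
  "\<sigma> permutes {1..n} \<Longrightarrow> (\<Sum>j=1..n. f (\<sigma> j)) = (\<Sum>j=1..n. f j)" for f :: "nat \<Rightarrow> 'a::comm_monoid_add"
  using sum.permute[of \<sigma> "{1..n}" f] by (simp add: comp_def)

section \<open>Lattices of cycles stable under relabelling\<close>

locale sublat =
  fixes n :: nat and U :: "mat set"
  assumes sub: "U \<subseteq> cycles n"
    and zero [simp]: "0 \<in> U"
    and diff: "x \<in> U \<Longrightarrow> y \<in> U \<Longrightarrow> x - y \<in> U"
    and relabel: "\<sigma> permutes {1..n} \<Longrightarrow> x \<in> U \<Longrightarrow> relabel \<sigma> x \<in> U"
begin

lemma minus: "x \<in> U \<Longrightarrow> - x \<in> U"
  using diff[of 0 x] by simp

lemma add: "x \<in> U \<Longrightarrow> y \<in> U \<Longrightarrow> x + y \<in> U"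
  using diff[of x "- y"] minus by simp

lemma sum: "(\<And>a. a \<in> A \<Longrightarrow> f a \<in> U) \<Longrightarrow> (\<Sum>a\<in>A. f a) \<in> U"
  by (induction A rule: infinite_finite_induct) (auto intro: add)

lemma smul: "x \<in> U \<Longrightarrow> smul c x \<in> U"
proof (induction c rule: int_induct[where k = 0])
  case (step1 i)
  then show ?case using add[of "smul i x" x] by (simp only: smul_add_left smul_1)
next
  case (step2 i)
  then show ?case using diff[of "smul i x" x] by (simp only: smul_diff_left smul_1)
qed simp

lemma smul_gcd:
  assumes "smul a x \<in> U" "smul b x \<in> U"
  shows "smul (gcd a b) x \<in> U"
proof -
  obtain u v where uv: "u * a + v * b = gcd a b" using bezout_int by blast
  have "smul u (smul a x) + smul v (smul b x) \<in> U"
    by (intro add smul[OF assms(1)] smul[OF assms(2)])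
  then show ?thesis by (simp add: smul_smul uv flip: smul_add_left)
qed

lemma smul_dvd: "smul a x \<in> U \<Longrightarrow> a dvd b \<Longrightarrow> smul b x \<in> U"
  using smul[of "smul a x"] by (auto simp: smul_smul mult.commute elim!: dvdE)

text \<open>The integers that multiply \<open>x\<close> into \<open>U\<close> form an ideal. This is
  how factors prime to \<open>p\<close> are discarded without denominators.\<close>

lemma smul_coprime:
  assumes "smul a x \<in> U" "smul b x \<in> U" "coprime a b"
  shows "x \<in> U"
proof -
  have "gcd a b = 1" using assms(3) by simp
  with smul_gcd[OF assms(1,2)] have "smul 1 x \<in> U" by (simp only:)
  then show ?thesis by (simp only: smul_1)
qed

end

lemma sublat_cycles: "sublat n (cycles n)"
proof
  fix x y assume "x \<in> cycles n" "y \<in> cycles n"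
  note x = cyclesD[OF this(1)] and y = cyclesD[OF this(2)]
  show "x - y \<in> cycles n"
  proof (rule cyclesI)
    show "(x - y) i j = - (x - y) j i" for i j using x(1)[of i j] y(1)[of i j] by simp
  qed (use x(3,4) y(3,4) in \<open>auto simp: sum_subtractf\<close>)
next
  fix x \<sigma> assume \<sigma>: "\<sigma> permutes {1..n}" and "x \<in> cycles n"
  note x = cyclesD[OF this(2)]
  show "relabel \<sigma> x \<in> cycles n"
  proof (rule cyclesI)
    show "relabel \<sigma> x i j = - relabel \<sigma> x j i" for i j using x(1)[of "\<sigma> i" "\<sigma> j"] by simp
    show "relabel \<sigma> x i j = 0" if "i \<notin> {1..n} \<or> j \<notin> {1..n}" for i j
      using x(3) that permutes_in_image[OF \<sigma>] unfolding relabel_apply by blast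
    show "(\<Sum>j=1..n. relabel \<sigma> x i j) = 0" for i
      using x(4) sum_permutes[OF \<sigma>, of "x (\<sigma> i)"] by simp
  qed
qed (auto simp: cycles_def)

interpretation cycles: sublat n "cycles n" for n by (rule sublat_cycles)

lemma cycles_divide:
  assumes "x \<in> cycles n" "c \<noteq> 0" "\<And>i j. i \<in> {1..n} \<Longrightarrow> j \<in> {1..n} \<Longrightarrow> c dvd x i j"
  obtains y where "y \<in> cycles n" "x = smul c y"
proof -
  note x = cyclesD[OF assms(1)]
  define y where "y = (\<lambda>i j. x i j div c)"
  have dvd: "c dvd x i j" for i j
    using assms(3) x(3)[of i j] by (cases "i \<in> {1..n} \<and> j \<in> {1..n}") auto
  then have xy: "x = smul c y" by (simp add: y_def fun_eq_iff)
  have "y \<in> cycles n"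
  proof (rule cyclesI)
    show "y i j = - y j i" for i j 
    proof -
      have "c * y i j = c * (- y j i)" using x(1)[of i j] by (simp add: xy)
      then show ?thesis using assms(2) by (metis mult_left_cancel)
    qed
    show "y i j = 0" if "i \<notin> {1..n} \<or> j \<notin> {1..n}" for i j using x(3)[OF that] by (simp add: y_def)
    show "(\<Sum>j=1..n. y i j) = 0" for i
      using x(4)[of i] assms(2) by (simp add: xy flip: sum_distrib_left)
  qed
  with xy that show ?thesis by blast
qed

subsection \<open>Triangles and squares\<close>

text \<open>Expanded, this is i \<and> j + j \<and> k + k \<and> i, the oriented boundary of a
  triangle.\<close>

definition tri :: "nat \<Rightarrow> nat \<Rightarrow> nat \<Rightarrow> mat"
  where "tri i j k = wedge (\<lambda>a. of_bool (a = j) - of_bool (a = i)) (\<lambda>a. of_bool (a = k) - of_bool (a = i))"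

text \<open>The four-cycle through \<open>i\<close>, \<open>k\<close>, \<open>j\<close>,
  \<open>l\<close> in this order.\<close>

definition sq :: "nat \<Rightarrow> nat \<Rightarrow> nat \<Rightarrow> nat \<Rightarrow> mat"
  where "sq i j k l = wedge (\<lambda>a. of_bool (a = i) - of_bool (a = j)) (\<lambda>a. of_bool (a = k) - of_bool (a = l))"

definition tau :: "nat \<Rightarrow> nat \<Rightarrow> nat \<Rightarrow> mat \<Rightarrow> int"
  where "tau i j k x = x i j + x j k + x k i"

text \<open>For an alternating matrix this is the sum of the values along the four-cycle
  \<open>sq i j k l\<close>, as \<open>tau\<close> is along a triangle.\<close>

definition csq :: "nat \<Rightarrow> nat \<Rightarrow> nat \<Rightarrow> nat \<Rightarrow> mat \<Rightarrow> int"
  where "csq i j k l x = x i k - x j k - x i l + x j l"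

text \<open>The sum of the coordinates in the basis \<open>tri 1 i j\<close>. It depends on the base
  vertex 1, but its parity is invariant under relabelling.\<close>

definition par :: "nat \<Rightarrow> mat \<Rightarrow> int"
  where "par n x = (\<Sum>(i, j)\<in>wedge_pairs n. x i j)"

lemma par_diff: "par n (x - y) = par n x - par n y"
  by (simp add: par_def case_prod_unfold sum_subtractf)

lemma par_smul: "par n (smul c x) = c * par n x"
  by (simp add: par_def case_prod_unfold sum_distrib_left)

lemma wedge_cycles:
  assumes "\<And>a. a \<notin> {1..n} \<Longrightarrow> x a = 0" "\<And>a. a \<notin> {1..n} \<Longrightarrow> y a = 0"
    "(\<Sum>a=1..n. x a) = 0" "(\<Sum>a=1..n. y a) = 0"
  shows "wedge x y \<in> cycles n"
  by (rule cyclesI)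
     (use assms in \<open>auto simp: wedge_def sum_subtractf simp flip: sum_distrib_left\<close>)

lemma tri_cycles:
  assumes "i \<in> {1..n}" "j \<in> {1..n}" "k \<in> {1..n}" shows "tri i j k \<in> cycles n"
  unfolding tri_def using assms
  by (intro wedge_cycles) (auto simp: sum_subtractf of_bool_def)

lemma sq_cycles:
  assumes "i \<in> {1..n}" "j \<in> {1..n}" "k \<in> {1..n}" "l \<in> {1..n}" shows "sq i j k l \<in> cycles n"
  unfolding sq_def using assms
  by (intro wedge_cycles) (auto simp: sum_subtractf of_bool_def)

lemma tri_rotate: "tri j k i = tri i j k"
  by (simp add: tri_def wedge_def fun_eq_iff algebra_simps)

lemma tri_swap: "tri i k j = - tri i j k"
  by (simp add: tri_def wedge_def fun_eq_iff)

lemma tri_diff: "tri i j k - tri i j l = sq j i k l"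
  by (simp add: tri_def sq_def wedge_def fun_eq_iff algebra_simps)

lemma tau_diff: "x \<in> cycles n \<Longrightarrow> tau i j k x - tau i j l x = csq j i k l x"
  using cycles_anti[of x n i l] cycles_anti[of x n k i] by (simp add: tau_def csq_def)

lemma tau_rotate: "tau j k i x = tau i j k x"
  by (simp add: tau_def)

lemma tau_swap: "x \<in> cycles n \<Longrightarrow> tau i k j x = - tau i j k x"
  using cycles_anti[of x n i k] cycles_anti[of x n k j] cycles_anti[of x n j i] by (simp add: tau_def)

lemma wedge_comb_eq_sum: "wedge_comb n \<alpha> = (\<Sum>(i, j)\<in>wedge_pairs n. smul (\<alpha> i j) (tri 1 i j))"
  by (simp add: fun_eq_iff wedge_comb_def sum_fun_apply case_prod_unfold tri_def basis_diff_def)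

lemma wedge_comb_cycles: "wedge_comb n \<alpha> \<in> cycles n"
  unfolding wedge_comb_eq_sum
  by (intro cycles.sum) (auto simp: wedge_pairs_def intro!: cycles.smul tri_cycles)

text \<open>The edges at vertex 1 form a spanning tree, so a cycle is determined by the remaining
  edges: the row sums recover column 1.\<close>

lemma cycles_eqI:
  assumes x: "x \<in> cycles n" and y: "y \<in> cycles n"
    and eq: "\<And>i j. (i, j) \<in> wedge_pairs n \<Longrightarrow> x i j = y i j"
  shows "x = y"
proof -
  define z where "z = x - y"
  have z: "z \<in> cycles n" unfolding z_def using x y by (rule cycles.diff)
  note z' = cyclesD[OF z]
  have ge: "z i j = 0" if "i \<noteq> 1" "j \<noteq> 1" for i j
  proof -
    have *: "z i j = 0" if "i < j" "i \<noteq> 1" for i j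
      using eq[of i j] z'(3)[of i j] that by (cases "(i, j) \<in> wedge_pairs n") (auto simp: z_def wedge_pairs_def)
    consider "i < j" | "i = j" | "j < i" by linarith
    then show ?thesis using *[of i j] *[of j i] that z'(2) z'(1)[of i j] by cases auto
  qed
  have "z i 1 = 0" if "i \<noteq> 1" for i
  proof (cases "n = 0")
    case True then show ?thesis using z'(3) by auto
  next
    case False
    then have "(\<Sum>j=1..n. z i j) = z i 1 + (\<Sum>j\<in>{1..n} - {1}. z i j)"
      by (subst sum.remove[of _ 1]) auto
    moreover have "(\<Sum>j\<in>{1..n} - {1}. z i j) = 0" using ge that by (intro sum.neutral) auto
    ultimately show ?thesis using z'(4)[of i] by simp
  qed
  then have "z i j = 0" for i j
    using ge[of i j] z'(2)[of 1] z'(1)[of 1 j] by (cases "i = 1"; cases "j = 1") auto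
  then show ?thesis by (simp add: z_def fun_eq_iff)
qed

lemma wedge_comb_self: "x \<in> cycles n \<Longrightarrow> wedge_comb n x = x"
  by (rule cycles_eqI) (auto simp: wedge_comb_cycles wedge_comb_coeff)

lemma carrier_specht: "carrier (specht_lattice n) = cycles n"
  unfolding carrier_specht_lattice
proof (intro equalityI subsetI)
  show "x \<in> range (wedge_comb n)" if "x \<in> cycles n" for x
    using wedge_comb_self[OF that] by (metis rangeI)
qed (auto simp: wedge_comb_cycles)

text \<open>
  Applied to \<open>tau\<close> this shows that the triangle values of a cycle agree modulo \<open>d\<close> if the square
  values vanish modulo \<open>d\<close>; applied to \<open>tri\<close> it shows that the squares span an index 2 sublattice.
\<close>

lemma triangles_cong:
  fixes T :: "nat \<Rightarrow> nat \<Rightarrow> nat \<Rightarrow> 'a::ab_group_add"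
  assumes n: "n \<ge> 5" and H0: "0 \<in> H" and H: "\<And>x y. x \<in> H \<Longrightarrow> y \<in> H \<Longrightarrow> x - y \<in> H"
    and rot: "\<And>i j k. T j k i = T i j k" and swap: "\<And>i j k. T i k j = - T i j k"
    and step: "\<And>i j k l. distinct [i, j, k, l] \<Longrightarrow> {i, j, k, l} \<subseteq> {1..n} \<Longrightarrow> T i j k - T i j l \<in> H"
  shows "T 1 2 3 + T 1 2 3 \<in> H \<and>
    (\<forall>a\<in>{2..n}. \<forall>b\<in>{2..n}. a \<noteq> b \<longrightarrow> T 1 a b - T 1 2 3 \<in> H)"
proof -
  have Hm: "- x \<in> H" if "x \<in> H" for x using H[OF H0 that] by simp
  have Ha: "x + y \<in> H" if "x \<in> H" "y \<in> H" for x y using H[OF that(1) Hm[OF that(2)]] by simp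
  have s1: "T 1 a b - T 1 a c \<in> H" if "a \<in> {2..n}" "b \<in> {2..n}" "c \<in> {2..n}" "a \<noteq> b" "a \<noteq> c" for a b c
    using step[of 1 a b c] that H0 by (cases "b = c") auto
  have s2: "T 1 2 b - T 1 2 3 \<in> H" if "b \<in> {3..n}" for b
    using s1[of 2 b 3] that n by auto
  have s3: "T 1 b 2 + T 1 2 3 \<in> H" if "b \<in> {3..n}" for b
    using Hm[OF s2[OF that]] swap[of 1 2 b] by (simp add: add.commute)
  have s4: "T 1 a b + T 1 2 3 \<in> H" if "a \<in> {3..n}" "b \<in> {3..n}" "a \<noteq> b" for a b
    using Ha[OF s1[of a b 2] s3[of a]] that by (auto simp: algebra_simps)
  have s5: "T 1 a b - T 1 2 3 \<in> H" if "a \<in> {3..n}" "b \<in> {3..n}" "a \<noteq> b" for a b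
    using Hm[OF s4[of b a]] that swap[of 1 b a] by (auto simp: algebra_simps)
  \<comment> \<open>The triangle 1 4 5 is congruent both to T 1 2 3 and to its negative. This takes
    two vertices besides 1, 2, 3, which is where \<open>n \<ge> 5\<close> enters.\<close>
  have two: "T 1 2 3 + T 1 2 3 \<in> H"
    using H[OF s4[of 4 5] s5[of 4 5]] n by (simp add: algebra_simps)
  have "T 1 a b - T 1 2 3 \<in> H" if "a \<in> {2..n}" "b \<in> {2..n}" "a \<noteq> b" for a b
  proof -
    consider "a = 2" | "b = 2" "a \<noteq> 2" | "a \<noteq> 2" "b \<noteq> 2" by blast
    then show ?thesis
    proof cases
      case 1 then show ?thesis using s2[of b] that by auto
    next
      case 2 then show ?thesis using H[OF s3[of a] two] that by auto
    next
      case 3 then show ?thesis using s5[of a b] that by auto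
    qed
  qed
  with two show ?thesis by blast
qed

text \<open>The edge congruence comes from summing \<open>tau i j k x\<close> over all
  \<open>k\<close>: by the row sums the total is \<open>n * x i j\<close>, the degenerate triangles
  contribute nothing, and the other \<open>n - 2\<close> are congruent to one value. It is the only
  passage from square values back to entries.\<close>

lemma tau_cong:
  assumes n: "n \<ge> 5" and x: "x \<in> cycles n"
    and d: "\<And>i j k l. distinct [i, j, k, l] \<Longrightarrow> {i, j, k, l} \<subseteq> {1..n} \<Longrightarrow> d dvd csq i j k l x"
  shows "d dvd 2 * tau 1 2 3 x"
    and "\<And>i j k. distinct [i, j, k] \<Longrightarrow> {i, j, k} \<subseteq> {1..n} \<Longrightarrow> d dvd tau i j k x - tau 1 2 3 x"
    and "\<And>i j. i \<in> {1..n} \<Longrightarrow> j \<in> {1..n} \<Longrightarrow> i \<noteq> j \<Longrightarrow> d dvd int n * x i j - (int n - 2) * tau 1 2 3 x"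
proof -
  let ?e = "tau 1 2 3 x"
  note A = cycles_anti[OF x] and D = cycles_diag[OF x] and R = cycles_row[OF x]
  have *: "?e + ?e \<in> {y. d dvd y} \<and>
    (\<forall>a\<in>{2..n}. \<forall>b\<in>{2..n}. a \<noteq> b \<longrightarrow> tau 1 a b x - ?e \<in> {y. d dvd y})"
  proof (rule triangles_cong[OF n])
    show "tau i j k x - tau i j l x \<in> {y. d dvd y}"
      if "distinct [i, j, k, l]" "{i, j, k, l} \<subseteq> {1..n}" for i j k l
      using d[of j i k l] that by (auto simp: tau_diff[OF x])
    show "tau j k i x = tau i j k x" "tau i k j x = - tau i j k x" for i j k
      by (rule tau_rotate, rule tau_swap[OF x])
  qed auto
  show e2: "d dvd 2 * ?e" using conjunct1[OF *] by simp
  have first: "d dvd tau 1 a b x - ?e" if "a \<in> {2..n}" "b \<in> {2..n}" "a \<noteq> b" for a b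
    using conjunct2[OF *] that by blast
  show all: "d dvd tau i j k x - ?e" if dist: "distinct [i, j, k]" and mem: "{i, j, k} \<subseteq> {1..n}" for i j k
  proof -
    consider "i = 1" | "j = 1" | "k = 1" | "i \<in> {2..n}" "j \<in> {2..n}" "k \<in> {2..n}"
      using mem by fastforce
    then show ?thesis
    proof cases
      case 4
      \<comment> \<open>A triangle avoiding 1 is the sum of three triangles through 1; since
        \<open>2 * ?e\<close> vanishes modulo \<open>d\<close>, three copies of \<open>?e\<close>
        amount to one.\<close>
      have "tau i j k x - ?e = (tau 1 i j x - ?e) + (tau 1 j k x - ?e) + (tau 1 k i x - ?e) + 2 * ?e"
        using A[of 1 i] A[of 1 j] A[of 1 k] by (simp add: tau_def)
      then show ?thesis
        using first[of i j] first[of j k] first[of k i] 4 dist e2 by (metis dvd_add distinct_length_2_or_more)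
    qed (use first[of j k] first[of k i] first[of i j] dist mem tau_rotate in \<open>auto simp: tau_rotate[of 1 k i] tau_rotate[of 1 i j] tau_rotate[of j 1 i]\<close>)
  qed
  show "d dvd int n * x i j - (int n - 2) * ?e" if ij: "i \<in> {1..n}" "j \<in> {1..n}" "i \<noteq> j" for i j
  proof -
    let ?K = "{1..n} - {i, j}"
    have "(\<Sum>k=1..n. x j k) = 0" "(\<Sum>k=1..n. x k i) = 0"
      using R by (simp_all only: A[of _ i] sum_negf)
    then have "int n * x i j = (\<Sum>k=1..n. tau i j k x)"
      by (simp add: tau_def sum.distrib)
    also have "\<dots> = (\<Sum>k\<in>?K. tau i j k x)"
      using A[of i j] D by (intro sum.mono_neutral_right) (auto simp: tau_def)
    finally have "int n * x i j - (int n - 2) * ?e = (\<Sum>k\<in>?K. tau i j k x - ?e)"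
      using ij n by (simp add: sum_subtractf card_Diff_subset of_nat_diff)
    moreover have "d dvd (\<Sum>k\<in>?K. tau i j k x - ?e)"
      using all[of i j] ij by (intro dvd_sum) auto
    ultimately show ?thesis by simp
  qed
qed

text \<open>Modulo the squares all basis elements \<open>tri 1 i j\<close> coincide and have order
  dividing 2, so only the parity of the coordinate sum matters.\<close>

lemma sq_spans:
  assumes U: "sublat n U" and n: "n \<ge> 5"
    and sq: "\<And>i j k l. distinct [i, j, k, l] \<Longrightarrow> {i, j, k, l} \<subseteq> {1..n} \<Longrightarrow> smul d (sq i j k l) \<in> U"
    and x: "x \<in> cycles n" "even (par n x)"
  shows "smul d x \<in> U"
proof -
  interpret sublat n U by fact
  let ?T = "\<lambda>i j k. smul d (tri i j k)"
  have *: "?T 1 2 3 + ?T 1 2 3 \<in> U \<and>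
    (\<forall>a\<in>{2..n}. \<forall>b\<in>{2..n}. a \<noteq> b \<longrightarrow> ?T 1 a b - ?T 1 2 3 \<in> U)"
  proof (rule triangles_cong[OF n, where T = ?T])
    show "?T i j k - ?T i j l \<in> U"
      if "distinct [i, j, k, l]" "{i, j, k, l} \<subseteq> {1..n}" for i j k l
      using sq[of j i k l] that by (auto simp flip: smul_diff simp: tri_diff)
    show "?T j k i = ?T i j k" for i j k
      by (simp only: tri_rotate)
    show "?T i k j = - ?T i j k" for i j k
      by (simp only: tri_swap[of i k j]) (simp add: fun_eq_iff)
  qed (auto intro: diff)
  have "smul d x = smul d (wedge_comb n x)" by (simp add: wedge_comb_self x)
  also have "\<dots> = (\<Sum>(i, j)\<in>wedge_pairs n. smul (x i j) (?T 1 i j - ?T 1 2 3)) + smul (par n x) (?T 1 2 3)"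
    by (simp add: wedge_comb_eq_sum smul_sum fun_eq_iff sum_fun_apply case_prod_unfold par_def
        sum_subtractf algebra_simps sum_distrib_left sum_distrib_right)
  also have "\<dots> \<in> U"
  proof (intro add sum)
    show "(case p of (i, j) \<Rightarrow> smul (x i j) (?T 1 i j - ?T 1 2 3)) \<in> U" if "p \<in> wedge_pairs n" for p
      using that conjunct2[OF *] by (auto simp: wedge_pairs_def simp del: One_nat_def intro!: smul)
    obtain m where "par n x = 2 * m" using x(2) by blast
    then have "smul (par n x) (?T 1 2 3) = smul m (?T 1 2 3 + ?T 1 2 3)"
      by (simp add: fun_eq_iff)
    then show "smul (par n x) (?T 1 2 3) \<in> U" using smul[OF conjunct1[OF *]] by simp
  qed
  finally show ?thesis .
qed

section \<open>Reflections and the ideal of square values\<close>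

lemma permutes_map_eq:
  assumes "distinct xs" "distinct ys" "length xs = length ys" "set xs \<subseteq> A" "set ys \<subseteq> A"
  shows "\<exists>\<sigma>. \<sigma> permutes A \<and> map \<sigma> xs = ys"
  using assms(3,1,2,4,5)
proof (induction xs ys rule: list_induct2)
  case Nil
  show ?case by (auto intro: exI[of _ id] permutes_id)
next
  case (Cons x xs y ys)
  then obtain \<sigma> where \<sigma>: "\<sigma> permutes A" "map \<sigma> xs = ys" by auto
  define \<rho> where "\<rho> = transpose (\<sigma> x) y \<circ> \<sigma>"
  have \<rho>: "\<rho> permutes A"
    unfolding \<rho>_def using Cons.prems \<sigma>(1)
    by (intro permutes_compose permutes_swap_id) (auto simp: permutes_in_image)
  have "\<rho> z = \<sigma> z" if "z \<in> set xs" for z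
  proof -
    have "\<sigma> z \<in> set ys" using \<sigma>(2) that by auto
    then have "\<sigma> z \<noteq> y" using Cons.prems by auto
    moreover have "\<sigma> z \<noteq> \<sigma> x"
      using Cons.prems that permutes_inj[OF \<sigma>(1)] by (auto simp: inj_eq)
    ultimately show ?thesis by (simp add: \<rho>_def)
  qed
  then have "map \<rho> xs = map \<sigma> xs" by simp
  moreover have "\<rho> x = y" by (simp add: \<rho>_def)
  ultimately have "map \<rho> (x # xs) = y # ys" by (simp only: list.map \<sigma>(2))
  with \<rho> show ?case by (intro exI[of _ \<rho>] conjI)
qed

lemma int_subgroup_principal:
  fixes I :: "int set"
  assumes "0 \<in> I" "\<And>x y. x \<in> I \<Longrightarrow> y \<in> I \<Longrightarrow> x - y \<in> I"
  obtains d where "d \<in> I" "d \<ge> 0" "\<And>y. y \<in> I \<Longrightarrow> d dvd y"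
proof (cases "I = {0}")
  case True
  then show ?thesis using that[of 0] by auto
next
  case False
  have neg: "- x \<in> I" if "x \<in> I" for x using assms(2)[OF assms(1) that] by simp
  have add: "x + y \<in> I" if "x \<in> I" "y \<in> I" for x y using assms(2)[OF that(1) neg[OF that(2)]] by simp
  have mult: "k * x \<in> I" if "x \<in> I" for k x
  proof (induction k rule: int_induct[where k = 0])
    case (step1 i) then show ?case using add[OF _ that] by (simp add: distrib_right)
  next
    case (step2 i) then show ?case using assms(2)[OF _ that] by (simp add: left_diff_distrib)
  qed (simp add: assms(1))
  define P where "P = (\<lambda>m::nat. 0 < m \<and> int m \<in> I)"
  obtain x where "x \<in> I" "x \<noteq> 0" using False assms(1) by auto
  then have "P (nat \<bar>x\<bar>)" using neg[of x] by (auto simp: P_def abs_if)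
  then have P: "P (LEAST m. P m)" by (rule LeastI)
  define d where "d = int (LEAST m. P m)"
  have d: "d \<in> I" "d > 0" using P by (auto simp: d_def P_def)
  have "d dvd y" if "y \<in> I" for y
  proof (rule ccontr)
    assume "\<not> d dvd y"
    then have "y mod d > 0" using d by (simp add: dvd_eq_mod_eq_0 order_less_le)
    moreover have "y mod d = y - (y div d) * d" by (simp add: minus_div_mult_eq_mod)
    then have "y mod d \<in> I" using assms(2)[OF that mult[OF d(1)]] by metis
    ultimately have "P (nat (y mod d))" by (simp add: P_def)
    then have "(LEAST m. P m) \<le> nat (y mod d)" by (rule Least_le)
    then have "d \<le> y mod d" using \<open>y mod d > 0\<close> by (simp add: d_def)
    then show False using pos_mod_bound[OF d(2), of y] by simp
  qed
  with d show ?thesis using that by (meson order.strict_implies_order)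
qed

text \<open>The first factor turns \<open>x\<close> into a product (i - j) \<and> v; the second then
  replaces v by v minus its reflection, a multiple of k - l. The coefficient is the entry at
  \<open>i\<close>, \<open>k\<close>.\<close>

lemma reflection_product:
  assumes x: "x \<in> cycles n" and ijkl: "distinct [i, j, k, l]"
  defines "y \<equiv> x - relabel (transpose i j) x"
  shows "y - relabel (transpose k l) y = smul (csq i j k l x) (sq i j k l)"
proof -
  note A = cycles_anti[OF x] and D = cycles_diag[OF x]
  note A' = A[of j i] A[of k i] A[of l i] A[of k j] A[of l j] A[of l k]
  have ne: "i \<noteq> j" "i \<noteq> k" "i \<noteq> l" "j \<noteq> k" "j \<noteq> l" "k \<noteq> l"
    "j \<noteq> i" "k \<noteq> i" "l \<noteq> i" "k \<noteq> j" "l \<noteq> j" "l \<noteq> k" using ijkl by auto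
  have "(y - relabel (transpose k l) y) a b = smul (csq i j k l x) (sq i j k l) a b" for a b
  proof -
    note defs = y_def sq_def wedge_def csq_def transpose_def ne A' D
    have b: "b = i \<or> b = j \<or> b = k \<or> b = l \<or> b \<noteq> i \<and> b \<noteq> j \<and> b \<noteq> k \<and> b \<noteq> l" by blast
    consider "a = i" | "a = j" | "a = k" | "a = l" | "a \<noteq> i" "a \<noteq> j" "a \<noteq> k" "a \<noteq> l" by blast
    then show ?thesis
    proof cases
      case 1 then show ?thesis using b by (elim disjE) (simp_all add: defs)
    next
      case 2 then show ?thesis using b by (elim disjE) (simp_all add: defs)
    next
      case 3 then show ?thesis using b by (elim disjE) (simp_all add: defs)
    next
      case 4 then show ?thesis using b by (elim disjE) (simp_all add: defs)
    next
      case 5 then show ?thesis by (simp add: defs)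
    qed
  qed
  then show ?thesis by (simp add: fun_eq_iff)
qed

context sublat
begin

lemma reflect: "i \<in> {1..n} \<Longrightarrow> j \<in> {1..n} \<Longrightarrow> x \<in> U \<Longrightarrow> x - relabel (transpose i j) x \<in> U"
  by (intro diff relabel permutes_swap_id)

lemma csq_sq_mem:
  assumes "x \<in> U" "distinct [i, j, k, l]" "{i, j, k, l} \<subseteq> {1..n}"
  shows "smul (csq i j k l x) (sq i j k l) \<in> U"
  using reflection_product[of x n i j k l] reflect[OF _ _ reflect[OF _ _ assms(1)], of k l i j] assms sub
  by auto

text \<open>Transitivity on quadruples reduces everything to the square values at 1, 2, 3, 4. They
  form an ideal whose generator is attained at some element of \<open>U\<close>, and the reflections
  turn that element into a multiple of a square. The zero lattice has content 0.\<close>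

lemma square_content:
  assumes n: "n \<ge> 5"
  obtains d where "d \<ge> 0"
    "\<And>x i j k l. x \<in> U \<Longrightarrow> distinct [i, j, k, l] \<Longrightarrow> {i, j, k, l} \<subseteq> {1..n} \<Longrightarrow> d dvd csq i j k l x"
    "\<And>i j k l. distinct [i, j, k, l] \<Longrightarrow> {i, j, k, l} \<subseteq> {1..n} \<Longrightarrow> smul d (sq i j k l) \<in> U"
proof -
  have one: "distinct [1::nat, 2, 3, 4]" "{1, 2, 3, 4} \<subseteq> {1..n}" using n by auto
  obtain d where d: "d \<in> csq 1 2 3 4 ` U" "d \<ge> 0" "\<And>y. y \<in> csq 1 2 3 4 ` U \<Longrightarrow> d dvd y"
  proof (rule int_subgroup_principal[of "csq 1 2 3 4 ` U"])
    show "0 \<in> csq 1 2 3 4 ` U" by (rule image_eqI[of _ _ 0]) (auto simp: csq_def)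
    show "a - b \<in> csq 1 2 3 4 ` U" if "a \<in> csq 1 2 3 4 ` U" "b \<in> csq 1 2 3 4 ` U" for a b
    proof -
      obtain x y where "x \<in> U" "y \<in> U" "a = csq 1 2 3 4 x" "b = csq 1 2 3 4 y" using \<open>a \<in> _\<close> \<open>b \<in> _\<close> by blast
      then show ?thesis by (intro image_eqI[of _ _ "x - y"] diff) (auto simp: csq_def)
    qed
  qed blast
  show ?thesis
  proof (rule that[OF d(2)])
    fix x i j k l assume x: "x \<in> U" and dist: "distinct [i, j, k, l]" "{i, j, k, l} \<subseteq> {1..n}"
    obtain \<sigma> where \<sigma>: "\<sigma> permutes {1..n}" "map \<sigma> [1, 2, 3, 4] = [i, j, k, l]"
      using permutes_map_eq[OF one(1) dist(1), of "{1..n}"] one(2) dist(2) by auto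
    have "csq i j k l x = csq 1 2 3 4 (relabel \<sigma> x)" using \<sigma>(2) by (simp add: csq_def)
    then show "d dvd csq i j k l x" using d(3) relabel[OF \<sigma>(1) x] by auto
  next
    fix i j k l assume dist: "distinct [i, j, k, l]" "{i, j, k, l} \<subseteq> {1..n}"
    obtain \<sigma> where \<sigma>: "\<sigma> permutes {1..n}" "map \<sigma> [i, j, k, l] = [1, 2, 3, 4]"
      using permutes_map_eq[OF dist(1) one(1), of "{1..n}"] one(2) dist(2) by auto
    have iff: "\<sigma> a = \<sigma> b \<longleftrightarrow> a = b" for a b using permutes_inj[OF \<sigma>(1)] by (simp add: inj_eq)
    have \<sigma>': "1 = \<sigma> i" "2 = \<sigma> j" "3 = \<sigma> k" "4 = \<sigma> l" using \<sigma>(2) by auto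
    obtain x where x: "x \<in> U" "d = csq 1 2 3 4 x" using d(1) by blast
    have "relabel \<sigma> (smul d (sq 1 2 3 4)) \<in> U"
      using relabel[OF \<sigma>(1) csq_sq_mem[OF x(1) one]] x(2) by simp
    moreover have "relabel \<sigma> (smul d (sq 1 2 3 4)) = smul d (sq i j k l)"
      unfolding \<sigma>' by (simp add: fun_eq_iff sq_def wedge_def iff)
    ultimately show "smul d (sq i j k l) \<in> U" by simp
  qed
qed

end

subsection \<open>The lattices of the classification\<close>

text \<open>The span of the squares, described by a congruence instead of generators.\<close>

definition even_lat :: "nat \<Rightarrow> mat set"
  where "even_lat n = {x \<in> cycles n. even (par n x)}"

text \<open>Modulo \<open>d\<close> these are the coboundaries g j - g i. If \<open>d\<close>
  divides \<open>n\<close>, multiplication by \<open>d\<close> makes this the exterior square of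
  \<open>M_sub n d\<close>; see \<open>ext_square_M_sub\<close>.\<close>

definition tri_lat :: "nat \<Rightarrow> int \<Rightarrow> mat set"
  where "tri_lat n d = {x \<in> cycles n. \<forall>i\<in>{1..n}. \<forall>j\<in>{1..n}. \<forall>k\<in>{1..n}. d dvd tau i j k x}"

text \<open>The common parity may vary with \<open>x\<close>. Degenerate triples are left out
  because \<open>tau\<close> vanishes on them.\<close>

definition tri_par :: "nat \<Rightarrow> mat set"
  where "tri_par n = {x \<in> cycles n. \<exists>e. \<forall>i j k. distinct [i, j, k] \<longrightarrow> {i, j, k} \<subseteq> {1..n} \<longrightarrow>
    even (tau i j k x - e)}"

lemma sum_from_1: "n \<noteq> 0 \<Longrightarrow> sum h {1..n} = h 1 + sum h {2..n}" for h :: "nat \<Rightarrow> int"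
  by (simp add: sum.atLeast_Suc_atMost numeral_2_eq_2)

lemma sum_wedge_pairs_symmetric:
  fixes f :: "nat \<Rightarrow> nat \<Rightarrow> int"
  assumes sym: "\<And>i j. f i j = f j i" and diag: "\<And>i. f i i = 0"
  shows "(\<Sum>i=1..n. \<Sum>j=1..n. f i j) = 2 * ((\<Sum>(i, j)\<in>wedge_pairs n. f i j) + (\<Sum>j=1..n. f 1 j))"
proof (cases "n = 0")
  case True
  then have "wedge_pairs n = {}" by (auto simp: wedge_pairs_def)
  with True show ?thesis by simp
next
  case False
  let ?g = "\<lambda>(i, j). f i j"
  define G where "G = {(i, j). 2 \<le> j \<and> j < i \<and> i \<le> n}"
  have fin: "finite G" by (rule finite_subset[of _ "{0..n} \<times> {0..n}"]) (auto simp: G_def)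
  have disj: "wedge_pairs n \<inter> G = {}" by (auto simp: G_def wedge_pairs_def)
  have G: "sum ?g G = sum ?g (wedge_pairs n)"
    by (rule sum.reindex_bij_witness[of _ prod.swap prod.swap]) (auto simp: G_def wedge_pairs_def sym)
  have "(\<Sum>i=2..n. \<Sum>j=2..n. f i j) = sum ?g ({2..n} \<times> {2..n})"
    by (simp add: sum.cartesian_product)
  also have "\<dots> = sum ?g (wedge_pairs n \<union> G)"
    by (rule sum.mono_neutral_right) (auto simp: wedge_pairs_def G_def diag not_less dest: antisym)
  also have "\<dots> = 2 * sum ?g (wedge_pairs n)"
    using sum.union_disjoint[OF finite_wedge_pairs fin disj, of ?g] G by simp
  finally have ge2: "(\<Sum>i=2..n. \<Sum>j=2..n. f i j) = 2 * sum ?g (wedge_pairs n)" .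
  show ?thesis
    unfolding sum_from_1[OF False] by (simp only: sum.distrib ge2 diag sym[of _ 1]) simp
qed

text \<open>A degree count: each vertex of \<open>{2..n}\<close> lies on \<open>n - 2\<close> edges
  of the complete graph on that set. Extending the summand by zero to vertex 1 and the diagonal
  brings it into the form of the symmetric double sum.\<close>

lemma sum_wedge_pairs_add:
  fixes f :: "nat \<Rightarrow> int"
  shows "(\<Sum>(i, j)\<in>wedge_pairs n. f i + f j) = (int n - 2) * (\<Sum>i=2..n. f i)"
proof (cases "n = 0")
  case True
  then have "wedge_pairs n = {}" by (auto simp: wedge_pairs_def)
  with True show ?thesis by simp
next
  case False
  let ?s = "\<Sum>i=2..n. f i"
  let ?f = "\<lambda>i j. if i = j \<or> i = 1 \<or> j = 1 then 0 else f i + f j"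
  have row: "(\<Sum>j=1..n. ?f i j) = ?s + (int n - 3) * f i" if "i \<in> {2..n}" for i
  proof -
    have "(\<Sum>j=1..n. ?f i j) = (\<Sum>j\<in>{2..n} - {i}. f i + f j)"
      using that by (intro sum.mono_neutral_cong_right) auto
    also have "\<dots> = (\<Sum>j=2..n. f i + f j) - (f i + f i)"
      using that by (simp add: sum_diff1 algebra_simps)
    finally show ?thesis using that by (simp add: sum.distrib of_nat_diff algebra_simps)
  qed
  have "2 * (\<Sum>(i, j)\<in>wedge_pairs n. f i + f j) = 2 * ((\<Sum>(i, j)\<in>wedge_pairs n. ?f i j) + (\<Sum>j=1..n. ?f 1 j))"
    by (simp, intro sum.cong) (auto simp: wedge_pairs_def)
  also have "\<dots> = (\<Sum>i=1..n. \<Sum>j=1..n. ?f i j)"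
    by (rule sum_wedge_pairs_symmetric[symmetric]) auto
  also have "\<dots> = (\<Sum>j=1..n. ?f 1 j) + (\<Sum>i=2..n. \<Sum>j=1..n. ?f i j)"
    by (rule sum_from_1[OF False])
  also have "\<dots> = (\<Sum>i=2..n. ?s + (int n - 3) * f i)"
    by (simp only: row cong: sum.cong) simp
  also have "\<dots> = (int n - 1) * ?s + (int n - 3) * ?s"
    using False by (simp add: sum.distrib sum_distrib_left of_nat_diff)
  also have "\<dots> = 2 * ((int n - 2) * ?s)" by (simp add: algebra_simps)
  finally show ?thesis by simp
qed

lemma card_wedge_pairs: "2 * int (card (wedge_pairs n)) = (int n - 2) * (int n - 1)" if "n \<ge> 1"
  using sum_wedge_pairs_add[of "\<lambda>_. 1" n] that by (simp add: case_prod_unfold of_nat_diff)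

text \<open>Squares have the parity of their roots, and the edges at vertex 1 have even total by the
  row sum. The right-hand side treats all vertices alike, which gives the invariance of
  \<open>even_lat\<close>.\<close>

lemma even_par_iff:
  assumes x: "x \<in> cycles n"
  shows "even (par n x) \<longleftrightarrow> 4 dvd (\<Sum>i=1..n. \<Sum>j=1..n. (x i j)\<^sup>2)"
proof -
  have ev: "even (a\<^sup>2 - a)" for a :: int by (simp add: power2_eq_square)
  let ?P = "\<Sum>(i, j)\<in>wedge_pairs n. (x i j)\<^sup>2" and ?R = "\<Sum>j=1..n. (x 1 j)\<^sup>2"
  have "(\<Sum>i=1..n. \<Sum>j=1..n. (x i j)\<^sup>2) = 2 * (?P + ?R)"
  proof (rule sum_wedge_pairs_symmetric)
    show "(x i j)\<^sup>2 = (x j i)\<^sup>2" for i j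
      unfolding cycles_anti[OF x, of i j] by simp
  qed (simp add: cycles_diag[OF x])
  moreover have "even (?P - par n x)"
    unfolding par_def case_prod_unfold sum_subtractf[symmetric] by (intro dvd_sum ev)
  moreover have "even (?R - (\<Sum>j=1..n. x 1 j))"
    unfolding sum_subtractf[symmetric] by (intro dvd_sum ev)
  then have "even ?R" using cycles_row[OF x, of 1] by simp
  moreover have "4 dvd 2 * (p + r) \<longleftrightarrow> even q" if "even (p - q)" "even r" for p q r :: int
    using that by presburger
  ultimately show ?thesis by simp
qed

lemma sublat_even_lat: "sublat n (even_lat n)"
proof
  fix x \<sigma> assume \<sigma>: "\<sigma> permutes {1..n}" and "x \<in> even_lat n"
  then have x: "x \<in> cycles n" "even (par n x)" by (auto simp: even_lat_def)
  have "(\<Sum>i=1..n. \<Sum>j=1..n. (relabel \<sigma> x i j)\<^sup>2) = (\<Sum>i=1..n. \<Sum>j=1..n. (x (\<sigma> i) j)\<^sup>2)"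
    using sum_permutes[OF \<sigma>, of "\<lambda>j. (x (\<sigma> i) j)\<^sup>2" for i] by simp
  also have "\<dots> = (\<Sum>i=1..n. \<Sum>j=1..n. (x i j)\<^sup>2)"
    by (rule sum_permutes[OF \<sigma>])
  finally show "relabel \<sigma> x \<in> even_lat n"
    using x even_par_iff[OF x(1)] even_par_iff[OF cycles.relabel[OF \<sigma> x(1)]]
      cycles.relabel[OF \<sigma> x(1)] by (simp add: even_lat_def)
qed (auto simp: even_lat_def par_diff cycles.diff, simp add: par_def)

lemma tau_simps: "tau i j k (x - y) = tau i j k x - tau i j k y" "tau i j k 0 = 0"
  "tau i j k (smul c x) = c * tau i j k x" "tau i j k (relabel \<sigma> x) = tau (\<sigma> i) (\<sigma> j) (\<sigma> k) x"
  by (simp_all add: tau_def algebra_simps)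

lemma sublat_tri_lat: "sublat n (tri_lat n d)"
proof
  fix x \<sigma> assume \<sigma>: "\<sigma> permutes {1..n}" and x: "x \<in> tri_lat n d"
  then show "relabel \<sigma> x \<in> tri_lat n d"
    using cycles.relabel[OF \<sigma>] permutes_in_image[OF \<sigma>] by (auto simp: tri_lat_def tau_simps)
qed (auto simp: tri_lat_def tau_simps cycles.diff)

lemma sublat_tri_par: "sublat n (tri_par n)"
proof
  fix x \<sigma> assume \<sigma>: "\<sigma> permutes {1..n}" and x: "x \<in> tri_par n"
  then obtain e where e: "\<And>i j k. distinct [i, j, k] \<Longrightarrow> {i, j, k} \<subseteq> {1..n} \<Longrightarrow> even (tau i j k x - e)"
    by (auto simp: tri_par_def)
  have "even (tau i j k (relabel \<sigma> x) - e)" if "distinct [i, j, k]" "{i, j, k} \<subseteq> {1..n}" for i j k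
    unfolding tau_simps
    by (rule e) (use that permutes_in_image[OF \<sigma>] permutes_inj[OF \<sigma>] in \<open>auto simp: inj_eq\<close>)
  then show "relabel \<sigma> x \<in> tri_par n"
    using x cycles.relabel[OF \<sigma>] unfolding tri_par_def by blast
next
  fix x y assume xy: "x \<in> tri_par n" "y \<in> tri_par n"
  then obtain e e' where e: "\<And>i j k. distinct [i, j, k] \<Longrightarrow> {i, j, k} \<subseteq> {1..n} \<Longrightarrow> even (tau i j k x - e)"
    "\<And>i j k. distinct [i, j, k] \<Longrightarrow> {i, j, k} \<subseteq> {1..n} \<Longrightarrow> even (tau i j k y - e')"
    unfolding tri_par_def by blast
  have "even (tau i j k (x - y) - (e - e'))" if "distinct [i, j, k]" "{i, j, k} \<subseteq> {1..n}" for i j k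
    using dvd_diff[OF e(1)[OF that] e(2)[OF that]] by (simp add: tau_simps algebra_simps)
  then show "x - y \<in> tri_par n"
    using xy cycles.diff[of x n y] unfolding tri_par_def by blast
qed (auto simp: tri_par_def tau_simps)

text \<open>Two cycles of odd parity differ by one of even parity: the index is at most 2.\<close>

lemma even_lat_odd:
  assumes "sublat n U" "even_lat n \<subseteq> U" "x \<in> U" "x \<in> cycles n" "odd (par n x)"
  shows "cycles n \<subseteq> U"
proof
  interpret sublat n U by fact
  fix y assume y: "y \<in> cycles n"
  show "y \<in> U"
  proof (cases "even (par n y)")
    case True then show ?thesis using y assms(2) by (auto simp: even_lat_def)
  next
    case False
    then have "y - x \<in> even_lat n"
      using y assms(4,5) cycles.diff[of y n x] by (simp add: even_lat_def par_diff)
    then have "y - x \<in> U" using assms(2) by blast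
    from add[OF this assms(3)] show ?thesis by simp
  qed
qed

text \<open>
  Modulo \<open>D\<close> the matrix \<open>x - relabel (transpose 1 l) x\<close> is a multiple of the coboundary of
  \<open>e\<^sub>1 - e\<^sub>l\<close>, and these coboundaries span \<open>tri_lat n D\<close>.
\<close>

lemma tri_lat_subset:
  assumes U: "sublat n U" and D: "D > 0" and DU: "\<And>y. y \<in> cycles n \<Longrightarrow> smul D y \<in> U"
    and x: "x \<in> U" "x \<in> tri_lat n D" and ab: "a \<in> {1..n}" "b \<in> {1..n}" "a \<noteq> b"
    and cop: "coprime (x a b) D"
  shows "tri_lat n D \<subseteq> U"
proof
  interpret sublat n U by fact
  fix z assume z: "z \<in> tri_lat n D"
  \<comment> \<open>The inverse of the entry modulo \<open>D\<close> normalizes the coboundaries to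
    coefficient 1.\<close>
  obtain c' where "[x a b * c' = 1] (mod D)" using cong_solve_coprime_int[OF cop] by blast
  then have c': "D dvd x a b * c' - 1" by (simp add: cong_iff_dvd_diff)
  let ?f = "\<lambda>l i. of_bool (i = 1) - of_bool (i = l) :: int"
  have "\<exists>y\<in>U. \<forall>i\<in>{1..n}. \<forall>j\<in>{1..n}. D dvd c' * y i j - (?f l i - ?f l j)" if l: "l \<in> {2..n}" for l
  proof -
    obtain \<sigma> where \<sigma>: "\<sigma> permutes {1..n}" "map \<sigma> [1, l] = [a, b]"
      using permutes_map_eq[of "[1, l]" "[a, b]" "{1..n}"] l ab by auto
    define w where "w = relabel \<sigma> x"
    have w: "w \<in> U" "w \<in> tri_lat n D" "w 1 l = x a b"
      unfolding w_def using \<sigma> relabel x sublat.relabel[OF sublat_tri_lat] by auto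
    have wc: "w \<in> cycles n" using w(2) by (simp add: tri_lat_def)
    note A = cycles_anti[OF wc] and Dg = cycles_diag[OF wc]
    define y where "y = w - relabel (transpose 1 l) w"
    have y: "y \<in> U" unfolding y_def using l w(1) by (intro reflect) auto
    have tau: "D dvd w 1 l + w l j - w 1 j" if "j \<in> {1..n}" for j
    proof -
      have "D dvd tau 1 l j w" using w(2) l that by (auto simp: tri_lat_def)
      then show ?thesis using A[of j 1] by (simp add: tau_def)
    qed
    have "D dvd y i j - w 1 l * (?f l i - ?f l j)" if ij: "i \<in> {1..n}" "j \<in> {1..n}" for i j
    proof -
      have "i = 1 \<or> i = l \<or> i \<notin> {1, l}" "j = 1 \<or> j = l \<or> j \<notin> {1, l}" by auto
      then show ?thesis
        using l tau[OF ij(1)] tau[OF ij(2)] dvd_minus_iff[of D "w 1 l + w l j - w 1 j"]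
          dvd_minus_iff[of D "w 1 l + w l i - w 1 i"] unfolding y_def
        by (elim disjE) (simp_all add: transpose_def Dg A[of l 1] A[of i 1] A[of i l] algebra_simps del: One_nat_def)
    qed
    then have "D dvd c' * (y i j - w 1 l * (?f l i - ?f l j)) + (x a b * c' - 1) * (?f l i - ?f l j)"
      if "i \<in> {1..n}" "j \<in> {1..n}" for i j using that c' by (meson dvd_add dvd_mult dvd_mult2)
    then show ?thesis using y w(3) by (intro bexI[of _ y]) (auto simp: algebra_simps)
  qed
  then obtain y where y: "\<And>l. l \<in> {2..n} \<Longrightarrow> y l \<in> U"
    "\<And>l i j. l \<in> {2..n} \<Longrightarrow> i \<in> {1..n} \<Longrightarrow> j \<in> {1..n} \<Longrightarrow> D dvd c' * y l i j - (?f l i - ?f l j)"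
    by metis
  have zc: "z \<in> cycles n" using z by (simp add: tri_lat_def)
  \<comment> \<open>Modulo \<open>D\<close> the matrix \<open>z\<close> is the coboundary of its
    first row, and that row is combined from the functions \<open>?f l\<close> with coefficients
    \<open>- z 1 l\<close>. At vertex 1 this uses that the first row has sum zero.\<close>
  define v where "v = (\<Sum>l=2..n. smul (z 1 l * c') (y l))"
  have v: "v \<in> U" unfolding v_def using y(1) by (intro sum smul)
  have F: "(\<Sum>l=2..n. z 1 l * ?f l i) = - z 1 i" if i: "i \<in> {1..n}" for i
  proof (cases "i = 1")
    case True
    have "(\<Sum>l=1..n. z 1 l) = z 1 1 + (\<Sum>l=2..n. z 1 l)"
      using i by (intro sum_from_1) simp
    then have "(\<Sum>l=2..n. z 1 l) = 0" using cycles_row[OF zc, of 1] cycles_diag[OF zc] by simp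
    moreover have "(\<Sum>l=2..n. z 1 l * ?f l i) = (\<Sum>l=2..n. z 1 l)"
      using True by (intro sum.cong) auto
    ultimately show ?thesis using True cycles_diag[OF zc] by simp
  next
    case False
    have "(\<Sum>l=2..n. z 1 l * ?f l i) = (\<Sum>l\<in>{2..n}. if l = i then - z 1 l else 0)"
      using False by (intro sum.cong) auto
    then show ?thesis using i False by (subst (asm) sum.delta) auto
  qed
  have "D dvd (z - v) i j" if ij: "i \<in> {1..n}" "j \<in> {1..n}" for i j
  proof -
    have "D dvd (\<Sum>l=2..n. z 1 l * (c' * y l i j - (?f l i - ?f l j)))"
      using y(2) ij by (intro dvd_sum dvd_mult)
    also have "\<dots> = v i j + z 1 i - z 1 j"
      using F[OF ij(1)] F[OF ij(2)]
      by (simp add: v_def sum_fun_apply sum_subtractf right_diff_distrib mult.assoc)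
    finally have "D dvd v i j + z 1 i - z 1 j" .
    moreover have "D dvd tau 1 i j z" using z ij by (auto simp: tri_lat_def)
    ultimately have "D dvd tau 1 i j z - (v i j + z 1 i - z 1 j)" by (rule dvd_diff[rotated])
    then show ?thesis using cycles_anti[OF zc, of j 1] by (simp add: tau_def)
  qed
  then obtain u where "u \<in> cycles n" "z - v = smul D u"
    using cycles_divide[of "z - v" n D] D zc v sub cycles.diff by (metis order_less_irrefl subset_iff)
  then have "z - v \<in> U" using DU by simp
  from add[OF this v] show "z \<in> U" by simp
qed

lemma tau_degenerate: "x \<in> cycles n \<Longrightarrow> \<not> distinct [i, j, k] \<Longrightarrow> tau i j k x = 0"
  using cycles_diag[of x n] cycles_anti[of x n i j] cycles_anti[of x n j k] cycles_anti[of x n i k]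
  by (auto simp: tau_def)

lemma tri_parE:
  assumes "x \<in> tri_par n"
  obtains e where "\<And>i j k. distinct [i, j, k] \<Longrightarrow> {i, j, k} \<subseteq> {1..n} \<Longrightarrow> even (tau i j k x - e)"
proof -
  obtain e where "\<forall>i j k. distinct [i, j, k] \<longrightarrow> {i, j, k} \<subseteq> {1..n} \<longrightarrow> even (tau i j k x - e)"
    using assms unfolding tri_par_def by blast
  then show ?thesis by (intro that[of e]) blast
qed

section \<open>Lattices of prime power index; the odd primes\<close>

lemma sublat_divide: "sublat n U \<Longrightarrow> sublat n {y \<in> cycles n. smul c y \<in> U}"
  unfolding sublat_def
  by (auto simp: smul_diff relabel_smul[symmetric] cycles.diff cycles.relabel)

lemma sublat_divide_eq:
  assumes U: "sublat n U" and c: "c \<noteq> 0"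
    and dvd: "\<And>x i j. x \<in> U \<Longrightarrow> i \<in> {1..n} \<Longrightarrow> j \<in> {1..n} \<Longrightarrow> c dvd x i j"
  shows "U = smul c ` {y \<in> cycles n. smul c y \<in> U}"
proof (intro equalityI subsetI)
  fix x assume x: "x \<in> U"
  then have "x \<in> cycles n" using sublat.sub[OF U] by blast
  then obtain y where "y \<in> cycles n" "x = smul c y" using cycles_divide c dvd[OF x] by metis
  with x show "x \<in> smul c ` {y \<in> cycles n. smul c y \<in> U}" by blast
qed auto

lemma square_content_prime_power:
  assumes U: "sublat n U" and n: "n \<ge> 5" and p: "prime p"
    and a: "\<And>y. y \<in> cycles n \<Longrightarrow> smul (int p ^ a) y \<in> U"
  obtains k where "k \<le> a"
    "\<And>x i j k' l. x \<in> U \<Longrightarrow> distinct [i, j, k', l] \<Longrightarrow> {i, j, k', l} \<subseteq> {1..n} \<Longrightarrow> int p ^ k dvd csq i j k' l x"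
    "\<And>y. y \<in> even_lat n \<Longrightarrow> smul (int p ^ k) y \<in> U"
proof -
  interpret sublat n U by fact
  obtain d where d: "d \<ge> 0"
    "\<And>x i j k l. x \<in> U \<Longrightarrow> distinct [i, j, k, l] \<Longrightarrow> {i, j, k, l} \<subseteq> {1..n} \<Longrightarrow> d dvd csq i j k l x"
    "\<And>i j k l. distinct [i, j, k, l] \<Longrightarrow> {i, j, k, l} \<subseteq> {1..n} \<Longrightarrow> smul d (sq i j k l) \<in> U"
    using square_content[OF n] by metis
  \<comment> \<open>This square meets the four-cycle 1 3 2 4 in the single edge from 1 to 3, so its
    value is 1; the square \<open>sq 1 2 3 4\<close> itself would give 4.\<close>
  have "d dvd csq 1 2 3 4 (smul (int p ^ a) (sq 1 5 3 2))"
    using n by (intro d(2) a sq_cycles) auto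
  also have "csq 1 2 3 4 (smul (int p ^ a) (sq 1 5 3 2)) = int p ^ a"
    by (simp add: csq_def sq_def wedge_def)
  finally have "nat d dvd p ^ a" using d(1) by (metis int_dvd_int_iff int_nat_eq of_nat_power)
  then obtain k where k: "k \<le> a" "nat d = p ^ k" using divides_primepow_nat[OF p] by blast
  then have dk: "d = int p ^ k" using d(1) by (metis int_nat_eq of_nat_power)
  show ?thesis
    by (rule that[OF k(1)]) (use d(2) sq_spans[OF U n d(3)] in \<open>auto simp: dk even_lat_def\<close>)
qed

text \<open>Truncated subtraction makes the claim trivial when \<open>k\<close> is at most the
  multiplicity.\<close>

lemma prime_power_dvd_cancel:
  assumes p: "prime p" and n: "n > 0" and dvd: "int p ^ k dvd int n * x"
  shows "int p ^ (k - multiplicity p n) dvd x"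
proof -
  obtain m where m: "n = p ^ multiplicity p n * m" "\<not> p dvd m"
    using multiplicity_decompose'[of n p] n p by (auto simp: prime_nat_iff)
  let ?v = "multiplicity p n"
  have cop: "coprime (int p ^ (k - ?v)) (int m)"
    using m(2) p by (simp add: prime_imp_coprime)
  show ?thesis
  proof (cases "?v \<le> k")
    case True
    then have "int p ^ ?v * int p ^ (k - ?v) dvd int p ^ ?v * (int m * x)"
      using dvd m(1) by (metis le_add_diff_inverse mult.assoc of_nat_mult of_nat_power power_add)
    then have "int p ^ (k - ?v) dvd int m * x"
      using p by (simp add: prime_gt_0_nat)
    then show ?thesis using cop by (simp add: coprime_dvd_mult_right_iff)
  qed simp
qed

text \<open>As 2 is invertible modulo \<open>p\<close>, all triangle values vanish modulo the
  content and \<open>U\<close> contains the content times every cycle. What remains free is how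
  large a power of \<open>p\<close> divides all entries; once it is divided out,
  \<open>tri_lat_subset\<close> fixes the lattice.\<close>

theorem odd_prime_classification:
  assumes U: "sublat n U" and n: "n \<ge> 5" and p: "prime p" "p \<noteq> 2"
    and a: "\<And>y. y \<in> cycles n \<Longrightarrow> smul (int p ^ a) y \<in> U"
  shows "\<exists>r i. i \<le> multiplicity p n \<and> U = smul (int p ^ r) ` tri_lat n (int p ^ i)"
proof -
  interpret sublat n U by fact
  obtain k where k: "k \<le> a"
    "\<And>x i j k' l. x \<in> U \<Longrightarrow> distinct [i, j, k', l] \<Longrightarrow> {i, j, k', l} \<subseteq> {1..n} \<Longrightarrow> int p ^ k dvd csq i j k' l x"
    "\<And>y. y \<in> even_lat n \<Longrightarrow> smul (int p ^ k) y \<in> U"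
    using square_content_prime_power[OF U n p(1) a] by metis
  have odd: "odd p" using p prime_odd_nat[of p] prime_ge_2_nat[of p] by force
  \<comment> \<open>Twice a cycle has even parity, which puts \<open>2 * p ^ k\<close> times it into
    \<open>U\<close>; so is \<open>p ^ a\<close> times it, and \<open>p\<close> is odd.\<close>
  have kU: "smul (int p ^ k) y \<in> U" if y: "y \<in> cycles n" for y
  proof (rule smul_coprime)
    have "smul 2 y \<in> even_lat n" using y by (simp add: even_lat_def cycles.smul par_smul)
    from k(3)[OF this] show "smul 2 (smul (int p ^ k) y) \<in> U"
      by (simp add: smul_smul mult.commute)
    show "smul (int p ^ (a - k)) (smul (int p ^ k) y) \<in> U"
      using a[OF y] k(1) by (simp add: smul_smul flip: power_add)
    show "coprime 2 (int p ^ (a - k))" using odd by simp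
  qed
  have xc: "x \<in> cycles n" if "x \<in> U" for x using that sub by blast
  have e: "int p ^ k dvd tau 1 2 3 x" if x: "x \<in> U" for x
    using tau_cong(1)[OF n xc[OF x] k(2)[OF x]] odd by (simp add: coprime_dvd_mult_right_iff)
  have tau: "int p ^ k dvd tau i j l x"
    if x: "x \<in> U" and ijl: "i \<in> {1..n}" "j \<in> {1..n}" "l \<in> {1..n}" for x i j l
  proof (cases "distinct [i, j, l]")
    case True
    have "int p ^ k dvd tau i j l x - tau 1 2 3 x"
      by (rule tau_cong(2)[OF n xc[OF x] k(2)[OF x] True]) (use ijl in auto)
    from dvd_add[OF this e[OF x]] show ?thesis by simp
  next
    case False
    then show ?thesis by (subst tau_degenerate[OF xc[OF x]]) simp_all
  qed
  have ent: "int p ^ k dvd int n * x i j"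
    if x: "x \<in> U" and ij: "i \<in> {1..n}" "j \<in> {1..n}" for x i j
  proof (cases "i = j")
    case False
    have "int p ^ k dvd int n * x i j - (int n - 2) * tau 1 2 3 x"
      by (rule tau_cong(3)[OF n xc[OF x] k(2)[OF x] ij False])
    from dvd_add[OF this dvd_mult[OF e[OF x], of "int n - 2"]] show ?thesis by simp
  qed (simp add: cycles_diag[OF xc[OF x]])
  \<comment> \<open>The cap \<open>k\<close> ensures that \<open>k - r\<close> is the exponent left
    after dividing by \<open>p ^ r\<close>. The edge congruence puts
    \<open>k - multiplicity p n\<close> into \<open>R\<close>, which bounds that exponent by the
    multiplicity.\<close>
  define R where "R = {r. r \<le> k \<and> (\<forall>x\<in>U. \<forall>i\<in>{1..n}. \<forall>j\<in>{1..n}. int p ^ r dvd x i j)}"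
  define r where "r = Max R"
  have fin: "finite R" by (rule finite_subset[of _ "{..k}"]) (auto simp: R_def)
  have v: "k - multiplicity p n \<in> R"
    using prime_power_dvd_cancel[OF p(1) _ ent] n by (auto simp: R_def)
  then have r: "r \<in> R" "k - multiplicity p n \<le> r"
    unfolding r_def using fin by (auto intro!: Max_in)
  define i where "i = k - r"
  have ki: "k = r + i" using r(1) by (simp add: i_def R_def)
  have i: "i \<le> multiplicity p n" using r(2) by (simp add: i_def)
  have p0: "int p ^ m \<noteq> 0" for m using p by auto
  define V where "V = {y \<in> cycles n. smul (int p ^ r) y \<in> U}"
  have UV: "U = smul (int p ^ r) ` V"
    unfolding V_def by (rule sublat_divide_eq[OF U p0]) (use r(1) in \<open>auto simp: R_def\<close>)
  have V: "sublat n V" unfolding V_def by (rule sublat_divide[OF U])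
  have VL: "V \<subseteq> tri_lat n (int p ^ i)"
  proof
    fix y assume y: "y \<in> V"
    have "int p ^ i dvd tau a b c y" if "a \<in> {1..n}" "b \<in> {1..n}" "c \<in> {1..n}" for a b c
    proof -
      have "int p ^ k dvd tau a b c (smul (int p ^ r) y)" using tau that y by (auto simp: V_def)
      then have "int p ^ r * int p ^ i dvd int p ^ r * tau a b c y"
        by (simp only: tau_simps ki power_add)
      then show ?thesis using p0[of r] by (metis dvd_mult_cancel_left)
    qed
    then show "y \<in> tri_lat n (int p ^ i)" using y by (simp add: tri_lat_def V_def)
  qed
  have DV: "smul (int p ^ i) y \<in> V" if "y \<in> cycles n" for y
    using kU[OF that] that by (simp add: V_def cycles.smul smul_smul ki power_add)
  have "tri_lat n (int p ^ i) \<subseteq> V"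
  proof (cases "i = 0")
    case True
    then show ?thesis using DV by (auto simp: tri_lat_def)
  next
    case False
    \<comment> \<open>By maximality some entry is not divisible by the next power; after division it
      is prime to \<open>p\<close>, as \<open>tri_lat_subset\<close> requires.\<close>
    then have "Suc r \<notin> R" using Max_ge[OF fin, of "Suc r"] r_def by auto
    then obtain x a b where x: "x \<in> U" "a \<in> {1..n}" "b \<in> {1..n}" "\<not> int p ^ Suc r dvd x a b"
      using False by (auto simp: R_def i_def)
    obtain y where y: "y \<in> V" "x = smul (int p ^ r) y" using x(1) UV by blast
    have nd: "\<not> int p dvd y a b"
      using x(4) y(2) p0[of r] by (auto simp: mult.commute)
    show ?thesis
    proof (rule tri_lat_subset[OF V _ DV y(1) _ x(2,3)])
      show "y \<in> tri_lat n (int p ^ i)" using VL y(1) by blast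
      show "a \<noteq> b"
      proof
        assume "a = b"
        then have "y a b = 0" using cycles_diag[of y n a] y(1) by (simp add: V_def)
        with nd show False by simp
      qed
      have "prime (int p)" using p by simp
      from prime_imp_coprime[OF this nd] show "coprime (y a b) (int p ^ i)"
        by (simp add: coprime_commute)
      show "0 < int p ^ i" using p by (simp add: prime_gt_0_nat)
    qed
  qed
  with VL UV i show ?thesis by blast
qed

subsection \<open>The prime 2\<close>

text \<open>With \<open>sum_row_2\<close> this reduces the parity of a cycle supported on rows and
  columns 1 and 2 to the entry \<open>x 1 2\<close>.\<close>

lemma sum_wedge_pairs_row:
  fixes f :: "nat \<Rightarrow> nat \<Rightarrow> int"
  assumes "\<And>i j. (i, j) \<in> wedge_pairs n \<Longrightarrow> i \<noteq> 2 \<Longrightarrow> f i j = 0"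
  shows "(\<Sum>(i, j)\<in>wedge_pairs n. f i j) = (\<Sum>j=3..n. f 2 j)"
proof -
  have "(\<Sum>(i, j)\<in>wedge_pairs n. f i j) = (\<Sum>(i, j)\<in>Pair 2 ` {3..n}. f i j)"
  proof (rule sum.mono_neutral_right)
    show "\<forall>q\<in>wedge_pairs n - Pair 2 ` {3..n}. (case q of (i, j) \<Rightarrow> f i j) = 0"
    proof clarify
      fix i j assume ij: "(i, j) \<in> wedge_pairs n" "(i, j) \<notin> Pair 2 ` {3..n}"
      then have "i \<noteq> 2" by (auto simp: wedge_pairs_def)
      with ij(1) show "f i j = 0" by (rule assms)
    qed
  qed (rule finite_wedge_pairs, auto simp: wedge_pairs_def)
  then show ?thesis by (simp add: sum.reindex inj_on_def)
qed

lemma sum_row_2: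
  assumes x: "x \<in> cycles n" and n: "n \<ge> 2"
  shows "(\<Sum>j=3..n. x 2 j) = x 1 2"
proof -
  have "(\<Sum>j=1..n. x 2 j) = x 2 1 + (\<Sum>j=2..n. x 2 j)"
    using n by (intro sum_from_1) simp
  also have "(\<Sum>j=2..n. x 2 j) = x 2 2 + (\<Sum>j=3..n. x 2 j)"
    using n by (simp add: sum.atLeast_Suc_atMost numeral_2_eq_2 numeral_3_eq_3)
  finally show ?thesis
    using cycles_row[OF x, of 2] cycles_diag[OF x, of 2] cycles_anti[OF x, of 2 1] by simp
qed

text \<open>
  The sum of the cycles \<open>v - relabel (transpose 1 l) v\<close> over \<open>l\<close>, minus \<open>v\<close>, has the coefficients
  \<open>tau 1 a b v\<close>.
\<close>

lemma (in sublat) tau_comb_mem: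
  assumes v: "v \<in> U" and n: "n \<ge> 1"
  shows "wedge_comb n (\<lambda>a b. tau 1 a b v) \<in> U"
proof -
  let ?z = "(\<Sum>l=2..n. v - relabel (transpose 1 l) v) - v"
  have z: "?z \<in> U" using n v by (intro diff sum reflect) auto
  have vc: "v \<in> cycles n" using v sub by blast
  have "wedge_comb n (\<lambda>a b. tau 1 a b v) = ?z"
  proof (rule cycles_eqI[OF wedge_comb_cycles])
    show "?z \<in> cycles n" using z sub by blast
    fix a b assume ab: "(a, b) \<in> wedge_pairs n"
    have ab': "2 \<le> a" "a < b" "b \<le> n" using ab by (auto simp: wedge_pairs_def)
    have "(\<Sum>l=2..n. v - relabel (transpose 1 l) v) a b =
      (\<Sum>l\<in>{2..n}. (if l = a then v a b - v 1 b else 0) + (if l = b then v a b - v a 1 else 0))"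
      unfolding sum_fun_apply
      by (rule sum.cong) (use ab' in \<open>auto simp: transpose_def\<close>)
    also have "\<dots> = 2 * v a b - v 1 b - v a 1"
      using ab' by (simp add: sum.distrib)
    finally show "wedge_comb n (\<lambda>a b. tau 1 a b v) a b = ?z a b"
      using ab cycles_anti[OF vc, of 1 a] cycles_anti[OF vc, of 1 b]
      by (simp add: wedge_comb_coeff tau_def)
  qed
  with z show ?thesis by simp
qed

lemma tri_par_csq:
  assumes x: "x \<in> cycles n"
    and e: "\<And>i j k. distinct [i, j, k] \<Longrightarrow> {i, j, k} \<subseteq> {1..n} \<Longrightarrow> even (tau i j k x - e)"
    and ijkl: "distinct [i, j, k, l]" "{i, j, k, l} \<subseteq> {1..n}"
  shows "even (csq i j k l x)"
proof -
  have "even (tau j i k x - e)" "even (tau j i l x - e)" using ijkl by (auto intro!: e simp del: even_diff)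
  from dvd_diff[OF this] show ?thesis using tau_diff[OF x, of j i k l] by simp
qed

text \<open>
  Put \<open>y = w - relabel (transpose 1 2) w\<close>. If the triangle values of \<open>w\<close> are odd, then \<open>y / 2\<close> is
  integral and has odd parity. If they are even, then \<open>n\<close> is 2 modulo 4, and half of the cycle that
  \<open>tau_comb_mem\<close> builds from \<open>y\<close> has odd parity.
\<close>

lemma two_adic_double:
  assumes U: "sublat n U" and n: "n \<ge> 5" "\<not> 4 dvd n"
    and par: "U \<subseteq> tri_par n" and w: "w \<in> U" "odd (w 1 2)"
  shows "\<exists>z. z \<in> cycles n \<and> odd (par n z) \<and> smul 2 z \<in> U"
proof -
  interpret sublat n U by fact
  have wc: "w \<in> cycles n" using w sub by blast
  note A = cycles_anti[OF wc] and D = cycles_diag[OF wc]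
  obtain e where e: "\<And>i j k. distinct [i, j, k] \<Longrightarrow> {i, j, k} \<subseteq> {1..n} \<Longrightarrow> even (tau i j k w - e)"
    using tri_parE[of w n] w(1) par by blast
  have tau2: "even (w 1 2 + w 2 l - w 1 l - e)" if "l \<in> {3..n}" for l
    using e[of 1 2 l] that A[of l 1] by (auto simp: tau_def)
  define y where "y = w - relabel (transpose 1 2) w"
  have y: "y \<in> U" unfolding y_def using n w(1) by (intro reflect) auto
  have yc: "y \<in> cycles n" using y sub by blast
  note Ay = cycles_anti[OF yc] and Dy = cycles_diag[OF yc]
  have y12: "y 1 2 = 2 * w 1 2" using A[of 2 1] by (simp add: y_def)
  have y2: "y 2 l = w 2 l - w 1 l" "y 1 l = w 1 l - w 2 l" if "l \<in> {3..n}" for l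
    using that by (simp_all add: y_def transpose_def)
  have y0: "y i j = 0" if "i \<in> {3..n}" "j \<in> {3..n}" for i j
    using that by (simp add: y_def transpose_def)
  show ?thesis
  proof (cases "even e")
    case False
    have "even (y i j)" if ij: "i \<in> {1..n}" "j \<in> {1..n}" for i j
    proof -
      have ev: "even (y 1 l)" "even (y 2 l)" if "l \<in> {1..n}" for l
      proof -
        have "l = 1 \<or> l = 2 \<or> l \<in> {3..n}" using that by auto
        then show "even (y 1 l)" "even (y 2 l)"
          using tau2[of l] y2[of l] y12 Ay[of 2 1] Dy[of 1] Dy[of 2] w(2) False by auto
      qed
      have "i = 1 \<or> i = 2 \<or> i \<in> {3..n}" "j = 1 \<or> j = 2 \<or> j \<in> {3..n}" using ij by auto
      then show ?thesis
        using ev ij Ay[of i 1] Ay[of i 2] y0[of i j] by auto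
    qed
    then obtain z where z: "z \<in> cycles n" "y = smul 2 z"
      using cycles_divide[OF yc, of 2] by auto
    \<comment> \<open>All entries of \<open>z\<close> outside the rows and columns 1 and 2
      vanish.\<close>
    have "par n z = (\<Sum>j=3..n. z 2 j)"
      unfolding par_def
    proof (rule sum_wedge_pairs_row)
      show "z i j = 0" if "(i, j) \<in> wedge_pairs n" "i \<noteq> 2" for i j
        using y0[of i j] that by (auto simp: z(2) wedge_pairs_def)
    qed
    also have "\<dots> = z 1 2" using n by (intro sum_row_2[OF z(1)]) simp
    also have "\<dots> = w 1 2" using y12 by (simp add: z(2))
    finally show ?thesis using w(2) y z by auto
  next
    case True
    have "even (tau 1 2 3 w)" using e[of 1 2 3] n True by auto
    \<comment> \<open>Since the triangle values are even, \<open>n * w 1 2\<close> is even as well;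
      the odd entry forces \<open>n\<close> to be even, hence 2 modulo 4.\<close>
    moreover have "2 dvd int n * w 1 2 - (int n - 2) * tau 1 2 3 w"
      by (rule tau_cong(3)[OF n(1) wc tri_par_csq[OF wc e]]) (assumption+, use n in auto)
    ultimately have "even n" using w(2) by simp
    with n(2) have n4: "4 dvd int n - 2" by presburger
    define h where "h = (\<lambda>l. w 2 l - w 1 l)"
    \<comment> \<open>\<open>h l\<close> is the entry \<open>y 2 l\<close>; it is odd because the
      triangle 1 2 \<open>l\<close> has even value and \<open>w 1 2\<close> is odd.\<close>
    define k where "k = (\<lambda>l. (h l - 1) div 2)"
    have hk: "h l = 2 * k l + 1" if "l \<in> {3..n}" for l
    proof -
      have "odd (h l)" using tau2[OF that] w(2) True by (auto simp: h_def)
      then show ?thesis by (simp add: k_def)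
    qed
    \<comment> \<open>Half of \<open>tau 1 a b y\<close>: for \<open>a = 2\<close> that value is
      \<open>2 * w 1 2 + 2 * h b\<close>, otherwise it is \<open>h b - h a\<close>.\<close>
    define z where "z = wedge_comb n (\<lambda>a b. if a = 2 then w 1 2 + h b else k b - k a)"
    have zc: "z \<in> cycles n" unfolding z_def by (rule wedge_comb_cycles)
    have zU: "smul 2 z \<in> U"
    proof -
      have "smul 2 z = wedge_comb n (\<lambda>a b. tau 1 a b y)"
      proof (rule cycles_eqI[OF cycles.smul[OF zc] wedge_comb_cycles])
        fix a b assume ab: "(a, b) \<in> wedge_pairs n"
        then have b: "b \<in> {3..n}" and a: "a = 2 \<or> a \<in> {3..n}" by (auto simp: wedge_pairs_def)
        have "tau 1 a b y = 2 * (if a = 2 then w 1 2 + h b else k b - k a)"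
          using a b y12 y2[OF b] y2[of a] y0[of a b] Ay[of b 1] hk[of a] hk[of b]
          by (auto simp: tau_def h_def)
        then show "smul 2 z a b = wedge_comb n (\<lambda>a b. tau 1 a b y) a b"
          by (simp add: z_def wedge_comb_coeff[OF ab])
      qed
      then show ?thesis using tau_comb_mem[OF y] n by simp
    qed
    \<comment> \<open>The default 0 at vertex 2 makes the degree count applicable to all pairs.
      Pairs with \<open>a = 2\<close> have an even coefficient in \<open>z\<close>, so their
      contribution \<open>k b\<close> is taken out again.\<close>
    let ?K = "\<lambda>l. if l = 2 then 0 else k l"
    let ?s = "\<Sum>b=3..n. k b"
    have ev: "even (par n z - (\<Sum>(a, b)\<in>wedge_pairs n. (?K a + ?K b) - (if a = 2 then k b else 0)))"
      unfolding par_def case_prod_unfold sum_subtractf[symmetric]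
    proof (rule dvd_sum)
      fix q assume q: "q \<in> wedge_pairs n"
      obtain a b where ab: "q = (a, b)" by force
      then have b: "b \<in> {3..n}" using q by (auto simp: wedge_pairs_def)
      have "even (w 1 2 + h b)" using hk[OF b] w(2) by simp
      then show "even (z (fst q) (snd q) - (?K (fst q) + ?K (snd q) - (if fst q = 2 then k (snd q) else 0)))"
        using q b by (auto simp: ab z_def wedge_comb_coeff)
    qed
    have split: "(\<Sum>(a, b)\<in>wedge_pairs n. (?K a + ?K b) - (if a = 2 then k b else 0)) =
      (\<Sum>(a, b)\<in>wedge_pairs n. ?K a + ?K b) - (\<Sum>(a, b)\<in>wedge_pairs n. if a = 2 then k b else 0)"
      by (simp add: case_prod_unfold sum_subtractf)
    have row: "(\<Sum>(a, b)\<in>wedge_pairs n. if a = 2 then k b else 0) = ?s"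
      by (subst sum_wedge_pairs_row) auto
    \<comment> \<open>Row 2 of \<open>y\<close> gives \<open>2 * w 1 2 = 2 * ?s + (n - 2)\<close>;
      since 4 divides \<open>n - 2\<close>, the sum inherits the parity of
      \<open>w 1 2\<close>.\<close>
    have odd: "odd ?s"
    proof -
      have "2 * w 1 2 = (\<Sum>b=3..n. y 2 b)" using sum_row_2[OF yc] n y12 by simp
      also have "\<dots> = (\<Sum>b=3..n. 2 * k b + 1)"
        using y2 hk by (intro sum.cong) (auto simp: h_def)
      also have "\<dots> = 2 * ?s + (int n - 2)"
        using n by (simp add: sum.distrib sum_distrib_left of_nat_diff)
      finally have "2 * w 1 2 = 2 * ?s + (int n - 2)" .
      with n4 w(2) show ?thesis by presburger
    qed
    have "even ((int n - 2) * (\<Sum>i=2..n. ?K i))" using n4 by (intro dvd_mult2) presburger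
    then have "odd (par n z)"
      using ev odd unfolding split row sum_wedge_pairs_add even_diff even_add by blast
    with zc zU show ?thesis by blast
  qed
qed

text \<open>For odd \<open>n\<close> the edge congruence makes every entry even. Hence
  \<open>tri_lat n 2\<close> is no new representative, and only three lattices remain at 2.\<close>

lemma tri_lat_2_odd:
  assumes n: "n \<ge> 5" "odd n"
  shows "tri_lat n 2 = smul 2 ` cycles n"
proof (intro equalityI subsetI)
  fix x assume x: "x \<in> tri_lat n 2"
  then have xc: "x \<in> cycles n" by (simp add: tri_lat_def)
  have e: "even (tau i j k x - 0)" if "{i, j, k} \<subseteq> {1..n}" for i j k
    using x that by (auto simp: tri_lat_def)
  have "even (x i j)" if ij: "i \<in> {1..n}" "j \<in> {1..n}" for i j
  proof (cases "i = j")
    case False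
    have "2 dvd int n * x i j - (int n - 2) * tau 1 2 3 x"
      using ij False e by (intro tau_cong(3)[OF n(1) xc tri_par_csq[OF xc, of 0]]) auto
    moreover have "even (tau 1 2 3 x)" using e[of 1 2 3] n by auto
    ultimately show ?thesis using n(2) by simp
  qed (simp add: cycles_diag[OF xc])
  then show "x \<in> smul 2 ` cycles n" using cycles_divide[OF xc, of 2] by (metis image_eqI zero_neq_numeral)
qed (auto simp: tri_lat_def cycles.smul tau_simps)

text \<open>Cycles with odd triangle values differ by one with even values, so nothing fits strictly
  between \<open>tri_lat n 2\<close> and \<open>tri_par n\<close>. The work is to get
  \<open>tri_lat n 2\<close> into \<open>U\<close>: \<open>two_adic_double\<close> supplies the
  doubles of all cycles, and for even \<open>n\<close> an element with even triangle values and an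
  odd entry is found for \<open>tri_lat_subset\<close>.\<close>

lemma two_adic_core:
  assumes U: "sublat n U" and n: "n \<ge> 5" "\<not> 4 dvd n"
    and even: "\<And>y. y \<in> even_lat n \<Longrightarrow> smul 2 y \<in> U"
    and par: "U \<subseteq> tri_par n" and x: "x \<in> U" "odd (x a b)"
  shows "U = tri_lat n 2 \<or> U = tri_par n"
proof -
  interpret sublat n U by fact
  have xc: "x \<in> cycles n" using x sub by blast
  have ab: "a \<in> {1..n}" "b \<in> {1..n}" "a \<noteq> b"
  proof -
    have "x a b \<noteq> 0" using x(2) by auto
    then show "a \<in> {1..n}" "b \<in> {1..n}" "a \<noteq> b"
      using cycles_outside[OF xc, of a b] cycles_diag[OF xc, of a] by blast+
  qed
  obtain \<sigma> where \<sigma>: "\<sigma> permutes {1..n}" "map \<sigma> [1, 2] = [a, b]"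
    using permutes_map_eq[of "[1, 2]" "[a, b]" "{1..n}"] n ab by auto
  define w where "w = relabel \<sigma> x"
  have w: "w \<in> U" "odd (w 1 2)" unfolding w_def using relabel[OF \<sigma>(1) x(1)] x(2) \<sigma>(2) by auto
  have wc: "w \<in> cycles n" using w sub by blast
  obtain z where z: "z \<in> cycles n" "odd (par n z)" "smul 2 z \<in> U"
    using two_adic_double[OF U n par w] by blast
  have dbl: "smul 2 y \<in> U" if "y \<in> cycles n" for y
    using even_lat_odd[OF sublat_divide[OF U, of 2], of z] z even that by (auto simp: even_lat_def)
  have L: "tri_lat n 2 \<subseteq> U"
  proof (cases "even n")
    case False
    then show ?thesis using dbl tri_lat_2_odd n by auto
  next
    case True
    obtain e where e: "\<And>i j k. distinct [i, j, k] \<Longrightarrow> {i, j, k} \<subseteq> {1..n} \<Longrightarrow> even (tau i j k w - e)"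
      using tri_parE[of w n] w(1) par by blast
    have "\<exists>v\<in>U. v \<in> tri_lat n 2 \<and> (\<exists>i\<in>{1..n}. \<exists>j\<in>{1..n}. odd (v i j))"
    proof (cases "even e")
      case e0: True
      have "even (tau i j k w)" if "i \<in> {1..n}" "j \<in> {1..n}" "k \<in> {1..n}" for i j k
        using e[of i j k] e0 that tau_degenerate[OF wc, of i j k] by (cases "distinct [i, j, k]") auto
      then have "w \<in> tri_lat n 2" using wc by (simp add: tri_lat_def)
      then show ?thesis using w n by (intro bexI[of _ w] conjI bexI[of _ 1] bexI[of _ 2]) auto
    next
      case e1: False
      \<comment> \<open>Otherwise the \<open>n - 1\<close> entries of row 1 off the diagonal would
        all be odd, and an odd number of odd entries cannot sum to zero. Subtracting the reflection
        in \<open>l\<close> and 2 makes all triangle values even and leaves an odd entry.\<close>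
      have "\<exists>l\<in>{3..n}. odd (w l 1 - w 2 1)"
      proof (rule ccontr)
        assume *: "\<not> (\<exists>l\<in>{3..n}. odd (w l 1 - w 2 1))"
        have "even (\<Sum>l=2..n. w 1 l - w 1 2)"
        proof (rule dvd_sum)
          fix l assume "l \<in> {2..n}"
          then have "l = 2 \<or> l \<in> {3..n}" by auto
          then have "even (w l 1 - w 2 1)" using * by auto
          then show "even (w 1 l - w 1 2)"
            unfolding cycles_anti[OF wc, of l 1] cycles_anti[OF wc, of 2 1] by simp
        qed
        moreover have "(\<Sum>l=2..n. w 1 l - w 1 2) = - (int n - 1) * w 1 2"
          using sum_from_1[of n "w 1"] cycles_row[OF wc, of 1] cycles_diag[OF wc, of 1] n
          by (simp add: sum_subtractf of_nat_diff algebra_simps)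
        ultimately show False using w(2) True by simp
      qed
      then obtain l where l: "l \<in> {3..n}" "odd (w l 1 - w 2 1)" by blast
      define v where "v = w - relabel (transpose l 2) w"
      have v: "v \<in> U" unfolding v_def using l n w(1) by (intro reflect) auto
      have vc: "v \<in> cycles n" using v sub by blast
      have "even (tau i j k v)" if ijk: "i \<in> {1..n}" "j \<in> {1..n}" "k \<in> {1..n}" for i j k
      proof (cases "distinct [i, j, k]")
        case True
        let ?t = "transpose l 2"
        have t: "?t permutes {1..n}" using l n by (intro permutes_swap_id) auto
        have "even (tau (?t i) (?t j) (?t k) w - e)"
          using True ijk permutes_in_image[OF t] permutes_inj[OF t] by (intro e) (auto simp: inj_eq)
        moreover have "even (tau i j k w - e)" using True ijk by (intro e) auto
        ultimately show ?thesis by (simp add: v_def tau_simps)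
      next
        case False
        then show ?thesis by (subst tau_degenerate[OF vc]) simp_all
      qed
      then have "v \<in> tri_lat n 2" using vc by (simp add: tri_lat_def)
      moreover have "odd (v l 1)" using l by (simp add: v_def transpose_def)
      ultimately show ?thesis using v l n by (intro bexI[of _ v] conjI bexI[of _ l] bexI[of _ 1]) auto
    qed
    then obtain v i j where v: "v \<in> U" "v \<in> tri_lat n 2" "i \<in> {1..n}" "j \<in> {1..n}" "odd (v i j)" by blast
    moreover have "i \<noteq> j" using v(2,5) cycles_diag[of v n i] by (auto simp: tri_lat_def)
    ultimately show ?thesis using tri_lat_subset[OF U, of 2 v i j] dbl by simp
  qed
  show ?thesis
  proof (cases "U \<subseteq> tri_lat n 2")
    case True then show ?thesis using L by blast
  next
    case False
    then obtain v where v: "v \<in> U" "v \<notin> tri_lat n 2" by blast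
    have vp: "v \<in> tri_par n" using v par by blast
    then have vc: "v \<in> cycles n" by (simp add: tri_par_def)
    have "tri_par n \<subseteq> U"
    proof
      fix y assume y: "y \<in> tri_par n"
      then have yc: "y \<in> cycles n" by (simp add: tri_par_def)
      obtain e where e: "\<And>i j k. distinct [i, j, k] \<Longrightarrow> {i, j, k} \<subseteq> {1..n} \<Longrightarrow> even (tau i j k v - e)"
        using tri_parE[OF vp] by blast
      obtain f where f: "\<And>i j k. distinct [i, j, k] \<Longrightarrow> {i, j, k} \<subseteq> {1..n} \<Longrightarrow> even (tau i j k y - f)"
        using tri_parE[OF y] by blast
      have lat: "u \<in> tri_lat n 2" if u: "u \<in> cycles n"
        and *: "\<And>i j k. distinct [i, j, k] \<Longrightarrow> {i, j, k} \<subseteq> {1..n} \<Longrightarrow> even (tau i j k u)" for u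
      proof -
        have "even (tau i j k u)" if "i \<in> {1..n}" "j \<in> {1..n}" "k \<in> {1..n}" for i j k
          using *[of i j k] that tau_degenerate[OF u, of i j k] by (cases "distinct [i, j, k]") auto
        then show ?thesis using u by (simp add: tri_lat_def)
      qed
      have "odd e"
      proof
        assume "even e"
        then have "v \<in> tri_lat n 2" using e by (intro lat[OF vc]) (auto simp: even_diff_iff)
        with v(2) show False by blast
      qed
      show "y \<in> U"
      proof (cases "even f")
        case True
        then have "y \<in> tri_lat n 2" using f by (intro lat[OF yc]) auto
        then show ?thesis using L by blast
      next
        case False
        have "y - v \<in> tri_lat n 2"
        proof (rule lat[OF cycles.diff[OF yc vc]])
          fix i j k :: nat assume "distinct [i, j, k]" "{i, j, k} \<subseteq> {1..n}"
          with e f have "even (tau i j k v - e)" "even (tau i j k y - f)" by blast+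
          then show "even (tau i j k (y - v))" using \<open>odd e\<close> False by (simp add: tau_simps)
        qed
        then have "y - v \<in> U" using L by blast
        from add[OF this v(1)] show ?thesis by simp
      qed
    qed
    then show ?thesis using par by blast
  qed
qed

text \<open>Either the content \<open>2 ^ k\<close> divides all entries, and the quotient contains
  the index 2 lattice \<open>even_lat n\<close>; or only \<open>2 ^ (k - 1)\<close> does, and the
  quotient has an odd entry and falls under \<open>two_adic_core\<close>.\<close>

theorem two_classification:
  assumes U: "sublat n U" and n: "n \<ge> 5" "\<not> 4 dvd n"
    and a: "\<And>y. y \<in> cycles n \<Longrightarrow> smul (2 ^ a) y \<in> U"
  shows "\<exists>r. \<exists>V\<in>{cycles n, even_lat n, tri_lat n 2, tri_par n}. U = smul (2 ^ r) ` V"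
proof -
  interpret sublat n U by fact
  obtain k where k: "k \<le> a"
    "\<And>x i j k' l. x \<in> U \<Longrightarrow> distinct [i, j, k', l] \<Longrightarrow> {i, j, k', l} \<subseteq> {1..n} \<Longrightarrow> 2 ^ k dvd csq i j k' l x"
    "\<And>y. y \<in> even_lat n \<Longrightarrow> smul (2 ^ k) y \<in> U"
    using square_content_prime_power[OF U n(1) two_is_prime_nat, of a] a by (metis of_nat_numeral)
  have div: "sublat n {y \<in> cycles n. smul (2 ^ m) y \<in> U}" for m by (rule sublat_divide[OF U])
  show ?thesis
  proof (cases "\<forall>x\<in>U. \<forall>i\<in>{1..n}. \<forall>j\<in>{1..n}. 2 ^ k dvd x i j")
    case True
    define V where "V = {y \<in> cycles n. smul (2 ^ k) y \<in> U}"
    have UV: "U = smul (2 ^ k) ` V"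
      unfolding V_def using True by (intro sublat_divide_eq[OF U]) auto
    have "even_lat n \<subseteq> V" using k(3) by (auto simp: V_def even_lat_def)
    then have "V = even_lat n \<or> V = cycles n"
      using even_lat_odd[of n V] div[of k] unfolding V_def[symmetric]
      by (auto simp: even_lat_def V_def)
    with UV show ?thesis by blast
  next
    case False
    then obtain x a b where x: "x \<in> U" "a \<in> {1..n}" "b \<in> {1..n}" "\<not> 2 ^ k dvd x a b" by blast
    then obtain m where m: "k = Suc m" by (cases k) auto
    have tau: "2 ^ k dvd 2 * tau 1 2 3 y"
      "\<And>i j l. distinct [i, j, l] \<Longrightarrow> {i, j, l} \<subseteq> {1..n} \<Longrightarrow> 2 ^ k dvd tau i j l y - tau 1 2 3 y"
      "\<And>i j. i \<in> {1..n} \<Longrightarrow> j \<in> {1..n} \<Longrightarrow> i \<noteq> j \<Longrightarrow> 2 ^ k dvd int n * y i j - (int n - 2) * tau 1 2 3 y"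
      if "y \<in> U" for y
      using tau_cong[OF n(1) _ k(2)[OF that]] sub that by blast+
    \<comment> \<open>Eliminating the triangle value between the two congruences leaves
      \<open>2 ^ k dvd 2 * (q * y i j)\<close> with \<open>q\<close> odd, namely \<open>n\<close> or
      half of \<open>n\<close>. This is where 4 must not divide \<open>n\<close>.\<close>
    have half: "2 ^ m dvd y i j" if y: "y \<in> U" and ij: "i \<in> {1..n}" "j \<in> {1..n}" for y i j
    proof (cases "i = j")
      case True
      then show ?thesis using cycles_diag[of y n] y sub by auto
    next
      case False
      note t = tau(1)[OF y] tau(3)[OF y ij False]
      show ?thesis
      proof (cases "even n")
        case True
        then obtain q where q: "int n = 2 * q" "odd q"
        proof -
          have "even (int n)" "\<not> 4 dvd int n" using True n(2) by presburger+
          then have "int n = 2 * (int n div 2)" "odd (int n div 2)" by presburger+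
          then show ?thesis using that by blast
        qed
        have "2 ^ k dvd (q - 1) * (2 * tau 1 2 3 y)" using t(1) by (rule dvd_mult)
        from dvd_add[OF t(2) this] have "2 ^ Suc m dvd 2 * (q * y i j)"
          by (simp add: q(1) m algebra_simps)
        then have "2 ^ m dvd q * y i j" by simp
        then show ?thesis using q(2) by (simp add: coprime_dvd_mult_right_iff)
      next
        case False
        have "2 ^ k dvd 2 * (int n * y i j - (int n - 2) * tau 1 2 3 y) + (int n - 2) * (2 * tau 1 2 3 y)"
          by (intro dvd_add dvd_mult[OF t(2)] dvd_mult[OF t(1)])
        then have "2 ^ Suc m dvd 2 * (int n * y i j)" by (simp add: m algebra_simps)
        then have "2 ^ m dvd int n * y i j" by simp
        then show ?thesis using False by (simp add: coprime_dvd_mult_right_iff)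
      qed
    qed
    define V where "V = {y \<in> cycles n. smul (2 ^ m) y \<in> U}"
    have UV: "U = smul (2 ^ m) ` V"
      unfolding V_def using half by (intro sublat_divide_eq[OF U]) auto
    obtain v where v: "v \<in> V" "x = smul (2 ^ m) v" using x(1) UV by blast
    have "V = tri_lat n 2 \<or> V = tri_par n"
    proof (rule two_adic_core[OF _ n])
      show "sublat n V" unfolding V_def by (rule div)
      show "smul 2 y \<in> V" if "y \<in> even_lat n" for y
        using k(3)[OF that] that
        by (simp add: V_def smul_smul m mult.commute even_lat_def cycles.smul)
      show "V \<subseteq> tri_par n"
      proof
        fix y assume "y \<in> V"
        then have y: "y \<in> cycles n" "smul (2 ^ m) y \<in> U" by (auto simp: V_def)
        have "even (tau i j l y - tau 1 2 3 y)" if "distinct [i, j, l]" "{i, j, l} \<subseteq> {1..n}" for i j l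
        proof -
          have "2 ^ m * 2 dvd 2 ^ m * (tau i j l y - tau 1 2 3 y)"
            using tau(2)[OF y(2) that] by (simp add: tau_simps m algebra_simps)
          then show ?thesis by simp
        qed
        then show "y \<in> tri_par n" using y(1) unfolding tri_par_def by blast
      qed
      show "v \<in> V" by fact
      show "odd (v a b)" using x(4) by (auto simp: v(2) m)
    qed
    with UV show ?thesis by blast
  qed
qed

subsection \<open>The sets of representatives\<close>

lemma specht_simps:
  "\<zero>\<^bsub>specht_lattice n\<^esub> = 0"
  "x \<oplus>\<^bsub>specht_lattice n\<^esub> y = x + y"
  "k \<odot>\<^bsub>specht_lattice n\<^esub> x = smul k x"
  "act (specht_lattice n) \<sigma> x = relabel (inv' \<sigma>) x"
  "carrier (specht_lattice n) = cycles n"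
  by (simp_all add: carrier_specht)
     (simp_all add: specht_lattice_def ext_square_perm_def smul_def relabel_def fun_eq_iff)

lemma sn_module_specht: "sn_module n \<Z> (specht_lattice n)"
proof -
  let ?E = "ext_square_perm n"
  interpret E: sn_module n \<Z> ?E by (rule sn_module_ext_square_perm)
  have S: "specht_lattice n = ?E\<lparr>carrier := cycles n\<rparr>"
    using carrier_specht[of n] by (simp add: specht_lattice_def)
  have E: "\<zero>\<^bsub>?E\<^esub> = 0" "\<And>x y. x \<oplus>\<^bsub>?E\<^esub> y = x + y" "\<And>k x. k \<odot>\<^bsub>?E\<^esub> x = smul k x"
    by (simp_all add: ext_square_perm_simps fun_eq_iff)
  have sub: "cycles n \<subseteq> carrier ?E"
  proof
    fix x assume x: "x \<in> cycles n"
    show "x \<in> carrier ?E"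
      unfolding ext_square_perm_carrier_iff
      using cycles_diag[OF x] cycles_outside[OF x] cycles_anti[OF x] by (metis add.right_inverse)
  qed
  have "submodule (cycles n) \<Z> ?E"
  proof (rule E.submoduleI)
    fix x assume x: "x \<in> cycles n"
    have "\<ominus>\<^bsub>?E\<^esub> x = - x"
      using sub x cycles.minus[OF x] by (intro E.M.minus_equality) (auto simp: E)
    then show "\<ominus>\<^bsub>?E\<^esub> x \<in> cycles n" using cycles.minus[OF x] by simp
  qed (use sub in \<open>auto simp: E cycles.add cycles.smul\<close>)
  then have M: "module \<Z> (specht_lattice n)"
    unfolding S by (rule submodule.submodule_is_module) unfold_locales
  show ?thesis
  proof (rule sn_module.intro[OF M], rule sn_module_axioms.intro)
    fix \<sigma> x assume \<sigma>: "\<sigma> \<in> carrier (sym_group n)" and x: "x \<in> carrier (specht_lattice n)"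
    then show "act (specht_lattice n) \<sigma> x \<in> carrier (specht_lattice n)"
      by (simp add: specht_simps sym_group_carrier cycles.relabel permutes_inv)
  next
    fix \<sigma> \<tau> x assume "\<sigma> \<in> carrier (sym_group n)" "\<tau> \<in> carrier (sym_group n)" "x \<in> carrier (specht_lattice n)"
    then show "act (specht_lattice n) (\<sigma> \<otimes>\<^bsub>sym_group n\<^esub> \<tau>) x =
        act (specht_lattice n) \<sigma> (act (specht_lattice n) \<tau> x)"
      using E.act_mult sub by (simp add: S subset_iff)
  qed (simp_all add: specht_simps relabel_add relabel_smul sym_group_one, simp add: relabel_def)
qed

lemma sublatI:
  assumes "U \<subseteq> cycles n" "0 \<in> U" "\<And>x y. x \<in> U \<Longrightarrow> y \<in> U \<Longrightarrow> x - y \<in> U"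
    "\<And>\<sigma> x. \<sigma> permutes {1..n} \<Longrightarrow> x \<in> U \<Longrightarrow> relabel \<sigma> x \<in> U"
  shows "sublat n U"
  using assms by unfold_locales

lemma sn_sublattice_iff: "sn_sublattice n (specht_lattice n) U \<longleftrightarrow> sublat n U"
proof
  let ?S = "specht_lattice n"
  interpret S: sn_module n \<Z> ?S by (rule sn_module_specht)
  have neg: "\<ominus>\<^bsub>?S\<^esub> x = - x" if "x \<in> cycles n" for x
    using that cycles.minus[OF that] by (intro S.M.minus_equality) (auto simp: specht_simps)
  {
    assume U: "sn_sublattice n ?S U"
    then have sm: "submodule U \<Z> ?S"
      and act: "\<And>\<sigma> x. \<sigma> permutes {1..n} \<Longrightarrow> x \<in> U \<Longrightarrow> relabel (inv' \<sigma>) x \<in> U"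
      by (auto simp: sn_sublattice_def specht_simps sym_group_carrier)
    note E = S.submoduleE[OF sm, unfolded specht_simps]
    have neg': "- x \<in> U" if "x \<in> U" for x using E(3)[OF that] E(1) that neg[of x] by (auto simp: subset_iff)
    show "sublat n U"
    proof (rule sublatI[OF E(1)])
      show diff: "x - y \<in> U" if "x \<in> U" "y \<in> U" for x y
        using E(5)[OF that(1) neg'[OF that(2)]] by simp
      obtain x where "x \<in> U" using E(2) by blast
      from diff[OF this this] show "0 \<in> U" by simp
      show "relabel \<sigma> x \<in> U" if "\<sigma> permutes {1..n}" "x \<in> U" for \<sigma> x
        using act[OF permutes_inv[OF that(1)] that(2)] permutes_inv_inv[OF that(1)] by simp
    qed
  next
    assume U: "sublat n U"
    then interpret sublat n U .
    have "submodule U \<Z> ?S"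
      by (rule S.submoduleI)
         (use sub minus add smul neg in \<open>auto simp: specht_simps subset_iff\<close>)
    then show "sn_sublattice n ?S U"
      by (auto simp: sn_sublattice_def specht_simps sym_group_carrier intro!: relabel permutes_inv)
  }
qed

lemma sublat_smul_image:
  assumes "sublat n U" shows "sublat n (smul c ` U)"
proof -
  interpret sublat n U by fact
  show ?thesis
  proof (rule sublatI)
    show "smul c ` U \<subseteq> cycles n" using sub by (auto intro: cycles.smul)
    show "0 \<in> smul c ` U" by (rule image_eqI[of _ _ 0]) auto
    show "x - y \<in> smul c ` U" if "x \<in> smul c ` U" "y \<in> smul c ` U" for x y
      using that by (auto simp flip: smul_diff intro: diff)
    show "relabel \<sigma> x \<in> smul c ` U" if "\<sigma> permutes {1..n}" "x \<in> smul c ` U" for \<sigma> x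
      using that by (auto simp: relabel_smul intro!: imageI relabel)
  qed
qed

section \<open>Exterior squares of the lattices \<open>M_sub n d\<close>\<close>

abbreviation uvec :: "nat \<Rightarrow> nat \<Rightarrow> int"
  where "uvec n \<equiv> \<lambda>j. \<Sum>i=2..n. basis_diff i j"

lemma uvec_eq: "n \<ge> 1 \<Longrightarrow> uvec n j = (if j = 1 then 1 - int n else of_bool (j \<in> {2..n}))"
  by (auto simp: basis_diff_def sum_subtractf sum_of_bool_eq of_nat_diff
      simp flip: of_nat_sum intro!: card_eq_0_iff[THEN iffD2])

lemma wedge_uvec_cycles:
  assumes n: "n \<ge> 1" and m: "m \<in> natural_specht n"
  shows "wedge (uvec n) m \<in> cycles n"
proof (rule wedge_cycles)
  show "uvec n a = 0" if "a \<notin> {1..n}" for a using that n by (auto simp: uvec_eq)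
  show "m a = 0" if "a \<notin> {1..n}" for a using that m by (simp add: natural_specht_def perm_lattice_def)
  have "sum (uvec n) {2..n} = (\<Sum>j=2..n. 1)"
    using n by (intro sum.cong) (auto simp: uvec_eq)
  moreover have "sum (uvec n) {1..n} = uvec n 1 + sum (uvec n) {2..n}"
    using n by (intro sum_from_1) simp
  ultimately show "sum (uvec n) {1..n} = 0" using n by (simp only: uvec_eq) (simp add: of_nat_diff)
  show "sum m {1..n} = 0" using m by (simp add: natural_specht_def)
qed

text \<open>Modulo a divisor of \<open>n\<close> the vector \<open>uvec n\<close> is constant 1 on
  \<open>{1..n}\<close>, since its first entry is \<open>1 - n\<close>. Wedging with it is therefore
  the coboundary map.\<close>

lemma wedge_uvec_cong:
  assumes n: "n \<ge> 1" and d: "int d dvd int n" and ij: "i \<in> {1..n}" "j \<in> {1..n}"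
  shows "int d dvd wedge (uvec n) m i j - (m j - m i)"
proof -
  have u: "int d dvd uvec n i - 1" if "i \<in> {1..n}" for i using that n d by (auto simp: uvec_eq)
  have "int d dvd (uvec n i - 1) * m j - m i * (uvec n j - 1)"
    by (rule dvd_diff[OF dvd_mult2[OF u[OF ij(1)]] dvd_mult[OF u[OF ij(2)]]])
  then show ?thesis by (simp add: wedge_def algebra_simps)
qed

lemma tri_lat_cong:
  assumes x: "x \<in> cycles n"
    and g: "\<And>i j. i \<in> {1..n} \<Longrightarrow> j \<in> {1..n} \<Longrightarrow> d dvd x i j - (g j - g i)"
  shows "x \<in> tri_lat n d"
proof -
  have "d dvd tau i j k x" if "i \<in> {1..n}" "j \<in> {1..n}" "k \<in> {1..n}" for i j k
  proof -
    have "d dvd (x i j - (g j - g i)) + (x j k - (g k - g j)) + (x k i - (g i - g k))"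
      using that by (intro dvd_add g)
    then show ?thesis by (simp add: tau_def algebra_simps)
  qed
  with x show ?thesis by (simp add: tri_lat_def)
qed

lemma ext_square_closed:
  shows ext_square_zero: "0 \<in> ext_square n N"
    and ext_square_add: "x \<in> ext_square n N \<Longrightarrow> y \<in> ext_square n N \<Longrightarrow> x + y \<in> ext_square n N"
    and ext_square_wedge: "a \<in> N \<Longrightarrow> b \<in> N \<Longrightarrow> wedge a b \<in> ext_square n N"
proof -
  let ?G = "add_monoid (ext_square_perm n)"
  have E: "\<one>\<^bsub>?G\<^esub> = 0" "\<And>x y. x \<otimes>\<^bsub>?G\<^esub> y = x + y"
    by (simp_all add: ext_square_perm_simps fun_eq_iff)
  show "0 \<in> ext_square n N"
    using generate.one[of ?G] unfolding ext_square_def E .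
  show "x \<in> ext_square n N \<Longrightarrow> y \<in> ext_square n N \<Longrightarrow> x + y \<in> ext_square n N"
    using generate.eng[of x ?G _ y] unfolding ext_square_def E .
  show "a \<in> N \<Longrightarrow> b \<in> N \<Longrightarrow> wedge a b \<in> ext_square n N"
    unfolding ext_square_def by (intro generate.incl) blast
qed

lemma ext_square_subset:
  assumes U: "sublat n U" and wedge: "\<And>a b. a \<in> N \<Longrightarrow> b \<in> N \<Longrightarrow> wedge a b \<in> U"
  shows "ext_square n N \<subseteq> U"
proof
  let ?G = "add_monoid (ext_square_perm n)"
  interpret sublat n U by fact
  interpret E: sn_module n \<Z> "ext_square_perm n" by (rule sn_module_ext_square_perm)
  have E: "\<one>\<^bsub>?G\<^esub> = 0" "\<And>x y. x \<otimes>\<^bsub>?G\<^esub> y = x + y"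
    by (simp_all add: ext_square_perm_simps fun_eq_iff)
  have car: "x \<in> carrier (ext_square_perm n)" if "x \<in> cycles n" for x
    unfolding ext_square_perm_carrier_iff
    using cycles_diag[OF that] cycles_outside[OF that] cycles_anti[OF that] by (metis add.right_inverse)
  have inv_eq: "inv\<^bsub>?G\<^esub> x = - x" if "x \<in> U" for x
    using car[of x] car[of "- x"] minus[OF that] that sub E.M.minus_equality[of "- x" x]
    by (auto simp: a_inv_def E[simplified])
  fix x assume "x \<in> ext_square n N"
  then show "x \<in> U"
    unfolding ext_square_def
  proof (induction rule: generate.induct)
    case one then show ?case by (simp only: E zero)
  next
    case (incl h) then show ?case using wedge by auto
  next
    case (inv h)
    then have h: "h \<in> U" using wedge by auto
    show ?case using minus[OF h] by (simp only: inv_eq[OF h])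
  next
    case (eng x y) then show ?case using add by (simp only: E)
  qed
qed

lemma ext_square_M_sub:
  assumes n: "n \<ge> 1" and d: "d dvd n" "d > 0"
  shows "ext_square n (M_sub n d) = smul (int d) ` tri_lat n (int d)"
proof (intro equalityI)
  show "ext_square n (M_sub n d) \<subseteq> smul (int d) ` tri_lat n (int d)"
  proof (rule ext_square_subset[OF sublat_smul_image[OF sublat_tri_lat]])
    fix x y assume "x \<in> M_sub n d" "y \<in> M_sub n d"
    then obtain k m k' m' where m: "m \<in> natural_specht n" "m' \<in> natural_specht n"
      and xy: "x = (\<lambda>j. k * uvec n j + int d * m j)" "y = (\<lambda>j. k' * uvec n j + int d * m' j)"
      by (auto simp: M_sub_def)
    define z where "z = smul k (wedge (uvec n) m') - smul k' (wedge (uvec n) m) + smul (int d) (wedge m m')"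
    have mm: "wedge m m' \<in> cycles n"
      by (rule wedge_cycles) (use m in \<open>auto simp: natural_specht_def perm_lattice_def\<close>)
    have zc: "z \<in> cycles n"
      unfolding z_def using n m mm by (intro cycles.add cycles.diff cycles.smul wedge_uvec_cycles)
    have "z \<in> tri_lat n (int d)"
    proof (rule tri_lat_cong[OF zc])
      fix i j assume ij: "i \<in> {1..n}" "j \<in> {1..n}"
      have dn: "int d dvd int n" using d by simp
      have "int d dvd k * (wedge (uvec n) m' i j - (m' j - m' i)) -
          k' * (wedge (uvec n) m i j - (m j - m i)) + int d * wedge m m' i j"
        by (intro dvd_add dvd_diff dvd_mult dvd_triv_left wedge_uvec_cong[OF n dn ij])
      then show "int d dvd z i j - ((k * m' j - k' * m j) - (k * m' i - k' * m i))"
        by (simp add: z_def algebra_simps)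
    qed
    moreover have "wedge x y = smul (int d) z"
      unfolding xy z_def by (simp add: fun_eq_iff wedge_def algebra_simps)
    ultimately show "wedge x y \<in> smul (int d) ` tri_lat n (int d)" by blast
  qed
  show "smul (int d) ` tri_lat n (int d) \<subseteq> ext_square n (M_sub n d)"
  proof clarify
    fix z assume z: "z \<in> tri_lat n (int d)"
    then have zc: "z \<in> cycles n" by (simp add: tri_lat_def)
    note row = cycles_row[OF zc]
    have m: "z 1 \<in> natural_specht n"
      using row[of 1] cycles_outside[OF zc] by (auto simp: natural_specht_def perm_lattice_def)
    have dv: "int d dvd (z - wedge (uvec n) (z 1)) i j" if ij: "i \<in> {1..n}" "j \<in> {1..n}" for i j
    proof -
      have "int d dvd tau 1 i j z" using z ij n by (auto simp: tri_lat_def)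
      moreover have "int d dvd wedge (uvec n) (z 1) i j - (z 1 j - z 1 i)"
        using d by (intro wedge_uvec_cong[OF n _ ij]) simp
      ultimately have "int d dvd tau 1 i j z - (wedge (uvec n) (z 1) i j - (z 1 j - z 1 i))"
        by (rule dvd_diff)
      then show ?thesis using cycles_anti[OF zc, of j 1] by (simp add: tau_def)
    qed
    have zw: "z - wedge (uvec n) (z 1) \<in> cycles n"
      using zc wedge_uvec_cycles[OF n m] by (rule cycles.diff)
    have "int d \<noteq> 0" using d(2) by simp
    then obtain y where y: "y \<in> cycles n" "z - wedge (uvec n) (z 1) = smul (int d) y"
      using cycles_divide[OF zw _ dv] by blast
    then have zy: "z = wedge (uvec n) (z 1) + smul (int d) y" by (simp add: algebra_simps)
    have scaled: "(\<lambda>j. int d * m j) \<in> M_sub n d" if "m \<in> natural_specht n" for m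
      unfolding M_sub_def using that by (intro CollectI exI[of _ 0] exI[of _ m]) simp
    have bd: "(\<lambda>j. c * basis_diff i j) \<in> natural_specht n" if "i \<in> {2..n}" for c i
      using that by (auto simp: natural_specht_def perm_lattice_def basis_diff_def sum_subtractf of_bool_def
          simp flip: sum_distrib_left)
    \<comment> \<open>One factor \<open>d\<close> goes into each side of every basis product, since
      \<open>M_sub n d\<close> contains the \<open>d\<close>-fold of the natural Specht
      lattice.\<close>
    have "smul (int d * int d) y \<in> ext_square n (M_sub n d)"
    proof -
      have "(\<Sum>(i, j)\<in>A. smul (int d * int d * y i j) (tri 1 i j)) \<in> ext_square n (M_sub n d)"
        if "finite A" "A \<subseteq> wedge_pairs n" for A
        using that
      proof (induction A rule: finite_induct)
        case empty then show ?case by (simp only: sum.empty ext_square_zero)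
      next
        case (insert p A)
        obtain i j where p: "p = (i, j)" by force
        then have ij: "i \<in> {2..n}" "j \<in> {2..n}" using insert.prems by (auto simp: wedge_pairs_def)
        have "smul (int d * int d * y i j) (tri 1 i j) =
            wedge (\<lambda>a. int d * (y i j * basis_diff i a)) (\<lambda>a. int d * (1 * basis_diff j a))"
          by (simp add: fun_eq_iff tri_def wedge_def basis_diff_def algebra_simps)
        then have mem: "smul (int d * int d * y i j) (tri 1 i j) \<in> ext_square n (M_sub n d)"
          using ext_square_wedge[OF scaled[OF bd[OF ij(1), of "y i j"]] scaled[OF bd[OF ij(2), of 1]]] by simp
        have A: "A \<subseteq> wedge_pairs n" using insert.prems by blast
        show ?case
          unfolding sum.insert[OF insert.hyps] unfolding p prod.case
          by (rule ext_square_add[OF mem insert.IH[OF A]])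
      qed
      note this[OF finite_wedge_pairs order_refl]
      moreover have "(\<Sum>(i, j)\<in>wedge_pairs n. smul (int d * int d * y i j) (tri 1 i j)) =
          smul (int d * int d) (wedge_comb n y)"
        by (simp add: fun_eq_iff sum_fun_apply wedge_comb_eq_sum case_prod_unfold sum_distrib_left mult.assoc)
      ultimately show ?thesis by (simp only: wedge_comb_self[OF y(1)])
    qed
    moreover have "smul (int d) (wedge (uvec n) (z 1)) \<in> ext_square n (M_sub n d)"
    proof -
      have "uvec n \<in> M_sub n d"
        unfolding M_sub_def by (intro CollectI exI[of _ 1] exI[of _ "\<lambda>_. 0"])
          (simp add: natural_specht_def perm_lattice_def)
      from ext_square_wedge[OF this scaled[OF m], of n]
      show ?thesis by (simp add: wedge_def smul_def algebra_simps)
    qed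
    ultimately have "smul (int d) (wedge (uvec n) (z 1)) + smul (int d * int d) y \<in> ext_square n (M_sub n d)"
      by (rule ext_square_add[rotated])
    then show "smul (int d) z \<in> ext_square n (M_sub n d)"
      by (subst zy) (simp add: smul_add smul_smul)
  qed
qed

section \<open>The lattices at the prime 2\<close>

lemma par_wedge_comb: "par n (wedge_comb n \<alpha>) = (\<Sum>(i, j)\<in>wedge_pairs n. \<alpha> i j)"
  unfolding par_def by (rule sum.cong) (auto simp: wedge_comb_coeff)

lemma S_hat1_eq: "S_hat1 n = even_lat n"
proof (intro equalityI subsetI)
  show "x \<in> even_lat n" if "x \<in> S_hat1 n" for x
    using that by (auto simp: S_hat1_def even_lat_def wedge_comb_cycles par_wedge_comb cong_0_iff)
  show "x \<in> S_hat1 n" if "x \<in> even_lat n" for x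
  proof -
    have "x = wedge_comb n x" "even (par n x)" using that wedge_comb_self[of x n] by (auto simp: even_lat_def)
    then show ?thesis unfolding S_hat1_def par_def by (auto simp: cong_0_iff intro!: exI[of _ x])
  qed
qed

text \<open>For odd \<open>n\<close> the edge congruence identifies each off-diagonal entry modulo 2
  with the common triangle value, so equal parity of triangles and of entries is the same
  condition.\<close>

lemma S_hat2_eq:
  assumes n: "n \<ge> 5" "odd n"
  shows "S_hat2 n = tri_par n"
proof (intro equalityI subsetI)
  fix x assume "x \<in> S_hat2 n"
  then obtain \<alpha> where x: "x = wedge_comb n \<alpha>" and \<alpha>: "\<And>i j. (i, j) \<in> wedge_pairs n \<Longrightarrow> [\<alpha> i j = \<alpha> (n - 1) n] (mod 2)"
    by (auto simp: S_hat2_def)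
  define e where "e = \<alpha> (n - 1) n"
  have xc: "x \<in> cycles n" by (simp add: x wedge_comb_cycles)
  note A = cycles_anti[OF xc] and D = cycles_diag[OF xc]
  have pairs: "even (x i j - e)" if "(i, j) \<in> wedge_pairs n" for i j
    using \<alpha>[OF that] by (simp add: x wedge_comb_coeff[OF that] e_def cong_iff_dvd_diff)
  have ge2: "even (x i j - e)" if ij: "i \<in> {2..n}" "j \<in> {2..n}" "i \<noteq> j" for i j
  proof (cases "i < j")
    case True then show ?thesis using ij by (intro pairs) (auto simp: wedge_pairs_def)
  next
    case False
    then have "even (x j i - e)" using ij by (intro pairs) (auto simp: wedge_pairs_def)
    then show ?thesis using A[of i j] by simp
  qed
  \<comment> \<open>Row \<open>j\<close> consists of \<open>x j 1\<close> and \<open>n - 2\<close>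
    entries of parity \<open>e\<close>; as \<open>n - 2\<close> is odd, the zero sum forces the same
    parity on \<open>x j 1\<close>.\<close>
  have one: "even (x j 1 - e)" if j: "j \<in> {2..n}" for j
  proof -
    have "even (\<Sum>k\<in>{2..n} - {j}. x j k - e)" using ge2 j by (intro dvd_sum) auto
    moreover have "(\<Sum>k\<in>{2..n} - {j}. x j k - e) = - x j 1 - (int n - 2) * e"
    proof -
      have "(\<Sum>k=1..n. x j k) = x j 1 + (\<Sum>k=2..n. x j k)" using n by (intro sum_from_1) simp
      moreover have "(\<Sum>k=2..n. x j k) = (\<Sum>k\<in>{2..n} - {j}. x j k)"
        using j D[of j] by (simp add: sum_diff1)
      ultimately show ?thesis
        using cycles_row[OF xc, of j] j n by (simp add: sum_subtractf card_Diff_singleton of_nat_diff algebra_simps)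
    qed
    ultimately show ?thesis using n(2) by simp
  qed
  have all: "even (x i j - e)" if ij: "i \<in> {1..n}" "j \<in> {1..n}" "i \<noteq> j" for i j
  proof -
    consider "i = 1" "j \<in> {2..n}" | "j = 1" "i \<in> {2..n}" | "i \<in> {2..n}" "j \<in> {2..n}" using ij by fastforce
    then show ?thesis
    proof cases
      case 1 then show ?thesis using one[of j] A[of j 1] by simp
    qed (use one ge2 ij in auto)
  qed
  have "even (tau i j k x - e)" if "distinct [i, j, k]" "{i, j, k} \<subseteq> {1..n}" for i j k
  proof -
    have "even (x i j - e)" "even (x j k - e)" "even (x k i - e)" using that by (auto intro!: all simp del: even_diff)
    then show ?thesis by (simp add: tau_def)
  qed
  then show "x \<in> tri_par n" using xc unfolding tri_par_def by blast
next
  fix x assume x: "x \<in> tri_par n"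
  then have xc: "x \<in> cycles n" by (simp add: tri_par_def)
  obtain e where e: "\<And>i j k. distinct [i, j, k] \<Longrightarrow> {i, j, k} \<subseteq> {1..n} \<Longrightarrow> even (tau i j k x - e)"
    using tri_parE[OF x] by blast
  have "even (x i j - tau 1 2 3 x)" if ij: "i \<in> {1..n}" "j \<in> {1..n}" "i \<noteq> j" for i j
    using tau_cong(3)[OF n(1) xc tri_par_csq[OF xc e] ij] n(2) by simp
  then have *: "\<And>i j. i \<in> {1..n} \<Longrightarrow> j \<in> {1..n} \<Longrightarrow> i \<noteq> j \<Longrightarrow> even (x i j - tau 1 2 3 x)" .
  have "[x i j = x (n - 1) n] (mod 2)" if "(i, j) \<in> wedge_pairs n" for i j
  proof -
    have "even (x i j - tau 1 2 3 x)" "even (x (n - 1) n - tau 1 2 3 x)"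
      using *[of i j] *[of "n - 1" n] that n by (auto simp: wedge_pairs_def simp del: even_diff)
    from dvd_diff[OF this] show ?thesis by (simp add: cong_iff_dvd_diff)
  qed
  then show "x \<in> S_hat2 n"
    unfolding S_hat2_def using wedge_comb_self[OF xc] by (auto intro!: exI[of _ x])
qed

lemma par_tri: "n \<ge> 4 \<Longrightarrow> par n (tri 1 2 3) = 1"
  "n \<ge> 4 \<Longrightarrow> par n (tri 1 2 4) = 1"
proof -
  have *: "par n (tri 1 2 k) = 1" if "n \<ge> 4" "k \<in> {3, 4}" for k
  proof -
    have "par n (tri 1 2 k) = (\<Sum>j=3..n. tri 1 2 k 2 j)"
      unfolding par_def
      by (rule sum_wedge_pairs_row) (use that in \<open>auto simp: wedge_pairs_def tri_def wedge_def\<close>)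
    also have "\<dots> = (\<Sum>j\<in>{3..n}. if j = k then 1 else 0)"
      using that by (intro sum.cong) (auto simp: tri_def wedge_def)
    finally show ?thesis using that by auto
  qed
  show "n \<ge> 4 \<Longrightarrow> par n (tri 1 2 3) = 1" "n \<ge> 4 \<Longrightarrow> par n (tri 1 2 4) = 1" using * by auto
qed

lemma sq_even_lat: "n \<ge> 5 \<Longrightarrow> sq 2 1 3 4 \<in> even_lat n"
proof -
  assume n: "n \<ge> 5"
  have "tri 1 2 3 - tri 1 2 4 \<in> cycles n" using n by (intro cycles.diff tri_cycles) auto
  moreover have "par n (tri 1 2 3 - tri 1 2 4) = 0" using n by (simp only: par_diff par_tri)
  ultimately have "tri 1 2 3 - tri 1 2 4 \<in> even_lat n" unfolding even_lat_def by simp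
  then show ?thesis by (simp only: tri_diff)
qed

text \<open>The product of \<open>uvec n\<close> with a difference of basis vectors is a coboundary
  modulo \<open>d\<close>. Its unit entry shows that no prime can be divided out of the
  lattice.\<close>

lemma tri_lat_unit:
  assumes n: "n \<ge> 5" and d: "d dvd n"
  shows "\<exists>x\<in>tri_lat n (int d). x 2 4 = -1"
proof
  let ?m = "\<lambda>j. of_bool (j = 2) - of_bool (j = 3) :: int"
  have m: "?m \<in> natural_specht n"
    using n by (auto simp: natural_specht_def perm_lattice_def sum_subtractf of_bool_def)
  show "wedge (uvec n) ?m \<in> tri_lat n (int d)"
    using n d by (intro tri_lat_cong[where g = ?m] wedge_uvec_cycles[OF _ m] wedge_uvec_cong) auto
  show "wedge (uvec n) ?m 2 4 = -1"
    using n by (simp add: wedge_def uvec_eq)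
qed

text \<open>The \<open>c\<close>-fold of a square meeting a four-cycle in one edge has square value
  exactly \<open>c\<close>, and square values are differences of triangle values.\<close>

lemma tri_lat_antimono:
  assumes n: "n \<ge> 5" and sub: "tri_lat n c \<subseteq> tri_lat n d"
  shows "d dvd c"
proof -
  let ?x = "smul c (sq 1 5 3 2)"
  have "?x \<in> tri_lat n c"
    using n by (auto simp: tri_lat_def tau_simps intro!: cycles.smul sq_cycles)
  then have x: "?x \<in> tri_lat n d" using sub by blast
  then have "d dvd tau 2 1 3 ?x - tau 2 1 4 ?x"
    using n by (intro dvd_diff) (auto simp: tri_lat_def)
  also have "tau 2 1 3 ?x - tau 2 1 4 ?x = csq 1 2 3 4 ?x"
    using x by (intro tau_diff) (auto simp: tri_lat_def)
  also have "\<dots> = c" by (simp add: csq_def sq_def wedge_def)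
  finally show ?thesis .
qed

text \<open>Entries away from vertex 1 are odd and, by the row sums, those at vertex 1 have the
  parity of \<open>n\<close>. A triangle contains two or none of the latter, so its value is odd.
  This separates \<open>tri_par n\<close> from \<open>tri_lat n 2\<close>.\<close>

lemma tri_par_one: "wedge_comb n (\<lambda>_ _. 1) \<in> tri_par n \<and> odd (tau 2 3 4 (wedge_comb n (\<lambda>_ _. 1)))"
  if n: "n \<ge> 5"
proof -
  let ?x = "wedge_comb n (\<lambda>_ _. 1)"
  have xc: "?x \<in> cycles n" by (rule wedge_comb_cycles)
  note A = cycles_anti[OF xc] and D = cycles_diag[OF xc]
  have lt: "?x i j = 1" if "2 \<le> i" "i < j" "j \<le> n" for i j
    using that by (subst wedge_comb_coeff) (auto simp: wedge_pairs_def)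
  have ge2: "odd (?x i j)" if "i \<in> {2..n}" "j \<in> {2..n}" "i \<noteq> j" for i j
    using lt[of i j] lt[of j i] A[of j i] that by (cases "i < j") auto
  have one: "even (?x j 1 - (int n - 2))" if j: "j \<in> {2..n}" for j
  proof -
    have "even (\<Sum>k\<in>{2..n} - {j}. ?x j k - 1)" using ge2 j by (intro dvd_sum) auto
    moreover have "(\<Sum>k\<in>{2..n} - {j}. ?x j k - 1) = - ?x j 1 - (int n - 2)"
    proof -
      have "(\<Sum>k=1..n. ?x j k) = ?x j 1 + (\<Sum>k=2..n. ?x j k)" using n by (intro sum_from_1) simp
      moreover have "(\<Sum>k=2..n. ?x j k) = (\<Sum>k\<in>{2..n} - {j}. ?x j k)"
        using j D[of j] by (simp add: sum_diff1)
      ultimately show ?thesis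
        using cycles_row[OF xc, of j] j n by (simp add: sum_subtractf card_Diff_singleton of_nat_diff algebra_simps)
    qed
    ultimately show ?thesis by simp
  qed
  have one': "even (?x 1 j - (int n - 2))" if j: "j \<in> {2..n}" for j
    using one[OF j] A[of j 1] by simp
  have odd: "odd (tau i j k ?x)" if dist: "distinct [i, j, k]" "{i, j, k} \<subseteq> {1..n}" for i j k
  proof -
    consider "i = 1" "j \<in> {2..n}" "k \<in> {2..n}" | "j = 1" "i \<in> {2..n}" "k \<in> {2..n}"
      | "k = 1" "i \<in> {2..n}" "j \<in> {2..n}" | "i \<in> {2..n}" "j \<in> {2..n}" "k \<in> {2..n}"
      using dist by (cases "i = 1"; cases "j = 1"; cases "k = 1") auto
    then show ?thesis
    proof cases
      case 1 then show ?thesis using one'[of j] one[of k] ge2[of j k] dist by (auto simp: tau_def)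
    next
      case 2 then show ?thesis using one[of i] one'[of k] ge2[of k i] dist by (auto simp: tau_def)
    next
      case 3 then show ?thesis using one[of j] one'[of i] ge2[of i j] dist by (auto simp: tau_def)
    next
      case 4 then show ?thesis using ge2[of i j] ge2[of j k] ge2[of k i] dist by (auto simp: tau_def)
    qed
  qed
  have "even (tau i j k ?x - 1)" if "distinct [i, j, k]" "{i, j, k} \<subseteq> {1..n}" for i j k
    using odd[OF that] by simp
  then have "?x \<in> tri_par n" using xc unfolding tri_par_def by blast
  moreover have "odd (tau 2 3 4 ?x)" using n by (intro odd) auto
  ultimately show ?thesis by blast
qed

lemma tri_par_double: "x \<in> cycles n \<Longrightarrow> smul 2 x \<in> tri_par n"
proof -
  assume x: "x \<in> cycles n"
  have "even (tau i j k (smul 2 x) - 0)" for i j k by (simp add: tau_simps)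
  then show ?thesis unfolding tri_par_def using cycles.smul[OF x] by blast
qed

text \<open>In the 2-adic classification a factor 2 already forces the double of all cycles, and a
  factor 4 is excluded by the entry 2 of a doubled square.\<close>

lemma between_double:
  assumes n: "n \<ge> 5" "\<not> 4 dvd n" and U: "sublat n U" "smul 2 ` cycles n \<subseteq> U"
  shows "U \<in> {smul 2 ` cycles n, tri_lat n 2, tri_par n, even_lat n, cycles n}"
proof -
  have "smul (2 ^ 1) y \<in> U" if "y \<in> cycles n" for y using U(2) that by auto
  from two_classification[OF U(1) n this]
  obtain r V where V: "V \<in> {cycles n, even_lat n, tri_lat n 2, tri_par n}" and UV: "U = smul (2 ^ r) ` V"
    by blast
  have Vc: "V \<subseteq> cycles n" using V by (auto simp: even_lat_def tri_lat_def tri_par_def)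
  consider "r = 0" | "r = 1" | m where "r = Suc (Suc m)" by (metis One_nat_def not0_implies_Suc)
  then show ?thesis
  proof cases
    case 1
    then have "U = V" using UV by simp
    then show ?thesis using V by blast
  next
    case 2
    have "cycles n \<subseteq> V"
    proof
      fix y assume "y \<in> cycles n"
      then have "smul 2 y \<in> smul 2 ` V" using U(2) UV 2 by auto
      then show "y \<in> V" by (auto simp: smul_cancel)
    qed
    then show ?thesis using UV Vc 2 by auto
  next
    case 3
    have "smul 2 (sq 1 2 3 4) \<in> U" using U(2) n by (auto intro!: imageI sq_cycles)
    then obtain v where "smul 2 (sq 1 2 3 4) = smul (2 ^ r) v" using UV by blast
    then have "smul 2 (sq 1 2 3 4) 1 3 = smul (2 ^ r) v 1 3" by simp
    then have "(2::int) = 4 * (2 ^ m * v 1 3)" by (simp add: 3 sq_def wedge_def)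
    then have False by presburger
    then show ?thesis ..
  qed
qed

text \<open>The third inclusion rests on \<open>n\<close> being 2 modulo 4; strictness is witnessed
  by explicit elements.\<close>

lemma chain_strict:
  assumes n: "n \<ge> 5" "\<not> 4 dvd n" "even n"
  shows "smul 2 ` cycles n \<subset> tri_lat n 2" "tri_lat n 2 \<subset> tri_par n" "tri_par n \<subset> even_lat n"
    "even_lat n \<subset> cycles n"
proof -
  have "smul 2 ` cycles n \<subseteq> tri_lat n 2" by (auto simp: tri_lat_def tau_simps cycles.smul)
  moreover obtain x where x: "x \<in> tri_lat n 2" "x 2 4 = -1" using tri_lat_unit[OF n(1), of 2] n(3) by auto
  moreover have "x \<notin> smul 2 ` cycles n"
  proof
    assume "x \<in> smul 2 ` cycles n"
    then obtain y where "x = smul 2 y" by blast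
    then have "(-1::int) = 2 * y 2 4" using x(2) by simp
    then show False by presburger
  qed
  ultimately show "smul 2 ` cycles n \<subset> tri_lat n 2" by blast
  have "tri_lat n 2 \<subseteq> tri_par n"
  proof
    fix x assume x: "x \<in> tri_lat n 2"
    then have "even (tau i j k x - 0)" if "{i, j, k} \<subseteq> {1..n}" for i j k using that by (auto simp: tri_lat_def)
    then show "x \<in> tri_par n" using x unfolding tri_par_def tri_lat_def by blast
  qed
  moreover have "wedge_comb n (\<lambda>_ _. 1) \<notin> tri_lat n 2"
  proof
    assume "wedge_comb n (\<lambda>_ _. 1) \<in> tri_lat n 2"
    then have "even (tau 2 3 4 (wedge_comb n (\<lambda>_ _. 1)))" using n by (auto simp: tri_lat_def)
    with tri_par_one[OF n(1)] show False by blast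
  qed
  ultimately show "tri_lat n 2 \<subset> tri_par n" using tri_par_one[OF n(1)] by blast
  have "tri_par n \<subseteq> even_lat n"
  proof
    fix x assume x: "x \<in> tri_par n"
    then have xc: "x \<in> cycles n" by (simp add: tri_par_def)
    obtain e where e: "\<And>i j k. distinct [i, j, k] \<Longrightarrow> {i, j, k} \<subseteq> {1..n} \<Longrightarrow> even (tau i j k x - e)"
      using tri_parE[OF x] by blast
    \<comment> \<open>Up to even terms the edges at 1 contribute \<open>x 1 a + x 1 b\<close>, whose
      sum vanishes by the degree count, and \<open>e\<close> occurs (n - 1)(n - 2) / 2 times, an
      even number. So the parity of \<open>x\<close> is even.\<close>
    have "even (\<Sum>(a, b)\<in>wedge_pairs n. tau 1 a b x - e)"
    proof (rule dvd_sum)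
      fix q assume "q \<in> wedge_pairs n"
      moreover obtain a b where q: "q = (a, b)" by force
      ultimately show "even (case q of (a, b) \<Rightarrow> tau 1 a b x - e)"
        unfolding q prod.case by (intro e) (auto simp: wedge_pairs_def)
    qed
    moreover have "(\<Sum>(a, b)\<in>wedge_pairs n. tau 1 a b x - e) =
        par n x + (\<Sum>(a, b)\<in>wedge_pairs n. x 1 a + x 1 b) - 2 * (\<Sum>(a, b)\<in>wedge_pairs n. x 1 b) -
        int (card (wedge_pairs n)) * e"
      using cycles_anti[OF xc, of _ 1]
      by (simp add: par_def case_prod_unfold tau_def sum.distrib sum_subtractf sum_negf)
    moreover have "(\<Sum>(a, b)\<in>wedge_pairs n. x 1 a + x 1 b) = 0"
    proof -
      have "(\<Sum>b=1..n. x 1 b) = x 1 1 + (\<Sum>b=2..n. x 1 b)" using n by (intro sum_from_1) simp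
      then have "(\<Sum>b=2..n. x 1 b) = 0" using cycles_row[OF xc, of 1] cycles_diag[OF xc, of 1] by simp
      then show ?thesis using sum_wedge_pairs_add[of "x 1" n] by simp
    qed
    moreover have "even (card (wedge_pairs n))"
    proof -
      have "4 dvd int n - 2" using n by presburger
      then have "4 dvd 2 * int (card (wedge_pairs n))"
        using n by (subst card_wedge_pairs) (auto intro: dvd_mult2)
      then show ?thesis by presburger
    qed
    ultimately have "even (par n x)" by simp
    then show "x \<in> even_lat n" using xc by (simp add: even_lat_def)
  qed
  moreover have "sq 2 1 3 4 \<notin> tri_par n"
  proof
    assume "sq 2 1 3 4 \<in> tri_par n"
    moreover have "sq 2 1 3 4 \<in> cycles n" using n by (intro sq_cycles) auto
    moreover obtain e where e: "\<And>i j k. distinct [i, j, k] \<Longrightarrow> {i, j, k} \<subseteq> {1..n} \<Longrightarrow>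
        even (tau i j k (sq 2 1 3 4) - e)"
      using tri_parE[OF calculation(1)] by blast
    \<comment> \<open>The square shares only the edge from 2 to 3 with the four-cycle 2 3 5 1, so
      the value is 1.\<close>
    ultimately have "even (csq 2 5 3 1 (sq 2 1 3 4))"
      using n by (intro tri_par_csq[OF _ e]) auto
    then show False by (simp add: csq_def sq_def wedge_def)
  qed
  ultimately show "tri_par n \<subset> even_lat n" using sq_even_lat[OF n(1)] by blast
  have "tri 1 2 3 \<in> cycles n" using n by (intro tri_cycles) auto
  moreover have "tri 1 2 3 \<notin> even_lat n" using par_tri(1)[of n] n by (simp add: even_lat_def)
  ultimately show "even_lat n \<subset> cycles n" by (auto simp: even_lat_def)
qed

text \<open>The five lattices between the double of the Specht lattice and the lattice itself form a
  chain, so being maximal means being the lower neighbour. This gives the definite description in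
  \<open>X_set\<close> its value.\<close>

lemma T_chain_iff:
  assumes n: "n \<ge> 5" "\<not> 4 dvd n" "even n"
  shows "T_chain n T1 T2 T3 \<longleftrightarrow> T1 = even_lat n \<and> T2 = tri_par n \<and> T3 = tri_lat n 2"
proof -
  let ?D = "smul 2 ` cycles n"
  note strict = chain_strict[OF n]
  have two: "(\<lambda>\<omega>. 2 \<odot>\<^bsub>specht_lattice n\<^esub> \<omega>) ` carrier (specht_lattice n) = ?D"
    by (simp add: specht_simps)
  have max: "maximal_sn_sublattice n (specht_lattice n) A B \<longleftrightarrow> sublat n A \<and> sublat n B \<and> A \<subset> B \<and>
      (\<forall>Y. sublat n Y \<and> A \<subseteq> Y \<and> Y \<subseteq> B \<longrightarrow> Y = A \<or> Y = B)" for A B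
    by (simp add: maximal_sn_sublattice_def sn_sublattice_iff)
  have lats: "sublat n ?D" "sublat n (tri_lat n 2)" "sublat n (tri_par n)" "sublat n (even_lat n)" "sublat n (cycles n)"
    by (simp_all add: sublat_smul_image sublat_cycles sublat_tri_lat sublat_tri_par sublat_even_lat)
  have btw: "Y = ?D \<or> Y = tri_lat n 2 \<or> Y = tri_par n \<or> Y = even_lat n \<or> Y = cycles n"
    if "sublat n Y" "?D \<subseteq> Y" for Y using between_double[OF n(1,2) that] by blast
  show ?thesis
  proof
    assume "T_chain n T1 T2 T3"
    then have s: "sublat n T1" "sublat n T2" "sublat n T3"
      and c: "?D \<subset> T3" "T3 \<subset> T2" "T2 \<subset> T1" "T1 \<subset> cycles n"
      unfolding T_chain_def Let_def two max specht_simps by auto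
    have T3: "T3 = tri_lat n 2 \<or> T3 = tri_par n \<or> T3 = even_lat n \<or> T3 = cycles n" using btw[OF s(3)] c by blast
    have T2: "T2 = tri_lat n 2 \<or> T2 = tri_par n \<or> T2 = even_lat n \<or> T2 = cycles n" using btw[OF s(2)] c by blast
    have T1: "T1 = tri_lat n 2 \<or> T1 = tri_par n \<or> T1 = even_lat n" using btw[OF s(1)] c by blast
    have T2': "T2 = tri_lat n 2 \<or> T2 = tri_par n" using T1 T2 c(3) strict by blast
    then have T3': "T3 = tri_lat n 2" using T3 c(2) strict by blast
    then have T2'': "T2 = tri_par n" using T2' c(2) by blast
    then have "T1 = even_lat n" using T1 c(3) strict by blast
    with T2'' T3' show "T1 = even_lat n \<and> T2 = tri_par n \<and> T3 = tri_lat n 2" by blast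
  next
    assume "T1 = even_lat n \<and> T2 = tri_par n \<and> T3 = tri_lat n 2"
    then have T: "T1 = even_lat n" "T2 = tri_par n" "T3 = tri_lat n 2" by auto
    have gap: "Y = A \<or> Y = B" if "sublat n Y" "A \<subseteq> Y" "Y \<subseteq> B"
      "(A, B) \<in> {(?D, tri_lat n 2), (tri_lat n 2, tri_par n), (tri_par n, even_lat n), (even_lat n, cycles n)}" for Y A B
    proof -
      have "?D \<subseteq> A" using that(4) strict by auto
      then have "?D \<subseteq> Y" using that(2) by blast
      from btw[OF that(1) this] show ?thesis using that(2,3,4) strict by auto
    qed
    show "T_chain n T1 T2 T3"
      unfolding T_chain_def Let_def two max specht_simps T
      using lats strict gap[of _ ?D "tri_lat n 2"] gap[of _ "tri_lat n 2" "tri_par n"]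
        gap[of _ "tri_par n" "even_lat n"] gap[of _ "even_lat n" "cycles n"] by simp
  qed
qed

lemma X_set_odd_prime:
  assumes n: "n \<ge> 1" and p: "prime p" "p \<noteq> 2"
  shows "X_set n p = {smul (int p ^ i) ` tri_lat n (int p ^ i) | i. i \<le> multiplicity p n}"
proof -
  have "ext_square n (M_sub n (p ^ i)) = smul (int p ^ i) ` tri_lat n (int p ^ i)" if "i \<le> multiplicity p n" for i
    using ext_square_M_sub[OF n, of "p ^ i"] p(1) multiplicity_dvd'[OF that] by (simp add: prime_gt_0_nat)
  then show ?thesis using p(2) unfolding X_set_def by (simp cong: conj_cong) metis
qed

lemma X_set_2:
  assumes n: "n \<ge> 5" "\<not> 4 dvd n"
  shows "X_set n 2 = (if odd n then {cycles n, even_lat n, tri_par n}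
    else {cycles n, even_lat n, tri_par n, tri_lat n 2})"
proof (cases "odd n")
  case True
  then show ?thesis using S_hat2_eq[OF n(1)] by (simp add: X_set_def carrier_specht S_hat1_eq)
next
  case False
  then have "(THE (T1, T2, T3). T_chain n T1 T2 T3) = (even_lat n, tri_par n, tri_lat n 2)"
    using T_chain_iff[OF n] by (intro the_equality) auto
  with False show ?thesis by (simp add: X_set_def carrier_specht)
qed

lemma X_set_sublat:
  assumes n: "n \<ge> 5" "\<not> 4 dvd n" and p: "prime p" and N: "N \<in> X_set n p"
  shows "sublat n N" and "\<exists>a. \<forall>y\<in>cycles n. smul (int p ^ a) y \<in> N"
proof -
  have "sublat n N \<and> (\<exists>a. \<forall>y\<in>cycles n. smul (int p ^ a) y \<in> N)"
  proof (cases "p = 2")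
    case True
    have "N = cycles n \<or> N = even_lat n \<or> N = tri_par n \<or> N = tri_lat n 2"
      using N X_set_2[OF n] True by (auto split: if_splits)
    moreover have "smul (2 ^ 1) y \<in> cycles n" "smul (2 ^ 1) y \<in> even_lat n" "smul (2 ^ 1) y \<in> tri_par n"
      "smul (2 ^ 1) y \<in> tri_lat n 2" if "y \<in> cycles n" for y
      using that by (simp_all add: even_lat_def par_smul cycles.smul tri_par_double tri_lat_def tau_simps)
    ultimately show ?thesis
      unfolding True of_nat_numeral
      using sublat_cycles sublat_tri_lat sublat_tri_par sublat_even_lat by (elim disjE) blast+
  next
    case False
    then obtain i where i: "N = smul (int p ^ i) ` tri_lat n (int p ^ i)"
      using N X_set_odd_prime[OF _ p] n by auto
    \<comment> \<open>One factor \<open>p ^ i\<close> enters \<open>tri_lat\<close>, the other is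
      the scaling of the representative.\<close>
    have "smul (int p ^ (i + i)) y \<in> N" if "y \<in> cycles n" for y
    proof -
      have "smul (int p ^ i) y \<in> tri_lat n (int p ^ i)"
        using that by (simp add: tri_lat_def tau_simps cycles.smul)
      then show ?thesis unfolding i power_add by (metis imageI smul_smul)
    qed
    then show ?thesis unfolding i using sublat_smul_image[OF sublat_tri_lat] by blast
  qed
  then show "sublat n N" "\<exists>a. \<forall>y\<in>cycles n. smul (int p ^ a) y \<in> N" by auto
qed

lemma image_smul_smul: "smul a ` smul b ` U = smul (a * b) ` U"
  by (simp add: image_image smul_smul)

text \<open>Powers of \<open>p\<close> appear on both sides because the representatives for odd
  \<open>p\<close> are themselves multiples of \<open>tri_lat\<close> by
  \<open>p ^ i\<close>.\<close>

lemma X_set_classification: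
  assumes n: "n \<ge> 5" "\<not> 4 dvd n" and p: "prime p" and U: "sublat n U"
    and a: "\<And>y. y \<in> cycles n \<Longrightarrow> smul (int p ^ a) y \<in> U"
  shows "\<exists>N\<in>X_set n p. \<exists>b c. smul (int p ^ b) ` U = smul (int p ^ c) ` N"
proof (cases "p = 2")
  case True
  obtain r V where V: "V \<in> {cycles n, even_lat n, tri_lat n 2, tri_par n}" and UV: "U = smul (2 ^ r) ` V"
    using two_classification[OF U n, of a] a True by auto
  show ?thesis
  proof (cases "V \<in> X_set n 2")
    case V: True
    then show ?thesis using UV unfolding True by (intro bexI[of _ V] exI[of _ 0] exI[of _ r]) simp_all
  next
    case False
    then have "odd n" "V = tri_lat n 2" using V X_set_2[OF n] by (auto split: if_splits)
    then have "U = smul (2 ^ Suc r) ` cycles n"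
      using UV tri_lat_2_odd[OF n(1)] by (simp add: image_smul_smul mult.commute)
    moreover have "cycles n \<in> X_set n 2" using X_set_2[OF n] by auto
    ultimately show ?thesis unfolding True by (intro bexI[of _ "cycles n"] exI[of _ 0] exI[of _ "Suc r"]) simp_all
  qed
next
  case False
  obtain r i where i: "i \<le> multiplicity p n" "U = smul (int p ^ r) ` tri_lat n (int p ^ i)"
    using odd_prime_classification[OF U n(1) p False a] by blast
  then have "smul (int p ^ i) ` U = smul (int p ^ r) ` smul (int p ^ i) ` tri_lat n (int p ^ i)"
    by (simp add: image_smul_smul mult.commute)
  moreover have "smul (int p ^ i) ` tri_lat n (int p ^ i) \<in> X_set n p"
    using X_set_odd_prime[OF _ p False] n i(1) by auto
  ultimately show ?thesis by blast
qed

text \<open>A unit entry cannot absorb a factor \<open>p\<close>, so the two exponents agree and the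
  scaling cancels.\<close>

lemma proportional_eq:
  assumes p: "prime p" and eq: "smul (int p ^ a) ` N = smul (int p ^ b) ` N'"
    and x: "x \<in> N" "is_unit (x i j)" and x': "x' \<in> N'" "is_unit (x' k l)"
  shows "N = N'"
proof -
  have le: "b \<le> a" if eq: "smul (int p ^ a) ` N = smul (int p ^ b) ` N'" and x: "x \<in> N" "is_unit (x i j)"
    for a b N N' x i j
  proof -
    obtain y where "smul (int p ^ a) x = smul (int p ^ b) y" using eq x(1) by blast
    then have "int p ^ a * x i j = int p ^ b * y i j" by (metis smul_apply)
    then have "int p ^ b dvd int p ^ a * x i j" by simp
    then have "int p ^ b dvd int p ^ a" using x(2) by (metis dvd_mult_unit_iff)
    then have "p ^ b dvd p ^ a" by (metis int_dvd_int_iff of_nat_power)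
    then show ?thesis using p power_dvd_imp_le[of p b a] prime_gt_1_nat by blast
  qed
  have ab: "a = b" using le[OF eq x] le[OF eq[symmetric] x'] by simp
  have "inj (smul (int p ^ a))" using p by (intro injI) (simp add: smul_cancel prime_gt_0_nat)
  then show ?thesis using eq unfolding ab by (simp add: inj_image_eq_iff)
qed

text \<open>This is the local uniqueness. For odd \<open>p\<close> the unit entries belong to the
  underlying \<open>tri_lat\<close>, and \<open>tri_lat_antimono\<close> then recovers the
  exponent.\<close>

lemma X_set_proportional:
  assumes n: "n \<ge> 5" "\<not> 4 dvd n" and p: "prime p" and N: "N \<in> X_set n p" "N' \<in> X_set n p"
    and eq: "smul (int p ^ a) ` N = smul (int p ^ b) ` N'"
  shows "N = N'"
proof (cases "p = 2")
  case True
  have unit: "\<exists>x\<in>N. \<exists>i j. is_unit (x i j)" if N: "N \<in> X_set n 2" for N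
  proof -
    have one: "\<exists>x\<in>tri_par n. \<exists>i j. is_unit (x i j)"
      using tri_par_one[OF n(1)] n
      by (intro bexI[of _ "wedge_comb n (\<lambda>_ _. 1)"] exI[of _ 2] exI[of _ 3])
         (auto simp: wedge_comb_coeff wedge_pairs_def)
    have two: "\<exists>x\<in>even_lat n. \<exists>i j. is_unit (x i j)"
      by (intro bexI[OF _ sq_even_lat[OF n(1)]] exI[of _ 2] exI[of _ 3]) (simp add: sq_def wedge_def)
    have three: "\<exists>x\<in>tri_lat n 2. \<exists>i j. is_unit (x i j)" if ev: "even n"
    proof -
      obtain x where "x \<in> tri_lat n 2" "x 2 4 = -1" using tri_lat_unit[OF n(1), of 2] ev by auto
      then show ?thesis by (intro bexI[of _ x] exI[of _ 2] exI[of _ 4]) simp_all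
    qed
    show ?thesis
      using N X_set_2[OF n] one two three by (auto simp: even_lat_def split: if_splits)
  qed
  obtain x i j where x: "x \<in> N" "is_unit (x i j)" using unit N(1) True by blast
  obtain x' k l where x': "x' \<in> N'" "is_unit (x' k l)" using unit N(2) True by blast
  show ?thesis by (rule proportional_eq[OF p eq x x'])
next
  case False
  obtain r where r: "r \<le> multiplicity p n" "N = smul (int p ^ r) ` tri_lat n (int p ^ r)"
    using N(1) X_set_odd_prime[OF _ p False] n by auto
  obtain s where s: "s \<le> multiplicity p n" "N' = smul (int p ^ s) ` tri_lat n (int p ^ s)"
    using N(2) X_set_odd_prime[OF _ p False] n by auto
  have unit: "\<exists>x\<in>tri_lat n (int p ^ r). x 2 4 = -1" if "r \<le> multiplicity p n" for r
    using tri_lat_unit[OF n(1) multiplicity_dvd'[OF that]] by simp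
  obtain x where x: "x \<in> tri_lat n (int p ^ r)" "x 2 4 = -1" using unit[OF r(1)] by blast
  obtain y where y: "y \<in> tri_lat n (int p ^ s)" "y 2 4 = -1" using unit[OF s(1)] by blast
  have "smul (int p ^ (a + r)) ` tri_lat n (int p ^ r) = smul (int p ^ (b + s)) ` tri_lat n (int p ^ s)"
    using eq by (simp add: r(2) s(2) image_smul_smul power_add)
  then have L: "tri_lat n (int p ^ r) = tri_lat n (int p ^ s)"
    by (rule proportional_eq[OF p _ x(1) _ y(1), where i = 2 and j = 4 and k = 2 and l = 4])
       (simp_all add: x(2) y(2))
  have "r \<le> s" if "tri_lat n (int p ^ s) \<subseteq> tri_lat n (int p ^ r)" for r s
  proof -
    have "p ^ r dvd p ^ s" using tri_lat_antimono[OF n(1) that] by (metis int_dvd_int_iff of_nat_power)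
    then show ?thesis using p power_dvd_imp_le[of p r s] prime_gt_1_nat by blast
  qed
  then have "r = s" using L by (metis order_antisym order_refl)
  then show ?thesis by (simp add: r(2) s(2))
qed

subsection \<open>Embedding a lattice into a rationally isomorphic one\<close>

definition pure_tensor :: "(int, 'v) sn_module \<Rightarrow> rat \<Rightarrow> 'v \<Rightarrow> (rat \<times> 'v \<Rightarrow>\<^sub>0 int) set"
  where "pure_tensor L q x = tensor_kernel L #>\<^bsub>tensor_gens L\<^esub> frag_of (q, x)"

text \<open>Integral linear forms are how freeness is used: they extend to the scalar extension and
  separate the points of a lattice.\<close>

definition functionals :: "(int, 'v) sn_module \<Rightarrow> ('v \<Rightarrow> int) set"
  where "functionals L = {f. (\<forall>x\<in>carrier L. \<forall>y\<in>carrier L. f (x \<oplus>\<^bsub>L\<^esub> y) = f x + f y) \<and>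
    (\<forall>k. \<forall>x\<in>carrier L. f (k \<odot>\<^bsub>L\<^esub> x) = k * f x)}"

context
  fixes n :: nat and L :: "(int, 'v) sn_module"
  assumes L: "sn_module n \<Z> L"
begin

interpretation L: sn_module n \<Z> L by (rule L)

lemma module_L: "module \<Z> L" ..

lemmas kernel_closed = tensor_kernel_closed[OF module_L]

lemma kernel_diff: "c \<in> tensor_kernel L \<Longrightarrow> d \<in> tensor_kernel L \<Longrightarrow> c - d \<in> tensor_kernel L"
  using kernel_closed(2)[of c "- d"] kernel_closed(3)[of d] by simp

lemma kernel_rels:
  assumes "x \<in> carrier L"
  shows "frag_of (q + r, x) - frag_of (q, x) - frag_of (r, x) \<in> tensor_kernel L"
    and "y \<in> carrier L \<Longrightarrow> frag_of (q, x \<oplus>\<^bsub>L\<^esub> y) - frag_of (q, x) - frag_of (q, y) \<in> tensor_kernel L"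
    and "frag_of (q * of_int k, x) - frag_of (q, k \<odot>\<^bsub>L\<^esub> x) \<in> tensor_kernel L"
  unfolding tensor_kernel_def tensor_rels_def using assms by (blast intro: generate.incl)+

lemma coset_eq_iff:
  "tensor_kernel L #>\<^bsub>tensor_gens L\<^esub> c = tensor_kernel L #>\<^bsub>tensor_gens L\<^esub> d \<longleftrightarrow> c - d \<in> tensor_kernel L"
proof
  assume "tensor_kernel L #>\<^bsub>tensor_gens L\<^esub> c = tensor_kernel L #>\<^bsub>tensor_gens L\<^esub> d"
  moreover have "c \<in> tensor_kernel L #>\<^bsub>tensor_gens L\<^esub> c"
    using kernel_closed(1) by (force simp: r_coset_def tensor_gens_simps(2))
  ultimately show "c - d \<in> tensor_kernel L"
    by (auto simp: r_coset_def tensor_gens_simps(2))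
next
  assume *: "c - d \<in> tensor_kernel L"
  have "\<exists>k'\<in>tensor_kernel L. k + c = k' + d" if "k \<in> tensor_kernel L" for k
    using kernel_closed(2)[OF that *] by (rule rev_bexI) simp
  moreover have "\<exists>k'\<in>tensor_kernel L. k + d = k' + c" if "k \<in> tensor_kernel L" for k
    using kernel_diff[OF that *] by (rule rev_bexI) simp
  ultimately show "tensor_kernel L #>\<^bsub>tensor_gens L\<^esub> c = tensor_kernel L #>\<^bsub>tensor_gens L\<^esub> d"
    unfolding r_coset_def tensor_gens_simps(2) set_eq_iff UN_iff singleton_iff by metis
qed

lemma pure_tensor_eq_iff:
  "pure_tensor L q x = pure_tensor L r y \<longleftrightarrow> frag_of (q, x) - frag_of (r, y) \<in> tensor_kernel L"
  unfolding pure_tensor_def by (rule coset_eq_iff)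

lemma frag_of_gens: "x \<in> carrier L \<Longrightarrow> frag_of (q, x) \<in> carrier (tensor_gens L)"
  by (simp add: tensor_gens_simps)

lemma carrier_rat_tensor:
  "carrier (rat_tensor L) = (\<lambda>c. tensor_kernel L #>\<^bsub>tensor_gens L\<^esub> c) ` carrier (tensor_gens L)"
  by (simp add: rat_tensor_def Let_def carrier_FactGroup)

lemma pure_tensor_closed: "x \<in> carrier L \<Longrightarrow> pure_tensor L q x \<in> carrier (rat_tensor L)"
  unfolding carrier_rat_tensor pure_tensor_def by (intro imageI frag_of_gens)

lemma pure_tensor_add:
  assumes "x \<in> carrier L" "y \<in> carrier L"
  shows "pure_tensor L q (x \<oplus>\<^bsub>L\<^esub> y) = pure_tensor L q x \<oplus>\<^bsub>rat_tensor L\<^esub> pure_tensor L q y"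
proof -
  have "pure_tensor L q x \<oplus>\<^bsub>rat_tensor L\<^esub> pure_tensor L q y =
      tensor_kernel L #>\<^bsub>tensor_gens L\<^esub> (frag_of (q, x) + frag_of (q, y))"
    using normal.rcos_sum[OF tensor_kernel_normal[OF module_L] frag_of_gens[OF assms(1)] frag_of_gens[OF assms(2)]]
    by (simp add: rat_tensor_def Let_def pure_tensor_def tensor_gens_simps(2))
  then show ?thesis
    unfolding pure_tensor_def using kernel_rels(2)[OF assms] by (simp add: coset_eq_iff diff_diff_eq)
qed

lemma pure_tensor_smult_right:
  "x \<in> carrier L \<Longrightarrow> pure_tensor L q (k \<odot>\<^bsub>L\<^esub> x) = pure_tensor L (q * of_int k) x"
  using kernel_rels(3) by (metis pure_tensor_eq_iff)

lemma smult_pure_tensor: "q \<odot>\<^bsub>rat_tensor L\<^esub> pure_tensor L r x = pure_tensor L (q * r) x"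
proof -
  let ?s = "\<lambda>(r, x). frag_of (q * r, x)"
  have "frag_extend ?s d \<in> tensor_kernel L" if "d \<in> tensor_rels L" for d
    using that unfolding tensor_rels_def
    by (auto simp: frag_extend_diff distrib_left mult.assoc[symmetric] intro: kernel_rels)
  from tensor_coset_map[OF module_L this] show ?thesis
    by (simp add: rat_tensor_def Let_def pure_tensor_def)
qed

lemma act_pure_tensor:
  assumes \<sigma>: "\<sigma> \<in> carrier (sym_group n)"
  shows "act (rat_tensor L) \<sigma> (pure_tensor L r x) = pure_tensor L r (act L \<sigma> x)"
proof -
  let ?a = "\<lambda>(r::rat, x). frag_of (r, act L \<sigma> x)"
  note kr = kernel_rels[OF L.act_closed[OF \<sigma>]]
  have "frag_extend ?a d \<in> tensor_kernel L" if "d \<in> tensor_rels L" for d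
    using that unfolding tensor_rels_def
    by (auto simp: frag_extend_diff L.act_add[OF \<sigma>] L.act_smult[OF \<sigma>] intro: kr(1,3) kr(2)[OF _ L.act_closed[OF \<sigma>]])
  from tensor_coset_map[OF module_L this] show ?thesis
    by (simp add: rat_tensor_def Let_def pure_tensor_def)
qed

text \<open>Common denominators: rational coefficients are cleared into the lattice, one generator
  at a time.\<close>

lemma rat_tensor_pure:
  assumes "T \<in> carrier (rat_tensor L)"
  obtains m x where "m > 0" "x \<in> carrier L" "T = pure_tensor L (1 / of_int m) x"
proof -
  obtain c where c: "Poly_Mapping.keys c \<subseteq> UNIV \<times> carrier L" "T = tensor_kernel L #>\<^bsub>tensor_gens L\<^esub> c"
    using assms by (auto simp: carrier_rat_tensor tensor_gens_simps(1))
  have null: "frag_of (0, x) \<in> tensor_kernel L" if "x \<in> carrier L" for x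
    using kernel_closed(3)[OF kernel_rels(1)[OF that, of 0 0]] by simp
  have "\<exists>m>0. \<exists>x\<in>carrier L. c - frag_of (1 / rat_of_int m, x) \<in> tensor_kernel L"
    using c(1)
  proof (induction c rule: frag_induction)
    case zero
    \<comment> \<open>The zero element is written as 1 \<otimes> (0 x) with x = 0: the relation for
      scalars moves the 0 to the left factor, where \<open>null\<close> applies.\<close>
    have "frag_of (1 * of_int 0, \<zero>\<^bsub>L\<^esub>) - frag_of (1, 0 \<odot>\<^bsub>L\<^esub> \<zero>\<^bsub>L\<^esub>) \<in> tensor_kernel L"
      by (intro kernel_rels) simp
    from kernel_diff[OF this null[of "\<zero>\<^bsub>L\<^esub>"]] show ?case
      by (intro exI[of _ 1] conjI bexI[of _ "0 \<odot>\<^bsub>L\<^esub> \<zero>\<^bsub>L\<^esub>"]) auto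
  next
    case (one p)
    then obtain q x where p: "p = (q, x)" "x \<in> carrier L" by auto
    obtain a b where ab: "quotient_of q = (a, b)" by force
    then have "q = 1 / of_int b * of_int a" "b > 0"
      using quotient_of_div[OF ab] quotient_of_denom_pos[OF ab] by auto
    then show ?case
      using kernel_rels(3)[OF p(2), of "1 / of_int b" a] p(2)
      by (intro exI[of _ b] conjI bexI[of _ "a \<odot>\<^bsub>L\<^esub> x"]) (auto simp: p(1))
  next
    case (diff c d)
    then obtain m x m' y where m: "m > 0" "m' > 0" and xy: "x \<in> carrier L" "y \<in> carrier L"
      and c: "c - frag_of (1 / rat_of_int m, x) \<in> tensor_kernel L"
      and d: "d - frag_of (1 / rat_of_int m', y) \<in> tensor_kernel L" by blast
    \<comment> \<open>The common denominator; the minus sign is carried by the integer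
      \<open>- m\<close>, so that the difference becomes a sum in the lattice.\<close>
    define q where "q = 1 / rat_of_int (m * m')"
    have q: "q * of_int m' = 1 / of_int m" "q * of_int m = 1 / of_int m'" "q * of_int (- m) = - (1 / of_int m')"
      using m by (auto simp: q_def)
    let ?x = "m' \<odot>\<^bsub>L\<^esub> x" and ?y = "(- m) \<odot>\<^bsub>L\<^esub> y"
    have x: "frag_of (1 / of_int m, x) - frag_of (q, ?x) \<in> tensor_kernel L"
      using kernel_rels(3)[OF xy(1), of q m'] by (simp only: q)
    have y: "frag_of (- (1 / of_int m'), y) - frag_of (q, ?y) \<in> tensor_kernel L"
      using kernel_rels(3)[OF xy(2), of q "- m"] by (simp only: q)
    have y': "frag_of (0, y) - frag_of (1 / of_int m', y) - frag_of (- (1 / of_int m'), y) \<in> tensor_kernel L"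
      using kernel_rels(1)[OF xy(2), of "1 / of_int m'" "- (1 / of_int m')"] by simp
    have s: "frag_of (q, ?x \<oplus>\<^bsub>L\<^esub> ?y) - frag_of (q, ?x) - frag_of (q, ?y) \<in> tensor_kernel L"
      using xy by (intro kernel_rels) auto
    have "(c - frag_of (1 / rat_of_int m, x)) - (d - frag_of (1 / rat_of_int m', y)) +
        (frag_of (1 / of_int m, x) - frag_of (q, ?x)) + (frag_of (- (1 / of_int m'), y) - frag_of (q, ?y)) +
        (frag_of (0, y) - frag_of (1 / of_int m', y) - frag_of (- (1 / of_int m'), y)) -
        (frag_of (q, ?x \<oplus>\<^bsub>L\<^esub> ?y) - frag_of (q, ?x) - frag_of (q, ?y)) - frag_of (0, y) \<in> tensor_kernel L"
      by (intro kernel_diff kernel_closed(2) c d x y y' s null xy(2))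
    then have "c - d - frag_of (q, ?x \<oplus>\<^bsub>L\<^esub> ?y) \<in> tensor_kernel L"
      by (simp add: algebra_simps)
    then show ?case
      unfolding q_def using m xy by (intro exI[of _ "m * m'"] conjI bexI[of _ "?x \<oplus>\<^bsub>L\<^esub> ?y"]) auto
  qed
  then obtain m x where "m > 0" "x \<in> carrier L" "c - frag_of (1 / rat_of_int m, x) \<in> tensor_kernel L" by blast
  then show ?thesis using that by (simp add: c(2) pure_tensor_def coset_eq_iff)
qed

text \<open>The assignment of \<open>q * f x\<close> to a generator extends additively to the free
  group and kills all relations. The sum runs over the support, and enlarging the index set makes
  additivity visible.\<close>

lemma pure_tensor_functional:
  assumes f: "f \<in> functionals L" and eq: "pure_tensor L q x = pure_tensor L r y"
  shows "q * of_int (f x) = r * of_int (f y)"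
proof -
  define F :: "(rat \<times> 'v \<Rightarrow>\<^sub>0 int) \<Rightarrow> rat" where "F = (\<lambda>c. \<Sum>p\<in>Poly_Mapping.keys c. of_int (Poly_Mapping.lookup c p) * (fst p * of_int (f (snd p))))"
  have F: "F c = (\<Sum>p\<in>A. of_int (Poly_Mapping.lookup c p) * (fst p * of_int (f (snd p))))"
    if "finite A" "Poly_Mapping.keys c \<subseteq> A" for A c
    unfolding F_def by (rule sum.mono_neutral_left[OF that]) (simp add: in_keys_iff)
  have add: "F (c + d) = F c + F d" for c d
    by (subst (1 2 3) F[of "Poly_Mapping.keys c \<union> Poly_Mapping.keys d"])
       (auto simp: lookup_add distrib_right sum.distrib dest: subsetD[OF keys_add])
  have minus: "F (- c) = - F c" for c
    using add[of c "- c"] by (simp add: F_def sum_negf)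
  have diff: "F (c - d) = F c - F d" for c d
    using add[of c "- d"] minus[of d] by simp
  have of: "F (frag_of (q, x)) = q * of_int (f x)" for q x by (simp add: F_def)
  have rel: "F h = 0" if "h \<in> tensor_rels L" for h
    using that f unfolding tensor_rels_def
    by (auto simp: functionals_def diff of distrib_left distrib_right mult.assoc)
  have "F c = 0" if "c \<in> generate (tensor_gens L) (tensor_rels L)" for c
    using that
  proof (induction rule: generate.induct)
    case one
    then show ?case by (simp add: tensor_gens_simps F_def)
  next
    case (incl h)
    then show ?case by (rule rel)
  next
    case (inv h)
    then have "h \<in> carrier (tensor_gens L)" using tensor_rels_closed[OF module_L] by auto
    then show ?case using rel[OF inv] by (simp add: tensor_gens_simps(4) minus)
  next
    case (eng h1 h2)
    then show ?case by (simp add: tensor_gens_simps(2) add)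
  qed
  then have "F (frag_of (q, x) - frag_of (r, y)) = 0"
    using eq by (simp add: pure_tensor_eq_iff tensor_kernel_def)
  then show ?thesis by (simp add: diff of)
qed

end

text \<open>The coordinates with respect to a basis are linear forms.\<close>

lemma sn_lattice_functionals:
  assumes L: "sn_lattice n L" and x: "x \<in> carrier L" and y: "y \<in> carrier L"
    and eq: "\<And>f. f \<in> functionals L \<Longrightarrow> f x = f y"
  shows "x = y"
proof -
  interpret sn_module n \<Z> L using L by (simp add: sn_lattice_def)
  obtain B where B: "finite B" "B \<subseteq> carrier L"
    and exp: "\<forall>x\<in>carrier L. \<exists>!c. c \<in> B \<rightarrow>\<^sub>E UNIV \<and> x = (\<Oplus>\<^bsub>L\<^esub>b\<in>B. c b \<odot>\<^bsub>L\<^esub> b)"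
    using L unfolding sn_lattice_def by (elim conjE exE)
  define c where "c = (\<lambda>x. THE c. c \<in> B \<rightarrow>\<^sub>E UNIV \<and> x = (\<Oplus>\<^bsub>L\<^esub>b\<in>B. c b \<odot>\<^bsub>L\<^esub> b))"
  have c: "c x \<in> B \<rightarrow>\<^sub>E UNIV" "x = (\<Oplus>\<^bsub>L\<^esub>b\<in>B. c x b \<odot>\<^bsub>L\<^esub> b)" if "x \<in> carrier L" for x
    using theI'[OF bspec[OF exp that]] unfolding c_def by blast+
  have c_unique: "c x b = k b" if "x = (\<Oplus>\<^bsub>L\<^esub>b\<in>B. k b \<odot>\<^bsub>L\<^esub> b)" "x \<in> carrier L" "b \<in> B" for x k b
  proof -
    \<comment> \<open>Coefficients are unique only among extensional functions, hence the
      restriction to \<open>B\<close>.\<close>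
    have "x = (\<Oplus>\<^bsub>L\<^esub>b\<in>B. restrict k B b \<odot>\<^bsub>L\<^esub> b)"
      unfolding that(1) by (rule M.finsum_cong') (use B(2) in auto)
    moreover have "restrict k B \<in> B \<rightarrow>\<^sub>E UNIV" by simp
    ultimately have "restrict k B = c x"
      using the1_equality[OF bspec[OF exp that(2)], of "restrict k B"] unfolding c_def by simp
    then have "c x b = restrict k B b" by simp
    then show ?thesis using that(3) by simp
  qed
  have mem: "(\<lambda>b. k b \<odot>\<^bsub>L\<^esub> b) \<in> B \<rightarrow> carrier L" for k :: "'a \<Rightarrow> int" using B(2) by auto
  have "(\<lambda>x. c x b) \<in> functionals L" if b: "b \<in> B" for b
    unfolding functionals_def
  proof (intro CollectI conjI ballI allI)
    fix x y assume xy: "x \<in> carrier L" "y \<in> carrier L"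
    have "x \<oplus>\<^bsub>L\<^esub> y = (\<Oplus>\<^bsub>L\<^esub>b\<in>B. c x b \<odot>\<^bsub>L\<^esub> b) \<oplus>\<^bsub>L\<^esub> (\<Oplus>\<^bsub>L\<^esub>b\<in>B. c y b \<odot>\<^bsub>L\<^esub> b)"
      by (rule arg_cong2[OF c(2)[OF xy(1)] c(2)[OF xy(2)]])
    also have "\<dots> = (\<Oplus>\<^bsub>L\<^esub>b\<in>B. c x b \<odot>\<^bsub>L\<^esub> b \<oplus>\<^bsub>L\<^esub> c y b \<odot>\<^bsub>L\<^esub> b)"
      by (rule M.finsum_addf[OF mem mem, symmetric])
    also have "\<dots> = (\<Oplus>\<^bsub>L\<^esub>b\<in>B. (c x b + c y b) \<odot>\<^bsub>L\<^esub> b)"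
      by (rule M.finsum_cong') (use B(2) smult_l_distr in auto)
    finally show "c (x \<oplus>\<^bsub>L\<^esub> y) b = c x b + c y b" by (rule c_unique[OF _ _ b]) (use xy in simp)
  next
    fix k x assume x: "x \<in> carrier L"
    have "k \<odot>\<^bsub>L\<^esub> x = k \<odot>\<^bsub>L\<^esub> (\<Oplus>\<^bsub>L\<^esub>b\<in>B. c x b \<odot>\<^bsub>L\<^esub> b)" by (rule arg_cong[OF c(2)[OF x]])
    also have "\<dots> = (\<Oplus>\<^bsub>L\<^esub>b\<in>B. k \<odot>\<^bsub>L\<^esub> (c x b \<odot>\<^bsub>L\<^esub> b))"
      by (rule finsum_smult_ldistr) (use B mem in auto)
    also have "\<dots> = (\<Oplus>\<^bsub>L\<^esub>b\<in>B. (k * c x b) \<odot>\<^bsub>L\<^esub> b)"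
      by (rule M.finsum_cong') (use B(2) smult_assoc1 in auto)
    finally show "c (k \<odot>\<^bsub>L\<^esub> x) b = k * c x b" by (rule c_unique[OF _ _ b]) (use x in simp)
  qed
  then have "c x b = c y b" if "b \<in> B" for b using eq that by blast
  then have "(\<Oplus>\<^bsub>L\<^esub>b\<in>B. c x b \<odot>\<^bsub>L\<^esub> b) = (\<Oplus>\<^bsub>L\<^esub>b\<in>B. c y b \<odot>\<^bsub>L\<^esub> b)"
    by (intro M.finsum_cong') (use mem in auto)
  then show ?thesis by (rule trans[OF c(2)[OF x] trans[OF _ c(2)[OF y, symmetric]]])
qed

text \<open>The images of a finite basis under the rational isomorphism have a common denominator
  \<open>m\<close>, and \<open>m\<close> times the isomorphism maps \<open>L\<close> into
  \<open>W\<close>. Linear forms on \<open>W\<close> make this map well defined, those on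
  \<open>L\<close> make it injective.\<close>

theorem lattice_embedding:
  fixes L :: "(int, 'v) sn_module" and W :: "(int, 'w) sn_module"
  assumes L: "sn_lattice n L" and W: "sn_module n \<Z> W"
    and iso: "sn_iso n rat_ring (rat_tensor L) (rat_tensor W)"
    and sep: "\<And>x y. x \<in> carrier W \<Longrightarrow> y \<in> carrier W \<Longrightarrow> (\<And>f. f \<in> functionals W \<Longrightarrow> f x = f y) \<Longrightarrow> x = y"
    and nonzero: "w \<in> carrier W" "w \<noteq> \<zero>\<^bsub>W\<^esub>"
  obtains h where "h ` carrier L \<subseteq> carrier W" "inj_on h (carrier L)"
    "\<And>x y. x \<in> carrier L \<Longrightarrow> y \<in> carrier L \<Longrightarrow> h (x \<oplus>\<^bsub>L\<^esub> y) = h x \<oplus>\<^bsub>W\<^esub> h y"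
    "\<And>k x. x \<in> carrier L \<Longrightarrow> h (k \<odot>\<^bsub>L\<^esub> x) = k \<odot>\<^bsub>W\<^esub> h x"
    "\<And>\<sigma> x. \<sigma> \<in> carrier (sym_group n) \<Longrightarrow> x \<in> carrier L \<Longrightarrow> h (act L \<sigma> x) = act W \<sigma> (h x)"
    "\<exists>x\<in>carrier L. h x \<noteq> \<zero>\<^bsub>W\<^esub>"
proof -
  have L': "sn_module n \<Z> L" using L by (simp add: sn_lattice_def)
  interpret L: sn_module n \<Z> L by (rule L')
  interpret W: sn_module n \<Z> W by (rule W)
  let ?T = "rat_tensor L" and ?S = "rat_tensor W"
  obtain F where bij: "bij_betw F (carrier ?T) (carrier ?S)"
    and Fadd: "\<And>x y. x \<in> carrier ?T \<Longrightarrow> y \<in> carrier ?T \<Longrightarrow> F (x \<oplus>\<^bsub>?T\<^esub> y) = F x \<oplus>\<^bsub>?S\<^esub> F y"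
    and Fsm: "\<And>r x. x \<in> carrier ?T \<Longrightarrow> F (r \<odot>\<^bsub>?T\<^esub> x) = r \<odot>\<^bsub>?S\<^esub> F x"
    and Fact: "\<And>\<sigma> x. \<sigma> \<in> carrier (sym_group n) \<Longrightarrow> x \<in> carrier ?T \<Longrightarrow> F (act ?T \<sigma> x) = act ?S \<sigma> (F x)"
    using iso unfolding sn_iso_def by auto
  obtain B where B: "finite B" "B \<subseteq> carrier L"
    and exp: "\<forall>x\<in>carrier L. \<exists>!c. c \<in> B \<rightarrow>\<^sub>E UNIV \<and> x = (\<Oplus>\<^bsub>L\<^esub>b\<in>B. c b \<odot>\<^bsub>L\<^esub> b)"
    using L unfolding sn_lattice_def by (elim conjE exE)
  have FS: "F (pure_tensor L 1 x) \<in> carrier ?S" if "x \<in> carrier L" for x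
    using bij pure_tensor_closed[OF L' that] by (auto simp: bij_betw_def)
  have "\<exists>m. m > 0 \<and> (\<exists>s\<in>carrier W. F (pure_tensor L 1 x) = pure_tensor W (1 / of_int m) s)"
    if "x \<in> carrier L" for x using rat_tensor_pure[OF W FS[OF that]] by metis
  then obtain den where den: "\<And>x. x \<in> carrier L \<Longrightarrow> den x > (0::int)"
    "\<And>x. x \<in> carrier L \<Longrightarrow> \<exists>s\<in>carrier W. F (pure_tensor L 1 x) = pure_tensor W (1 / of_int (den x)) s" by metis
  define m where "m = (\<Prod>b\<in>B. den b)"
  have m: "m > 0" unfolding m_def using den(1) B(2) by (intro prod_pos) auto
  \<comment> \<open>The graph of the embedding. As a relation it can be shown compatible with all
    operations before existence and uniqueness of the value are known.\<close>
  define P where "P = (\<lambda>x s. s \<in> carrier W \<and> F (pure_tensor L 1 x) = pure_tensor W (1 / of_int m) s)"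
  have Padd: "P (x \<oplus>\<^bsub>L\<^esub> y) (s \<oplus>\<^bsub>W\<^esub> t)" if "P x s" "P y t" "x \<in> carrier L" "y \<in> carrier L" for x y s t
    using that by (simp add: P_def pure_tensor_add[OF L'] pure_tensor_add[OF W] Fadd pure_tensor_closed[OF L'])
  have Psm: "P (k \<odot>\<^bsub>L\<^esub> x) (k \<odot>\<^bsub>W\<^esub> s)" if "P x s" "x \<in> carrier L" for k x s
  proof -
    have "F (pure_tensor L 1 (k \<odot>\<^bsub>L\<^esub> x)) = F (of_int k \<odot>\<^bsub>?T\<^esub> pure_tensor L 1 x)"
      using that(2) by (simp add: pure_tensor_smult_right[OF L'] smult_pure_tensor[OF L'])
    also have "\<dots> = of_int k \<odot>\<^bsub>?S\<^esub> pure_tensor W (1 / of_int m) s"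
      using that by (simp add: Fsm pure_tensor_closed[OF L'] P_def)
    also have "\<dots> = pure_tensor W (1 / of_int m) (k \<odot>\<^bsub>W\<^esub> s)"
      using that(1) by (simp add: pure_tensor_smult_right[OF W] smult_pure_tensor[OF W] P_def)
    finally show ?thesis using that(1) by (simp add: P_def)
  qed
  have Pact: "P (act L \<sigma> x) (act W \<sigma> s)" if "\<sigma> \<in> carrier (sym_group n)" "P x s" "x \<in> carrier L" for \<sigma> x s
    using that by (simp add: P_def W.act_closed Fact pure_tensor_closed[OF L']
        flip: act_pure_tensor[OF L'] act_pure_tensor[OF W])
  have Puniq: "s = t" if "P x s" "P x t" for x s t
  proof (rule sep)
    show "s \<in> carrier W" "t \<in> carrier W" using that by (auto simp: P_def)
    fix f assume "f \<in> functionals W"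
    from pure_tensor_functional[OF W this, of "1 / of_int m" s "1 / of_int m" t] that m
    show "f s = f t" by (simp add: P_def)
  qed
  have PB: "\<exists>s. P b s" if b: "b \<in> B" for b
  proof -
    obtain s where s: "s \<in> carrier W" "F (pure_tensor L 1 b) = pure_tensor W (1 / of_int (den b)) s"
      using den(2) b B(2) by blast
    define k where "k = (\<Prod>b\<in>B - {b}. den b)"
    have "m = den b * k" unfolding m_def k_def using b B(1) by (simp add: prod.remove)
    then have "1 / rat_of_int (den b) = 1 / of_int m * of_int k"
      using m by (auto simp: field_simps)
    then have "P b (k \<odot>\<^bsub>W\<^esub> s)"
      using s by (simp add: P_def pure_tensor_smult_right[OF W])
    then show ?thesis ..
  qed
  \<comment> \<open>The start of the induction over basis sums: 1 \<otimes> 0 is its own zero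
    multiple, and a zero factor can be moved back into \<open>W\<close>.\<close>
  have P0: "P \<zero>\<^bsub>L\<^esub> \<zero>\<^bsub>W\<^esub>"
  proof -
    obtain k s where ks: "k > (0::int)" "s \<in> carrier W"
      "F (pure_tensor L 1 \<zero>\<^bsub>L\<^esub>) = pure_tensor W (1 / of_int k) s"
      using rat_tensor_pure[OF W FS[OF L.M.zero_closed]] by metis
    have "F (pure_tensor L 1 \<zero>\<^bsub>L\<^esub>) = F (0 \<odot>\<^bsub>?T\<^esub> pure_tensor L 1 \<zero>\<^bsub>L\<^esub>)"
      using pure_tensor_smult_right[OF L', of "\<zero>\<^bsub>L\<^esub>" 1 0] by (simp add: smult_pure_tensor[OF L'])
    also have "\<dots> = pure_tensor W 0 s"
      using ks by (simp add: Fsm pure_tensor_closed[OF L'] smult_pure_tensor[OF W])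
    also have "\<dots> = pure_tensor W (1 / of_int m) \<zero>\<^bsub>W\<^esub>"
      using pure_tensor_smult_right[OF W ks(2), of "1 / of_int m" 0] ks(2) by simp
    finally show ?thesis by (simp add: P_def)
  qed
  have "\<exists>s. P x s" if x: "x \<in> carrier L" for x
  proof -
    obtain c where c: "x = (\<Oplus>\<^bsub>L\<^esub>b\<in>B. c b \<odot>\<^bsub>L\<^esub> b)" using bspec[OF exp x] by (elim ex1E conjE)
    have "\<exists>s. P (\<Oplus>\<^bsub>L\<^esub>b\<in>A. c b \<odot>\<^bsub>L\<^esub> b) s" if "A \<subseteq> B" for A
      using finite_subset[OF that B(1)] that
    proof (induction A rule: finite_induct)
      case empty
      then show ?case using P0 by auto
    next
      case (insert b A)
      then have b: "b \<in> carrier L" and A: "(\<lambda>b. c b \<odot>\<^bsub>L\<^esub> b) \<in> A \<rightarrow> carrier L" using B(2) by auto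
      obtain s where "P b s" using PB[of b] insert.prems by blast
      moreover obtain t where "P (\<Oplus>\<^bsub>L\<^esub>b\<in>A. c b \<odot>\<^bsub>L\<^esub> b) t" using insert by blast
      ultimately have "P (c b \<odot>\<^bsub>L\<^esub> b \<oplus>\<^bsub>L\<^esub> (\<Oplus>\<^bsub>L\<^esub>b\<in>A. c b \<odot>\<^bsub>L\<^esub> b)) (c b \<odot>\<^bsub>W\<^esub> s \<oplus>\<^bsub>W\<^esub> t)"
        using A b by (intro Padd Psm) auto
      then show ?case using insert A b by (auto simp: L.M.finsum_insert)
    qed
    from this[of B] show ?thesis unfolding c by blast
  qed
  then obtain h where h: "\<And>x. x \<in> carrier L \<Longrightarrow> P x (h x)" by metis
  have zeroF: "f \<zero>\<^bsub>W\<^esub> = 0" if "f \<in> functionals W" for f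
  proof -
    have "f (\<zero>\<^bsub>W\<^esub> \<oplus>\<^bsub>W\<^esub> \<zero>\<^bsub>W\<^esub>) = f \<zero>\<^bsub>W\<^esub> + f \<zero>\<^bsub>W\<^esub>"
      using that W.M.zero_closed unfolding functionals_def by blast
    then show ?thesis by simp
  qed
  show ?thesis
  proof (rule that[of h])
    show "h ` carrier L \<subseteq> carrier W" using h by (auto simp: P_def)
    show "h (x \<oplus>\<^bsub>L\<^esub> y) = h x \<oplus>\<^bsub>W\<^esub> h y" if "x \<in> carrier L" "y \<in> carrier L" for x y
      using that by (intro Puniq[OF h Padd] h) auto
    show "h (k \<odot>\<^bsub>L\<^esub> x) = k \<odot>\<^bsub>W\<^esub> h x" if "x \<in> carrier L" for k x
      using that by (intro Puniq[OF h Psm] h) auto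
    show "h (act L \<sigma> x) = act W \<sigma> (h x)" if "\<sigma> \<in> carrier (sym_group n)" "x \<in> carrier L" for \<sigma> x
      using that by (intro Puniq[OF h Pact] h L.act_closed) auto
    show "inj_on h (carrier L)"
    proof (rule inj_onI)
      fix x y assume xy: "x \<in> carrier L" "y \<in> carrier L" "h x = h y"
      then have "F (pure_tensor L 1 x) = F (pure_tensor L 1 y)" using h[of x] h[of y] by (simp add: P_def)
      then have eq: "pure_tensor L 1 x = pure_tensor L 1 y"
        using bij xy pure_tensor_closed[OF L'] unfolding bij_betw_def by (meson inj_onD)
      show "x = y"
        using xy pure_tensor_functional[OF L' _ eq] by (intro sn_lattice_functionals[OF L]) auto
    qed
    \<comment> \<open>If \<open>h\<close> vanished, every value of \<open>F\<close> would be a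
      multiple of a tensor with right factor zero, against surjectivity.\<close>
    show "\<exists>x\<in>carrier L. h x \<noteq> \<zero>\<^bsub>W\<^esub>"
    proof (rule ccontr)
      assume *: "\<not> (\<exists>x\<in>carrier L. h x \<noteq> \<zero>\<^bsub>W\<^esub>)"
      have "pure_tensor W 1 w \<in> F ` carrier ?T"
        using bij pure_tensor_closed[OF W nonzero(1), of 1] by (auto simp: bij_betw_def)
      then obtain T where T: "T \<in> carrier ?T" "F T = pure_tensor W 1 w" by auto
      obtain k x where kx: "x \<in> carrier L" "T = pure_tensor L (1 / of_int k) x"
        using rat_tensor_pure[OF L' T(1)] by metis
      have "F T = F ((1 / of_int k) \<odot>\<^bsub>?T\<^esub> pure_tensor L 1 x)"
        by (simp add: kx(2) smult_pure_tensor[OF L'])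
      also have "\<dots> = (1 / of_int k) \<odot>\<^bsub>?S\<^esub> pure_tensor W (1 / of_int m) \<zero>\<^bsub>W\<^esub>"
        using h[OF kx(1)] * kx(1) by (simp add: Fsm pure_tensor_closed[OF L'] P_def)
      finally have eq: "pure_tensor W 1 w = pure_tensor W (1 / of_int k * (1 / of_int m)) \<zero>\<^bsub>W\<^esub>"
        by (simp add: smult_pure_tensor[OF W] T(2))
      have "w = \<zero>\<^bsub>W\<^esub>"
        using nonzero(1) pure_tensor_functional[OF W _ eq] by (intro sep) (auto simp: zeroF)
      with nonzero(2) show False ..
    qed
  qed
qed

subsection \<open>From local to global\<close>

text \<open>The localization at \<open>p\<close> cut back to integral cycles, which makes it a
  lattice of the same kind.\<close>

definition localization :: "nat \<Rightarrow> nat \<Rightarrow> mat set \<Rightarrow> mat set"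
  where "localization n p U = {x \<in> cycles n. \<exists>k. coprime k (int p) \<and> smul k x \<in> U}"

lemma sublat_localization:
  assumes U: "sublat n U"
  shows "sublat n (localization n p U)"
proof -
  interpret sublat n U by fact
  show ?thesis
  proof (rule sublatI)
    fix x y assume "x \<in> localization n p U" "y \<in> localization n p U"
    then obtain k l where k: "coprime k (int p)" "smul k x \<in> U" and l: "coprime l (int p)" "smul l y \<in> U"
      and xy: "x \<in> cycles n" "y \<in> cycles n" by (auto simp: localization_def)
    have "smul (k * l) (x - y) = smul l (smul k x) - smul k (smul l y)"
      by (simp add: smul_smul smul_diff mult.commute)
    also have "\<dots> \<in> U" by (intro diff smul k l)
    finally have "smul (k * l) (x - y) \<in> U" .
    moreover have "coprime (k * l) (int p)" using k l by simp
    ultimately show "x - y \<in> localization n p U"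
      using cycles.diff[OF xy] unfolding localization_def by blast
  next
    fix \<sigma> x assume \<sigma>: "\<sigma> permutes {1..n}" and x: "x \<in> localization n p U"
    then obtain k where k: "coprime k (int p)" "smul k x \<in> U" "x \<in> cycles n" by (auto simp: localization_def)
    have "smul k (relabel \<sigma> x) \<in> U" using relabel[OF \<sigma> k(2)] by (simp add: relabel_smul)
    then show "relabel \<sigma> x \<in> localization n p U"
      using k cycles.relabel[OF \<sigma>] unfolding localization_def by blast
  qed (auto simp: localization_def intro: exI[of _ 1])
qed

lemma (in sublat) saturated:
  assumes "\<And>y. y \<in> cycles n \<Longrightarrow> smul (int p ^ a) y \<in> U" "x \<in> cycles n" "smul k x \<in> U" "coprime k (int p)"
  shows "x \<in> U"
  using smul_coprime[OF assms(3) assms(1)[OF assms(2)]] assms(4) by simp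

text \<open>For \<open>x\<close> in every localization, the ideal of multipliers into
  \<open>U\<close> contains \<open>m\<close> and, for each prime in \<open>P\<close>, an integer
  prime to it. No prime divides its generator, which is therefore 1.\<close>

lemma inter_localizations:
  assumes U: "sublat n U" and m: "m \<noteq> 0" "\<And>y. y \<in> cycles n \<Longrightarrow> smul m y \<in> U"
    and P: "P \<noteq> {}" "\<And>p. prime p \<Longrightarrow> int p dvd m \<Longrightarrow> p \<in> P"
  shows "(\<Inter>p\<in>P. localization n p U) = U"
proof (intro equalityI subsetI)
  interpret sublat n U by fact
  fix x assume x: "x \<in> (\<Inter>p\<in>P. localization n p U)"
  then have xc: "x \<in> cycles n" using P(1) by (auto simp: localization_def)
  obtain g where g: "g \<in> {k. smul k x \<in> U}" "g \<ge> 0" "\<And>k. k \<in> {k. smul k x \<in> U} \<Longrightarrow> g dvd k"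
    by (rule int_subgroup_principal[of "{k. smul k x \<in> U}"]) (auto simp: smul_diff_left diff)
  have gm: "g dvd m" using g(3) m(2)[OF xc] by blast
  have "g = 1"
  proof (rule ccontr)
    assume "g \<noteq> 1"
    then have "nat g \<noteq> 1" using g(2) by linarith
    then obtain q where q: "prime q" "q dvd nat g"
      using prime_factor_nat by blast
    then have qg: "int q dvd g" using g(2) by (metis int_dvd_int_iff int_nat_eq)
    then have "q \<in> P" using P(2)[OF q(1)] gm dvd_trans by blast
    then obtain k where k: "coprime k (int q)" "smul k x \<in> U" using x by (auto simp: localization_def)
    then have "int q dvd k" using g(3) qg dvd_trans by blast
    then have "is_unit (int q)" using k(1) by (meson coprime_common_divisor dvd_refl)
    then show False using q(1) by (auto dest: prime_gt_1_nat)
  qed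
  then show "x \<in> U" using g(1) by simp
next
  fix x assume "x \<in> U"
  then show "x \<in> (\<Inter>p\<in>P. localization n p U)"
    using sublat.sub[OF U] by (auto simp: localization_def intro!: exI[of _ 1])
qed

section \<open>Recombining proportional local lattices\<close>

lemma prime_powers_dvd:
  assumes "finite P" "\<And>p. p \<in> P \<Longrightarrow> prime p" "\<And>p. p \<in> P \<Longrightarrow> int p ^ c p dvd v"
  shows "(\<Prod>p\<in>P. int p ^ c p) dvd v"
  using assms
proof (induction P rule: finite_induct)
  case (insert q P)
  have "coprime (int q ^ c q) (int p ^ c p)" if "p \<in> P" for p
    using primes_coprime[of "int q" "int p"] insert.hyps(2) insert.prems(1)[of q] insert.prems(1)[of p] that by auto
  then have "coprime (int q ^ c q) (\<Prod>p\<in>P. int p ^ c p)" by (rule prod_coprime_right)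
  then show ?case using insert by (simp add: divides_mult)
qed simp

lemma prime_powers_remove:
  assumes P: "finite P" "\<And>p. p \<in> P \<Longrightarrow> prime p" and p: "p \<in> P"
  obtains B where "(\<Prod>q\<in>P. int q ^ b q) = int p ^ b p * B" "coprime B (int p)"
proof (rule that)
  show "(\<Prod>q\<in>P. int q ^ b q) = int p ^ b p * (\<Prod>q\<in>P - {p}. int q ^ b q)"
    using P(1) p by (rule prod.remove)
  have "coprime (int p) (int q ^ b q)" if "q \<in> P - {p}" for q
    using primes_coprime[of "int p" "int q"] P(2)[OF p] P(2)[of q] that by auto
  then show "coprime (\<Prod>q\<in>P - {p}. int q ^ b q) (int p)"
    using prod_coprime_right[of "P - {p}" "int p" "\<lambda>q. int q ^ b q"] by (simp add: coprime_commute)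
qed

text \<open>Divisibility by each prime power gives divisibility by their product. The quotient lies
  in each \<open>W p\<close> up to factors prime to \<open>p\<close>, which \<open>saturated\<close>
  removes.\<close>

lemma inter_scaling_subset:
  assumes P: "finite P" "P \<noteq> {}" "\<And>p. p \<in> P \<Longrightarrow> prime p"
    and sub: "\<And>p. p \<in> P \<Longrightarrow> sublat n (V p)" "\<And>p. p \<in> P \<Longrightarrow> sublat n (W p)"
    and e: "\<And>p y. p \<in> P \<Longrightarrow> y \<in> cycles n \<Longrightarrow> smul (int p ^ e p) y \<in> W p"
    and eq: "\<And>p. p \<in> P \<Longrightarrow> smul (int p ^ b p) ` V p = smul (int p ^ c p) ` W p"
  shows "smul (\<Prod>p\<in>P. int p ^ b p) ` (\<Inter>p\<in>P. V p) \<subseteq> smul (\<Prod>p\<in>P. int p ^ c p) ` (\<Inter>p\<in>P. W p)"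
proof clarify
  fix x assume x: "x \<in> (\<Inter>p\<in>P. V p)"
  let ?B = "\<Prod>p\<in>P. int p ^ b p" and ?C = "\<Prod>p\<in>P. int p ^ c p"
  have xc: "x \<in> cycles n" using x P(2) sub(1) sublat.sub by blast
  have z: "\<exists>z\<in>W p. smul (int p ^ b p) x = smul (int p ^ c p) z" if "p \<in> P" for p
    using eq[OF that] x that by blast
  have "int p ^ c p \<noteq> 0" if "p \<in> P" for p using P(3)[OF that] by auto
  then have C0: "?C \<noteq> 0" unfolding prod_zero_iff[OF P(1)] by blast
  have dvd: "?C dvd smul ?B x i j" for i j
  proof (rule prime_powers_dvd[OF P(1,3)])
    fix p assume p: "p \<in> P"
    obtain B where B: "?B = int p ^ b p * B" using prime_powers_remove[OF P(1,3) p] by metis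
    obtain z where z: "smul (int p ^ b p) x = smul (int p ^ c p) z" using z[OF p] by blast
    have "smul ?B x i j = B * smul (int p ^ b p) x i j" by (simp add: B)
    then show "int p ^ c p dvd smul ?B x i j" by (simp add: z)
  qed
  then obtain y where y: "y \<in> cycles n" "smul ?B x = smul ?C y"
    using cycles_divide[OF cycles.smul[OF xc] C0 dvd] by blast
  have "y \<in> W p" if p: "p \<in> P" for p
  proof -
    obtain B where B: "?B = int p ^ b p * B" using prime_powers_remove[OF P(1,3) p] by metis
    obtain C where C: "?C = int p ^ c p * C" "coprime C (int p)" using prime_powers_remove[OF P(1,3) p] by metis
    obtain z where z: "z \<in> W p" "smul (int p ^ b p) x = smul (int p ^ c p) z" using z[OF p] by blast
    have "smul (int p ^ c p) (smul C y) = smul B (smul (int p ^ b p) x)"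
      using y(2) by (simp add: B C smul_smul mult.commute)
    also have "\<dots> = smul (int p ^ c p) (smul B z)" by (simp add: z(2) smul_smul mult.commute)
    finally have "smul C y = smul B z" using P(3)[OF p] by (simp add: smul_cancel prime_gt_0_nat)
    then have "smul C y \<in> W p" using sublat.smul[OF sub(2)[OF p] z(1)] by simp
    then show ?thesis using sublat.saturated[OF sub(2)[OF p] e[OF p] y(1)] C(2) by blast
  qed
  with y(2) show "smul ?B x \<in> smul ?C ` (\<Inter>p\<in>P. W p)" by auto
qed

text \<open>Combining the edge congruence with the bound on twice the triangle value shows that the
  content divides \<open>2 * n\<close> times each entry, while \<open>U\<close> contains the content
  times every doubled cycle. Together this gives the constant \<open>4 * n\<close>.\<close>

lemma normalize_sublat:
  assumes U: "sublat n U" and n: "n \<ge> 5" and nz: "U \<noteq> {0}"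
  obtains d V where "d \<noteq> 0" "sublat n V" "smul (2 * int n) ` U = smul d ` V"
    "\<And>y. y \<in> cycles n \<Longrightarrow> smul (4 * int n) y \<in> V"
proof -
  interpret sublat n U by fact
  obtain d where d: "d \<ge> 0"
    "\<And>x i j k l. x \<in> U \<Longrightarrow> distinct [i, j, k, l] \<Longrightarrow> {i, j, k, l} \<subseteq> {1..n} \<Longrightarrow> d dvd csq i j k l x"
    "\<And>i j k l. distinct [i, j, k, l] \<Longrightarrow> {i, j, k, l} \<subseteq> {1..n} \<Longrightarrow> smul d (sq i j k l) \<in> U"
    using square_content[OF n] by metis
  have dvd: "d dvd 2 * int n * x i j" if x: "x \<in> U" for x i j
  proof (cases "i \<in> {1..n} \<and> j \<in> {1..n} \<and> i \<noteq> j")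
    case True
    have xc: "x \<in> cycles n" using x sub by blast
    have t: "d dvd int n * x i j - (int n - 2) * tau 1 2 3 x"
      using True by (intro tau_cong(3)[OF n xc d(2)[OF x]]) auto
    have "d dvd 2 * (int n * x i j - (int n - 2) * tau 1 2 3 x) + (int n - 2) * (2 * tau 1 2 3 x)"
      by (intro dvd_add dvd_mult[OF t] dvd_mult[OF tau_cong(1)[OF n xc d(2)[OF x]]])
    then show ?thesis by (simp add: algebra_simps)
  next
    case False
    then show ?thesis using cycles_outside[of x n i j] cycles_diag[of x n i] x sub by auto
  qed
  have d0: "d \<noteq> 0"
  proof
    assume "d = 0"
    then have "x = 0" if "x \<in> U" for x using dvd[OF that] n by (simp add: fun_eq_iff)
    then show False using nz zero by blast
  qed
  let ?W = "smul (2 * int n) ` U"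
  have W: "sublat n ?W" by (rule sublat_smul_image[OF U])
  define V where "V = {y \<in> cycles n. smul d y \<in> ?W}"
  have WV: "?W = smul d ` V"
    unfolding V_def by (rule sublat_divide_eq[OF W d0]) (use dvd in auto)
  have "smul (4 * int n) y \<in> V" if y: "y \<in> cycles n" for y
  proof -
    have "smul d (smul 2 y) \<in> U"
      using y by (intro sq_spans[OF U n d(3)]) (simp_all add: cycles.smul par_smul)
    then have "smul (2 * int n) (smul d (smul 2 y)) \<in> ?W" by blast
    then show ?thesis using y by (simp add: V_def cycles.smul smul_smul mult.commute mult.left_commute)
  qed
  then show ?thesis using that[OF d0 _ WV] sublat_divide[OF W] unfolding V_def by blast
qed

text \<open>Since \<open>g\<close> commutes with the reflections, it multiplies squares by a factor,
  and by transitivity by the same one. Thus \<open>smul (4 * m) (g x)\<close> and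
  \<open>smul c x\<close> have equal square values, and a cycle whose square values all vanish is
  zero.\<close>

lemma equivariant_scalar:
  assumes n: "n \<ge> 5" and V: "sublat n V" "sublat n W" and m: "m \<noteq> 0" "\<And>y. y \<in> cycles n \<Longrightarrow> smul m y \<in> V"
    and bij: "bij_betw g V W" and add: "\<And>x y. x \<in> V \<Longrightarrow> y \<in> V \<Longrightarrow> g (x + y) = g x + g y"
    and sm: "\<And>k x. x \<in> V \<Longrightarrow> g (smul k x) = smul k (g x)"
    and rel: "\<And>\<sigma> x. \<sigma> permutes {1..n} \<Longrightarrow> x \<in> V \<Longrightarrow> g (relabel \<sigma> x) = relabel \<sigma> (g x)"
  obtains c c' where "c \<noteq> 0" "c' \<noteq> 0" "smul c ` V = smul c' ` W"
proof -
  interpret V: sublat n V by fact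
  interpret W: sublat n W by fact
  have gW: "g x \<in> W" if "x \<in> V" for x using bij that by (auto simp: bij_betw_def)
  have diff: "g (x - y) = g x - g y" if "x \<in> V" "y \<in> V" for x y
    using add[OF V.diff[OF that] that(2)] by simp
  have refl: "g (x - relabel (transpose i j) x) = g x - relabel (transpose i j) (g x)"
    if "x \<in> V" "i \<in> {1..n}" "j \<in> {1..n}" for x i j
    using that by (simp add: diff rel V.relabel permutes_swap_id)
  have csq: "g (smul (csq i j k l x) (sq i j k l)) = smul (csq i j k l (g x)) (sq i j k l)"
    if x: "x \<in> V" and ijkl: "distinct [i, j, k, l]" "{i, j, k, l} \<subseteq> {1..n}" for x i j k l
  proof -
    define y where "y = x - relabel (transpose i j) x"
    have y: "y \<in> V" unfolding y_def using x ijkl by (intro V.reflect) auto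
    have gy: "g y = g x - relabel (transpose i j) (g x)" unfolding y_def using x ijkl by (intro refl) auto
    have xc: "x \<in> cycles n" "g x \<in> cycles n" using x gW[OF x] V.sub W.sub by auto
    have r: "y - relabel (transpose k l) y = smul (csq i j k l x) (sq i j k l)"
      "g y - relabel (transpose k l) (g y) = smul (csq i j k l (g x)) (sq i j k l)"
      unfolding gy unfolding y_def
      by (rule reflection_product[OF xc(1) ijkl(1)], rule reflection_product[OF xc(2) ijkl(1)])
    have "g (y - relabel (transpose k l) y) = g y - relabel (transpose k l) (g y)"
      using y ijkl by (intro refl) auto
    then show ?thesis unfolding r .
  qed
  have mem: "smul m (sq i j k l) \<in> V" if "{i, j, k, l} \<subseteq> {1..n}" for i j k l
    using that by (intro m(2) sq_cycles) auto
  define q where "q = sq 1 2 3 4"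
  define c where "c = csq 1 2 3 4 (g (smul m q))"
  have one: "distinct [1::nat, 2, 3, 4]" "{1, 2, 3, 4} \<subseteq> {1..n}" using n by auto
  \<comment> \<open>The square is evaluated on its own four-cycle, so all four edges count; hence
    the 4 in the scalar.\<close>
  have "csq 1 2 3 4 (smul m q) = 4 * m" by (simp add: csq_def q_def sq_def wedge_def)
  then have base: "g (smul (4 * m) q) = smul c q"
    using csq[OF mem[OF one(2)] one] by (simp add: c_def q_def)
  have all: "g (smul (4 * m) (sq i j k l)) = smul c (sq i j k l)"
    if ijkl: "distinct [i, j, k, l]" "{i, j, k, l} \<subseteq> {1..n}" for i j k l
  proof -
    obtain \<sigma> where \<sigma>: "\<sigma> permutes {1..n}" "map \<sigma> [i, j, k, l] = [1, 2, 3, 4]"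
      using permutes_map_eq[OF ijkl(1) one(1), of "{1..n}"] one(2) ijkl(2) by auto
    have iff: "\<sigma> a = \<sigma> b \<longleftrightarrow> a = b" for a b using permutes_inj[OF \<sigma>(1)] by (simp add: inj_eq)
    have \<sigma>': "1 = \<sigma> i" "2 = \<sigma> j" "3 = \<sigma> k" "4 = \<sigma> l" using \<sigma>(2) by auto
    have rq: "relabel \<sigma> q = sq i j k l"
      unfolding q_def \<sigma>' by (simp add: fun_eq_iff sq_def wedge_def iff)
    have "smul (4 * m) q \<in> V"
      using V.smul[OF mem[OF one(2)], of 4] by (simp add: q_def smul_smul)
    from rel[OF \<sigma>(1) this] show ?thesis by (simp add: relabel_smul rq base)
  qed
  have scalar: "smul (4 * m) (g x) = smul c x" if x: "x \<in> V" for x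
  proof -
    define z where "z = smul (4 * m) (g x) - smul c x"
    have zc: "z \<in> cycles n"
      unfolding z_def using gW[OF x] x V.sub W.sub by (intro cycles.diff cycles.smul) auto
    \<comment> \<open>Divisibility by 0 is vanishing, so \<open>tau_cong\<close> with content 0
      yields \<open>z = 0\<close>.\<close>
    have "0 dvd csq i j k l z" if ijkl: "distinct [i, j, k, l]" "{i, j, k, l} \<subseteq> {1..n}" for i j k l
    proof -
      let ?s = "sq i j k l"
      have s: "smul (csq i j k l x) ?s \<in> V" "smul (4 * m) ?s \<in> V"
        using V.csq_sq_mem[OF x ijkl] V.smul[OF mem[OF ijkl(2)], of 4] by (simp_all add: smul_smul)
      have "smul (4 * m * csq i j k l (g x)) ?s = smul (4 * m) (g (smul (csq i j k l x) ?s))"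
        by (simp add: csq[OF x ijkl] smul_smul)
      also have "\<dots> = g (smul (4 * m) (smul (csq i j k l x) ?s))" by (rule sm[OF s(1), symmetric])
      also have "\<dots> = g (smul (csq i j k l x) (smul (4 * m) ?s))" by (simp add: smul_smul mult.commute)
      also have "\<dots> = smul (csq i j k l x) (g (smul (4 * m) ?s))" by (rule sm[OF s(2)])
      also have "\<dots> = smul (csq i j k l x * c) ?s" by (simp add: all[OF ijkl] smul_smul)
      finally have "smul (4 * m * csq i j k l (g x)) ?s i k = smul (csq i j k l x * c) ?s i k" by simp
      moreover have "?s i k = 1" using ijkl(1) by (auto simp: sq_def wedge_def)
      ultimately have "4 * m * csq i j k l (g x) = csq i j k l x * c" by simp
      then show ?thesis by (simp add: z_def csq_def algebra_simps)
    qed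
    note t = tau_cong[OF n zc this]
    have "z = 0"
    proof (intro ext)
      fix i j
      show "z i j = 0 i j"
      proof (cases "i \<in> {1..n} \<and> j \<in> {1..n} \<and> i \<noteq> j")
        case True
        then show ?thesis using t(1) t(3)[of i j] n by simp
      next
        case False
        then show ?thesis using cycles_outside[OF zc, of i j] cycles_diag[OF zc, of i] by auto
      qed
    qed
    then show ?thesis by (simp add: z_def)
  qed
  have c0: "c \<noteq> 0"
  proof
    assume "c = 0"
    have mq: "smul m q \<in> V" unfolding q_def by (rule mem[OF one(2)])
    have "smul (4 * m) (g (smul m q)) = smul (4 * m) (g 0)"
      using scalar[OF mq] scalar[OF V.zero] \<open>c = 0\<close> by simp
    then have "g (smul m q) = g 0" using m(1) by (simp add: smul_cancel)
    then have "smul m q = 0" using bij mq V.zero by (meson bij_betw_def inj_onD)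
    then have "smul m q 1 3 = 0" by simp
    then show False using m(1) by (simp add: q_def sq_def wedge_def)
  qed
  have "smul c ` V = smul (4 * m) ` g ` V" using scalar by (auto simp: image_image)
  then have "smul c ` V = smul (4 * m) ` W" using bij by (simp add: bij_betw_def)
  then show ?thesis using that[of c "4 * m"] c0 m(1) by simp
qed

text \<open>The converse of recombination: proportional intersections are proportional at each
  prime, because the factors prime to \<open>p\<close> can be cancelled on both sides.\<close>

lemma inter_proportional_subset:
  assumes P: "finite P" "\<And>p. p \<in> P \<Longrightarrow> prime p" and p: "p \<in> P"
    and sub: "\<And>p. p \<in> P \<Longrightarrow> sublat n (V p)" "\<And>p. p \<in> P \<Longrightarrow> sublat n (W p)"
    and e: "\<And>p y. p \<in> P \<Longrightarrow> y \<in> cycles n \<Longrightarrow> smul (int p ^ e p) y \<in> V p"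
    and e': "\<And>y. y \<in> cycles n \<Longrightarrow> smul (int p ^ e') y \<in> W p"
    and eq: "smul (int p ^ a * c) ` (\<Inter>p\<in>P. V p) \<subseteq> smul (int p ^ b * d) ` (\<Inter>p\<in>P. W p)"
    and cop: "coprime c (int p)" "coprime d (int p)"
  shows "smul (int p ^ a) ` V p \<subseteq> smul (int p ^ b) ` W p"
proof clarify
  fix x assume x: "x \<in> V p"
  then have xc: "x \<in> cycles n" using sub(1)[OF p] sublat.sub by blast
  \<comment> \<open>This multiplier moves \<open>x\<close> into all other members of the family and
    is prime to \<open>p\<close>.\<close>
  let ?K = "\<Prod>q\<in>P - {p}. int q ^ e q"
  have "coprime (int p) (int q ^ e q)" if "q \<in> P - {p}" for q
    using primes_coprime[of "int p" "int q"] P(2)[OF p] P(2)[of q] that by auto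
  then have K: "coprime ?K (int p)"
    using prod_coprime_right[of "P - {p}" "int p" "\<lambda>q. int q ^ e q"] by (simp add: coprime_commute)
  have "smul ?K x \<in> V q" if q: "q \<in> P" for q
  proof (cases "q = p")
    case True
    then show ?thesis using sublat.smul[OF sub(1)[OF p] x] by simp
  next
    case False
    then have "int q ^ e q dvd ?K" using q P(1) by (intro dvd_prodI) auto
    then show ?thesis using sublat.smul_dvd[OF sub(1)[OF q] e[OF q xc]] by blast
  qed
  then have "smul (int p ^ a * c) (smul ?K x) \<in> smul (int p ^ b * d) ` (\<Inter>p\<in>P. W p)" using eq by blast
  then obtain y where y: "\<And>q. q \<in> P \<Longrightarrow> y \<in> W q" "smul (int p ^ a * c) (smul ?K x) = smul (int p ^ b * d) y" by auto
  have p0: "int p ^ k \<noteq> 0" for k using P(2)[OF p] by auto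
  have "int p ^ b dvd smul (int p ^ a) x i j" for i j
  proof -
    have "(c * ?K) * (int p ^ a * x i j) = int p ^ b * (d * y i j)"
      using fun_cong[OF fun_cong[OF y(2), of i], of j] by (simp add: ac_simps)
    then have "int p ^ b dvd (c * ?K) * (int p ^ a * x i j)" by simp
    moreover have "coprime (int p ^ b) (c * ?K)" using cop(1) K by (simp add: coprime_commute)
    ultimately show ?thesis by (simp add: coprime_dvd_mult_right_iff)
  qed
  then obtain z where z: "z \<in> cycles n" "smul (int p ^ a) x = smul (int p ^ b) z"
    using cycles_divide[OF cycles.smul[OF xc] p0] by blast
  have "smul (int p ^ b) (smul (c * ?K) z) = smul (int p ^ b) (smul d y)"
  proof -
    have "smul (int p ^ b) (smul (c * ?K) z) = smul (c * ?K) (smul (int p ^ a) x)"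
      unfolding z(2) by (simp add: smul_smul mult.commute)
    also have "\<dots> = smul (int p ^ a * c) (smul ?K x)" by (simp add: smul_smul ac_simps)
    also have "\<dots> = smul (int p ^ b) (smul d y)" unfolding y(2) by (simp only: smul_smul)
    finally show ?thesis .
  qed
  then have "smul (c * ?K) z = smul d y" using p0 by (simp add: smul_cancel)
  then have "smul (c * ?K) z \<in> W p" using sublat.smul[OF sub(2)[OF p] y(1)[OF p]] by simp
  moreover have "coprime (c * ?K) (int p)" using cop(1) K by simp
  ultimately have "z \<in> W p" using sublat.saturated[OF sub(2)[OF p] e' z(1)] by blast
  with z(2) show "smul (int p ^ a) x \<in> smul (int p ^ b) ` W p" by auto
qed

lemma prime_power_decompose:
  assumes "prime p" "c \<noteq> 0"
  obtains a d where "c = int p ^ a * d" "coprime d (int p)"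
proof -
  have "\<not> is_unit (int p)" using assms(1) by (auto dest: prime_gt_1_nat)
  then obtain d where d: "c = int p ^ multiplicity (int p) c * d" "\<not> int p dvd d"
    using multiplicity_decompose'[OF assms(2), of "int p"] by metis
  have "prime (int p)" using assms(1) by simp
  from prime_imp_coprime[OF this d(2)] show ?thesis
    using that[OF d(1)] by (simp add: coprime_commute)
qed

text \<open>The isomorphism is \<open>h\<close> times the quotient of \<open>a\<close> by
  \<open>b\<close>, defined as the solution of \<open>smul a (h x) = smul b (f x)\<close>.\<close>

theorem scaled_lattice_iso:
  fixes L :: "(int, 'a) sn_module"
  assumes L: "sn_module n \<Z> L" and ab: "a \<noteq> 0" "b \<noteq> 0"
    and h: "inj_on h (carrier L)"
    "\<And>x y. x \<in> carrier L \<Longrightarrow> y \<in> carrier L \<Longrightarrow> h (x \<oplus>\<^bsub>L\<^esub> y) = h x + h y"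
    "\<And>k x. x \<in> carrier L \<Longrightarrow> h (k \<odot>\<^bsub>L\<^esub> x) = smul k (h x)"
    "\<And>\<sigma> x. \<sigma> \<in> carrier (sym_group n) \<Longrightarrow> x \<in> carrier L \<Longrightarrow> h (act L \<sigma> x) = relabel (inv' \<sigma>) (h x)"
    and eq: "smul a ` h ` carrier L = smul b ` V"
  shows "sn_iso n \<Z> L ((specht_lattice n)\<lparr>carrier := V\<rparr>)"
proof -
  interpret sn_module n \<Z> L by fact
  have "\<exists>v\<in>V. smul a (h x) = smul b v" if "x \<in> carrier L" for x using eq that by blast
  then obtain f where f: "\<And>x. x \<in> carrier L \<Longrightarrow> f x \<in> V" "\<And>x. x \<in> carrier L \<Longrightarrow> smul a (h x) = smul b (f x)"
    by metis
  have uniq: "f x = v" if "x \<in> carrier L" "smul a (h x) = smul b v" for x v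
    using f(2)[OF that(1)] that(2) ab(2) by (simp add: smul_cancel)
  have "bij_betw f (carrier L) V"
    unfolding bij_betw_def
  proof (intro conjI equalityI subsetI inj_onI)
    fix x y assume xy: "x \<in> carrier L" "y \<in> carrier L" "f x = f y"
    then have "smul a (h x) = smul a (h y)" using f(2) by metis
    then have "h x = h y" using ab(1) by (simp add: smul_cancel)
    then show "x = y" using h(1) xy by (meson inj_onD)
  next
    fix v assume "v \<in> V"
    then have "smul b v \<in> smul a ` h ` carrier L" using eq by blast
    then obtain x where x: "x \<in> carrier L" "smul a (h x) = smul b v" by auto
    then show "v \<in> f ` carrier L" using uniq[OF x] by blast
  qed (use f(1) in auto)
  moreover have "f (x \<oplus>\<^bsub>L\<^esub> y) = f x + f y" if "x \<in> carrier L" "y \<in> carrier L" for x y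
    using that by (intro uniq) (simp_all add: h(2) smul_add f(2))
  moreover have "f (k \<odot>\<^bsub>L\<^esub> x) = smul k (f x)" if "x \<in> carrier L" for k x
  proof (rule uniq)
    have "smul a (smul k (h x)) = smul k (smul a (h x))" by (simp add: smul_smul mult.commute)
    also have "\<dots> = smul b (smul k (f x))" by (simp add: f(2)[OF that] smul_smul mult.commute)
    finally show "smul a (h (k \<odot>\<^bsub>L\<^esub> x)) = smul b (smul k (f x))" by (simp only: h(3)[OF that])
  qed (use that in simp)
  moreover have "f (act L \<sigma> x) = relabel (inv' \<sigma>) (f x)" if "\<sigma> \<in> carrier (sym_group n)" "x \<in> carrier L" for \<sigma> x
    using that by (intro uniq) (simp_all add: h(4) act_closed f(2) flip: relabel_smul)
  ultimately show ?thesis unfolding sn_iso_def by (auto simp: specht_simps)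
qed

lemma iso_lattices_proportional:
  fixes L :: "(int, 'a) sn_module"
  assumes n: "n \<ge> 5" and L: "sn_module n \<Z> L" and V: "sublat n V" "sublat n W"
    and m: "m \<noteq> 0" "\<And>y. y \<in> cycles n \<Longrightarrow> smul m y \<in> V"
    and iso: "sn_iso n \<Z> L ((specht_lattice n)\<lparr>carrier := V\<rparr>)" "sn_iso n \<Z> L ((specht_lattice n)\<lparr>carrier := W\<rparr>)"
  obtains c c' where "c \<noteq> 0" "c' \<noteq> 0" "smul c ` V = smul c' ` W"
proof -
  interpret sn_module n \<Z> L by fact
  obtain f where f: "bij_betw f (carrier L) V"
    "\<And>x y. x \<in> carrier L \<Longrightarrow> y \<in> carrier L \<Longrightarrow> f (x \<oplus>\<^bsub>L\<^esub> y) = f x + f y"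
    "\<And>k x. x \<in> carrier L \<Longrightarrow> f (k \<odot>\<^bsub>L\<^esub> x) = smul k (f x)"
    "\<And>\<sigma> x. \<sigma> \<in> carrier (sym_group n) \<Longrightarrow> x \<in> carrier L \<Longrightarrow> f (act L \<sigma> x) = relabel (inv' \<sigma>) (f x)"
    using iso(1) unfolding sn_iso_def by (auto simp: specht_simps)
  obtain h where h: "bij_betw h (carrier L) W"
    "\<And>x y. x \<in> carrier L \<Longrightarrow> y \<in> carrier L \<Longrightarrow> h (x \<oplus>\<^bsub>L\<^esub> y) = h x + h y"
    "\<And>k x. x \<in> carrier L \<Longrightarrow> h (k \<odot>\<^bsub>L\<^esub> x) = smul k (h x)"
    "\<And>\<sigma> x. \<sigma> \<in> carrier (sym_group n) \<Longrightarrow> x \<in> carrier L \<Longrightarrow> h (act L \<sigma> x) = relabel (inv' \<sigma>) (h x)"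
    using iso(2) unfolding sn_iso_def by (auto simp: specht_simps)
  define k where "k = inv_into (carrier L) f"
  have k: "k v \<in> carrier L" "f (k v) = v" if "v \<in> V" for v
    using that f(1) unfolding k_def bij_betw_def by (auto intro: inv_into_into f_inv_into_f)
  have kf: "k (f x) = x" if "x \<in> carrier L" for x
    using f(1) that by (simp add: k_def bij_betw_def)
  have bij: "bij_betw (h \<circ> k) V W"
    using bij_betw_trans[OF bij_betw_inv_into[OF f(1)] h(1)] by (simp add: k_def)
  have "k (x + y) = k x \<oplus>\<^bsub>L\<^esub> k y" if "x \<in> V" "y \<in> V" for x y
    using f(2)[OF k(1)[OF that(1)] k(1)[OF that(2)]] kf[of "k x \<oplus>\<^bsub>L\<^esub> k y"] k that by simp
  then have add: "(h \<circ> k) (x + y) = (h \<circ> k) x + (h \<circ> k) y" if "x \<in> V" "y \<in> V" for x y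
    using that k h(2) by simp
  have "k (smul r x) = r \<odot>\<^bsub>L\<^esub> k x" if "x \<in> V" for r x
    using f(3)[OF k(1)[OF that], of r] kf[of "r \<odot>\<^bsub>L\<^esub> k x"] k that by simp
  then have sm: "(h \<circ> k) (smul r x) = smul r ((h \<circ> k) x)" if "x \<in> V" for r x
    using that k h(3) by simp
  have rel: "(h \<circ> k) (relabel \<sigma> x) = relabel \<sigma> ((h \<circ> k) x)" if \<sigma>: "\<sigma> permutes {1..n}" and x: "x \<in> V" for \<sigma> x
  proof -
    have s: "inv' \<sigma> \<in> carrier (sym_group n)" using permutes_inv[OF \<sigma>] by (simp add: sym_group_carrier)
    have i: "inv' (inv' \<sigma>) = \<sigma>" by (rule permutes_inv_inv[OF \<sigma>])
    have "k (relabel \<sigma> x) = act L (inv' \<sigma>) (k x)"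
      using f(4)[OF s k(1)[OF x]] kf[OF act_closed[OF s k(1)[OF x]]] k(2)[OF x] by (simp add: i)
    then show ?thesis using h(4)[OF s k(1)[OF x]] by (simp add: i)
  qed
  show ?thesis using equivariant_scalar[OF n V m bij add sm rel] that by blast
qed

lemma specht_functionals:
  assumes xy: "x \<in> carrier (specht_lattice n)" "y \<in> carrier (specht_lattice n)"
    and eq: "\<And>f. f \<in> functionals (specht_lattice n) \<Longrightarrow> f x = f y"
  shows "x = y"
proof (intro ext)
  fix i j
  have "(\<lambda>z. z i j) \<in> functionals (specht_lattice n)" by (simp add: functionals_def specht_simps)
  from eq[OF this] show "x i j = y i j" .
qed

text \<open>For existence, each localization of a rescaled copy of \<open>L\<close> is replaced by
  the proportional member of \<open>X_set n p\<close>, and the pieces are recombined. For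
  uniqueness, isomorphic intersections are proportional, hence so are the members at each prime,
  which then coincide.\<close>

theorem theorem8p3:
  fixes n :: nat and L :: "(int, 'a) sn_module"
  assumes "n \<ge> 5" and "\<not> [n = 0] (mod 4)"
    and "Z_form n (rat_tensor (specht_lattice n)) L"
  shows "\<exists>!N. N \<in> (\<Pi>\<^sub>E p\<in>prime_factors (fact n :: nat). X_set n p) \<and>
    sn_iso n \<Z> L ((specht_lattice n)\<lparr>carrier := \<Inter>p\<in>prime_factors (fact n :: nat). N p\<rparr>)"
proof -
  define P where "P = prime_factors (fact n :: nat)"
  have n: "n \<ge> 5" "\<not> 4 dvd n" using assms(1,2) by (simp_all add: cong_0_iff)
  have P: "p \<in> P \<longleftrightarrow> prime p \<and> p \<le> n" for p
    by (auto simp: P_def prime_factors_dvd prime_dvd_fact_iff)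
  have fin: "finite P" by (simp add: P_def)
  have ne: "P \<noteq> {}" using P[of 2] n(1) by auto
  have lat: "sn_lattice n L" and iso: "sn_iso n rat_ring (rat_tensor L) (rat_tensor (specht_lattice n))"
    using assms(3) by (auto simp: Z_form_def)
  have L: "sn_module n \<Z> L" using lat by (simp add: sn_lattice_def)
  interpret L: sn_module n \<Z> L by (rule L)
  have q: "sq 1 2 3 4 \<in> carrier (specht_lattice n)" "sq 1 2 3 4 \<noteq> \<zero>\<^bsub>specht_lattice n\<^esub>"
  proof -
    show "sq 1 2 3 4 \<in> carrier (specht_lattice n)" using n unfolding specht_simps by (intro sq_cycles) auto
    have "sq 1 2 3 4 1 3 \<noteq> 0" by (simp add: sq_def wedge_def)
    then show "sq 1 2 3 4 \<noteq> \<zero>\<^bsub>specht_lattice n\<^esub>" unfolding specht_simps by auto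
  qed
  obtain h where h: "h ` carrier L \<subseteq> cycles n" "inj_on h (carrier L)"
    "\<And>x y. x \<in> carrier L \<Longrightarrow> y \<in> carrier L \<Longrightarrow> h (x \<oplus>\<^bsub>L\<^esub> y) = h x + h y"
    "\<And>k x. x \<in> carrier L \<Longrightarrow> h (k \<odot>\<^bsub>L\<^esub> x) = smul k (h x)"
    "\<And>\<sigma> x. \<sigma> \<in> carrier (sym_group n) \<Longrightarrow> x \<in> carrier L \<Longrightarrow> h (act L \<sigma> x) = relabel (inv' \<sigma>) (h x)"
    "\<exists>x\<in>carrier L. h x \<noteq> 0"
  proof (rule lattice_embedding[OF lat sn_module_specht iso _ q])
    show "x = y" if "x \<in> carrier (specht_lattice n)" "y \<in> carrier (specht_lattice n)"
      "\<And>f. f \<in> functionals (specht_lattice n) \<Longrightarrow> f x = f y" for x y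
      using that by (rule specht_functionals)
  qed (rule that, simp_all add: specht_simps)
  define U where "U = h ` carrier L"
  have U: "sublat n U"
  proof (rule sublatI)
    show "U \<subseteq> cycles n" using h(1) by (simp add: U_def)
    show diff: "x - y \<in> U" if xy: "x \<in> U" "y \<in> U" for x y
    proof -
      obtain a b where ab: "a \<in> carrier L" "b \<in> carrier L" "x = h a" "y = h b" using xy by (auto simp: U_def)
      then have "x - y = h (a \<oplus>\<^bsub>L\<^esub> (-1) \<odot>\<^bsub>L\<^esub> b)" by (simp add: h(3,4) smul_minus_left)
      then show ?thesis using ab by (simp add: U_def)
    qed
    obtain x where "x \<in> U" using h(6) by (auto simp: U_def)
    from diff[OF this this] show "0 \<in> U" by simp
    show "relabel \<sigma> x \<in> U" if \<sigma>: "\<sigma> permutes {1..n}" and x: "x \<in> U" for \<sigma> x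
    proof -
      obtain a where a: "a \<in> carrier L" "x = h a" using x by (auto simp: U_def)
      have s: "inv' \<sigma> \<in> carrier (sym_group n)" using permutes_inv[OF \<sigma>] by (simp add: sym_group_carrier)
      have "relabel \<sigma> x = h (act L (inv' \<sigma>) a)"
        using h(5)[OF s a(1)] a(2) permutes_inv_inv[OF \<sigma>] by simp
      then show ?thesis using L.act_closed[OF s a(1)] by (simp add: U_def)
    qed
  qed
  have "U \<noteq> {0}" using h(6) by (auto simp: U_def)
  then obtain d W where W: "d \<noteq> 0" "sublat n W" "smul (2 * int n) ` U = smul d ` W"
    "\<And>y. y \<in> cycles n \<Longrightarrow> smul (4 * int n) y \<in> W"
    using normalize_sublat[OF U n(1)] by metis
  have X: "sublat n N" "\<exists>a. \<forall>y\<in>cycles n. smul (int p ^ a) y \<in> N" if "p \<in> P" "N \<in> X_set n p" for p N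
    using X_set_sublat[OF n _ that(2)] P that(1) by auto
  have locW: "\<exists>e. \<forall>y\<in>cycles n. smul (int p ^ e) y \<in> localization n p W" if p: "p \<in> P" for p
  proof -
    obtain e k where e: "4 * int n = int p ^ e * k" "coprime k (int p)"
      using prime_power_decompose[of p "4 * int n"] p P n by auto
    have "smul (int p ^ e) y \<in> localization n p W" if y: "y \<in> cycles n" for y
    proof -
      have "smul (int p ^ e * k) y \<in> W" using W(4)[OF y] by (simp only: e(1))
      then have "smul k (smul (int p ^ e) y) \<in> W" by (simp only: smul_smul mult.commute)
      then show ?thesis using e(2) cycles.smul[OF y] unfolding localization_def by blast
    qed
    then show ?thesis by blast
  qed
  then obtain e where e: "\<And>p y. p \<in> P \<Longrightarrow> y \<in> cycles n \<Longrightarrow> smul (int p ^ e p) y \<in> localization n p W" by metis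
  have "\<exists>N b c. N \<in> X_set n p \<and> smul (int p ^ b) ` localization n p W = smul (int p ^ c) ` N" if p: "p \<in> P" for p
    using X_set_classification[OF n _ sublat_localization[OF W(2)] e[OF p]] P p by blast
  then obtain N b c where N: "\<And>p. p \<in> P \<Longrightarrow> N p \<in> X_set n p"
    "\<And>p. p \<in> P \<Longrightarrow> smul (int p ^ b p) ` localization n p W = smul (int p ^ c p) ` N p" by metis
  have "\<exists>a. \<forall>y\<in>cycles n. smul (int p ^ a) y \<in> N p" if "p \<in> P" for p
    by (rule X(2)[OF that N(1)[OF that]])
  then obtain e' where e': "\<And>p y. p \<in> P \<Longrightarrow> y \<in> cycles n \<Longrightarrow> smul (int p ^ e' p) y \<in> N p"
    by metis
  let ?B = "\<Prod>p\<in>P. int p ^ b p" and ?C = "\<Prod>p\<in>P. int p ^ c p"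
  have "(\<Inter>p\<in>P. localization n p W) = W"
  proof (rule inter_localizations[OF W(2) _ W(4) ne])
    \<comment> \<open>A prime dividing \<open>4 * n\<close> is 2 or divides \<open>n\<close>, hence
      is at most \<open>n\<close>: this is why the prime divisors of \<open>fact n\<close>
      suffice.\<close>
    fix p :: nat assume p: "prime p" "int p dvd 4 * int n"
    then have "p dvd 4 * n" by (metis int_dvd_int_iff of_nat_mult of_nat_numeral)
    then have "p dvd 2 * 2 \<or> p dvd n" using p(1) by (simp add: prime_dvd_mult_iff)
    then have "p \<le> n" using p(1) n(1) prime_dvd_multD[OF p(1), of 2 2] dvd_imp_le[of p 2] dvd_imp_le[of p n] by auto
    then show "p \<in> P" using P p(1) by blast
  qed (use n in auto)
  moreover have "smul ?B ` (\<Inter>p\<in>P. localization n p W) = smul ?C ` (\<Inter>p\<in>P. N p)"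
  proof (rule equalityI)
    show "smul ?B ` (\<Inter>p\<in>P. localization n p W) \<subseteq> smul ?C ` (\<Inter>p\<in>P. N p)"
      by (rule inter_scaling_subset[OF fin ne _ _ _ e' N(2)])
         (use P X(1) N(1) sublat_localization[OF W(2)] in auto)
    show "smul ?C ` (\<Inter>p\<in>P. N p) \<subseteq> smul ?B ` (\<Inter>p\<in>P. localization n p W)"
      by (rule inter_scaling_subset[OF fin ne _ _ _ e N(2)[symmetric]])
         (use P X(1) N(1) sublat_localization[OF W(2)] in auto)
  qed
  ultimately have BC: "smul ?B ` W = smul ?C ` (\<Inter>p\<in>P. N p)" by simp
  have B0: "?B \<noteq> 0" "?C \<noteq> 0" using fin P by auto
  have "smul (?B * (2 * int n)) ` h ` carrier L = smul ?B ` smul d ` W"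
    unfolding U_def[symmetric] W(3)[symmetric] by (simp add: image_smul_smul)
  also have "\<dots> = smul d ` smul ?B ` W" by (simp add: image_smul_smul mult.commute)
  also have "\<dots> = smul (d * ?C) ` (\<Inter>p\<in>P. N p)" by (simp add: BC image_smul_smul)
  finally have scale: "smul (?B * (2 * int n)) ` h ` carrier L = smul (d * ?C) ` (\<Inter>p\<in>P. N p)" .
  have isoN: "sn_iso n \<Z> L ((specht_lattice n)\<lparr>carrier := \<Inter>p\<in>P. N p\<rparr>)"
    by (rule scaled_lattice_iso[OF L _ _ h(2-5) scale]) (use B0 W(1) n in auto)
  show ?thesis
    unfolding P_def[symmetric]
  proof (rule ex1I[of _ "restrict N P"])
    have "(\<Inter>p\<in>P. restrict N P p) = (\<Inter>p\<in>P. N p)" by simp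
    then show "restrict N P \<in> (\<Pi>\<^sub>E p\<in>P. X_set n p) \<and>
        sn_iso n \<Z> L ((specht_lattice n)\<lparr>carrier := \<Inter>p\<in>P. restrict N P p\<rparr>)"
      using isoN N(1) by auto
  next
    fix N' assume N': "N' \<in> (\<Pi>\<^sub>E p\<in>P. X_set n p) \<and> sn_iso n \<Z> L ((specht_lattice n)\<lparr>carrier := \<Inter>p\<in>P. N' p\<rparr>)"
    then have N'X: "N' p \<in> X_set n p" if "p \<in> P" for p using that by auto
    have "\<exists>a. \<forall>y\<in>cycles n. smul (int p ^ a) y \<in> N' p" if "p \<in> P" for p
      by (rule X(2)[OF that N'X[OF that]])
    then obtain f where f: "\<And>p y. p \<in> P \<Longrightarrow> y \<in> cycles n \<Longrightarrow> smul (int p ^ f p) y \<in> N' p"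
      by metis
    have inter: "sublat n (\<Inter>p\<in>P. M p)" if M: "\<And>p. p \<in> P \<Longrightarrow> sublat n (M p)" for M
    proof (rule sublatI)
      show "(\<Inter>p\<in>P. M p) \<subseteq> cycles n" using ne sublat.sub[OF M] by blast
      show "relabel \<sigma> x \<in> (\<Inter>p\<in>P. M p)" if "\<sigma> permutes {1..n}" "x \<in> (\<Inter>p\<in>P. M p)" for \<sigma> x
        using that sublat.relabel[OF M] by blast
    qed (use M in \<open>auto intro: sublat.zero sublat.diff\<close>)
    have sub: "sublat n (N p)" "sublat n (N' p)" if "p \<in> P" for p using X(1) N(1) N'X that by auto
    let ?E = "\<Prod>p\<in>P. int p ^ e' p"
    have mem: "smul ?E y \<in> (\<Inter>p\<in>P. N p)" if y: "y \<in> cycles n" for y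
    proof
      fix p assume p: "p \<in> P"
      have "int p ^ e' p dvd ?E" using fin p by (intro dvd_prodI) auto
      then show "smul ?E y \<in> N p" using sublat.smul_dvd[OF sub(1)[OF p] e'[OF p y]] by blast
    qed
    have E0: "?E \<noteq> 0" using fin P by auto
    \<comment> \<open>The isomorphism of the two intersections is a scalar; below, each prime sees
      only its own part of \<open>r\<close> and \<open>s\<close>.\<close>
    obtain r s where rs: "r \<noteq> 0" "s \<noteq> 0" "smul r ` (\<Inter>p\<in>P. N p) = smul s ` (\<Inter>p\<in>P. N' p)"
      by (rule iso_lattices_proportional[OF n(1) L inter[OF sub(1)] inter[OF sub(2)] E0 mem isoN conjunct2[OF N']])
    have "N p = N' p" if p: "p \<in> P" for p
    proof -
      have pr: "prime p" using P p by blast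
      obtain a r' where r': "r = int p ^ a * r'" "coprime r' (int p)" using prime_power_decompose[OF pr rs(1)] by blast
      obtain b s' where s': "s = int p ^ b * s'" "coprime s' (int p)" using prime_power_decompose[OF pr rs(2)] by blast
      note eq = rs(3)[unfolded r'(1) s'(1)]
      have "smul (int p ^ a) ` N p = smul (int p ^ b) ` N' p"
      proof (rule equalityI)
        show "smul (int p ^ a) ` N p \<subseteq> smul (int p ^ b) ` N' p"
          by (rule inter_proportional_subset[OF fin _ p sub e' f[OF p] equalityD1[OF eq] r'(2) s'(2)])
             (use P in auto)
        show "smul (int p ^ b) ` N' p \<subseteq> smul (int p ^ a) ` N p"
          by (rule inter_proportional_subset[OF fin _ p sub(2,1) f e'[OF p] equalityD2[OF eq] s'(2) r'(2)])
             (use P in auto)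
      qed
      then show ?thesis by (rule X_set_proportional[OF n pr N(1)[OF p] N'X[OF p]])
    qed
    then show "N' = restrict N P" using N' by (auto simp: PiE_iff extensional_def fun_eq_iff)
  qed
qed

end
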